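(* The twist map $\vartheta$ preserves $\mathrm{Fl}_n^{>0}$ and $\mathrm{Fl}_n^{\ge 0}$. For all permutations $v,w\in\mathfrak{S}_n$ with $v\le w$ in Bruhat order, it restricts to a diffeomorphism $\vartheta:C_{v,w}\xrightarrow{\cong}C_{v^{-1},w^{-1}}$.
   Context: $\mathrm{Fl}_n(\mathbb{C})=\mathrm{GL}_n(\mathbb{C})/\mathrm{B}_n(\mathbb{C})$, where $\mathrm{B}_n(\mathbb{C})$ (resp. $\mathrm{B}_n^-(\mathbb{C})$) is the group of invertible upper- (resp. lower-) triangular matrices. $\mathrm{Fl}_n^{>0}$ is the image in $\mathrm{Fl}_n(\mathbb{C})$ of the set of real $n\times n$ matrices all of whose minors are positive, and $\mathrm{Fl}_n^{\ge 0}$ is its closure. A left-justified minor $\Delta_I$ has row set $I$ and column set $\{1,\dots,|I|\}$. Every $V\in\mathrm{Fl}_n^{\ge0}$ is represented by a unique real orthogonal matrix $g$ all of whose left-justified minors are nonnegative; the twist map is $\vartheta(V):=$ the flag represented by $\iota(g):=\delta_ng^{-1}\delta_n$, where $\delta_n=\mathrm{Diag}(1,-1,1,\dots,(-1)^{n-1})$. By the same formula $\vartheta$ extends to a diffeomorphism on an open neighborhood of $\mathrm{Fl}_n^{\ge0}$ in $\mathrm{Fl}_n(\mathbb{R})$, namely the image of $S\cap\iota(S)$, where $S$ is the set of orthogonal $g$ with $\sum_{|I|=k}\Delta_I(g)>0$ for $1\le k\le n$. Bruhat order on the symmetric group $\mathfrak{S}_n$: $v\le w$ iff for each $1\le k\le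 n-1$, writing the sets $v(\{1,\dots,k\})$ and $w(\{1,\dots,k\})$ in increasing order, the former is componentwise $\le$ the latter. For $w\in\mathfrak{S}_n$, $\mathring{w}$ is the signed permutation matrix with $(w(j),j)$ entries $\pm1$ (other entries $0$), the signs chosen so that all left-justified minors are nonnegative; it is also regarded as an element of $\mathrm{Fl}_n(\mathbb{C})$. For $v\le w$, $C_{v,w}:=(\mathrm{B}_n^-(\mathbb{C})\cdot\mathring v)\cap(\mathrm{B}_n(\mathbb{C})\cdot\mathring w)\cap\mathrm{Fl}_n^{\ge0}$. *)

theory Defs
  imports "HOL-Analysis.Analysis" "HOL-Combinatorics.Permutations"
    "Jordan_Normal_Form.Determinant"
begin

text \<open>
  The index set \<open>{1,\<dots>,n}\<close> is a type \<open>'n\<close> of class finite and linorder; the dimension is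
  \<open>n = CARD('n)\<close>, and every \<open>n \<ge> 1\<close> arises.  Matrices and their algebra are those of HOL-Analysis.
  The matrix type of Jordan_Normal_Form is used only for the determinant of a submatrix, whose
  size is not given by a type.
\<close>

no_notation vec_index (infixl "$" 100)
hide_const (open) Matrix.mat Determinant.det Matrix.vec

type_synonym ('a, 'n) sqmat = "'a ^ 'n ^ 'n"

subsection \<open>Minors\<close>

text \<open>The set of the \<open>k\<close> smallest indices, that is, \<open>{1,\<dots>,k}\<close>.\<close>

definition initial :: "nat \<Rightarrow> 'n::{finite,linorder} set" where
  "initial k = {j. card {..<j} < k}"

text \<open>Only meaningful when \<open>card I = card J\<close>. The empty minor is \<open>1\<close>.\<close>

definition minor ::
  "('a::comm_ring_1, 'n::{finite,linorder}) sqmat \<Rightarrow> 'n set \<Rightarrow> 'n set \<Rightarrow> 'a" where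
  "minor A I J = Determinant.det (Matrix.mat (card I) (card I)
     (\<lambda>(i, j). A $ (sorted_list_of_set I ! i) $ (sorted_list_of_set J ! j)))"

definition left_minor ::
  "('a::comm_ring_1, 'n::{finite,linorder}) sqmat \<Rightarrow> 'n set \<Rightarrow> 'a" where
  "left_minor A I = minor A I (initial (card I))"

definition totally_positive :: "(real, 'n::{finite,linorder}) sqmat \<Rightarrow> bool" where
  "totally_positive A \<longleftrightarrow> (\<forall>I J. card I = card J \<longrightarrow> minor A I J > 0)"

subsection \<open>The complete flag variety\<close>

definition upper_B :: "('a::field, 'n::{finite,linorder}) sqmat set" where
  "upper_B = {b. invertible b \<and> (\<forall>i j. j < i \<longrightarrow> b $ i $ j = 0)}"

definition lower_B :: "('a::field, 'n::{finite,linorder}) sqmat set" where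
  "lower_B = {b. invertible b \<and> (\<forall>i j. i < j \<longrightarrow> b $ i $ j = 0)}"

text \<open>A point of \<open>GL\<^sub>n(\<complex>)/B\<^sub>n(\<complex>)\<close> is a left coset of \<open>B\<^sub>n(\<complex>)\<close>.\<close>

type_synonym 'n flag = "(complex, 'n) sqmat set"

definition GL :: "('a::field, 'n::{finite,linorder}) sqmat set" where
  "GL = {g. invertible g}"

definition flag :: "(complex, 'n::{finite,linorder}) sqmat \<Rightarrow> 'n flag" where
  "flag g = {g ** b | b. b \<in> upper_B}"

definition flag_variety :: "'n::{finite,linorder} flag set" where
  "flag_variety = flag ` GL"

text \<open>The quotient topology of \<open>GL\<^sub>n(\<complex>)/B\<^sub>n(\<complex>)\<close>.\<close>

definition flag_topology :: "'n::{finite,linorder} flag topology" where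
  "flag_topology = topology (\<lambda>U. U \<subseteq> flag_variety \<and>
     openin (top_of_set GL) {g \<in> GL. flag g \<in> U})"

lemma openin_flag_topology:
  "openin flag_topology U \<longleftrightarrow>
     U \<subseteq> flag_variety \<and> openin (top_of_set GL) {g \<in> GL. flag g \<in> U}"
proof -
  have "istopology (\<lambda>U :: 'a flag set. U \<subseteq> flag_variety \<and>
     openin (top_of_set GL) {g \<in> GL. flag g \<in> U})"
    unfolding istopology_def
  proof (rule conjI, intro allI impI, goal_cases)
    case (1 S T)
    have "{g \<in> GL. flag g \<in> S \<inter> T} = {g \<in> GL. flag g \<in> S} \<inter> {g \<in> GL. flag g \<in> T}"
      by auto
    with 1 show ?case by auto
  next
    case 2
    show ?case
    proof (intro allI impI, goal_cases)
      case (1 \<K>)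
      have "{g \<in> GL. flag g \<in> \<Union>\<K>} = (\<Union>K\<in>\<K>. {g \<in> GL. flag g \<in> K})"
        by auto
      with 1 show ?case by auto
    qed
  qed
  then show ?thesis
    unfolding flag_topology_def by (simp add: topology_inverse')
qed

lemma topspace_flag_topology:
  "topspace flag_topology = (flag_variety :: 'n::{finite,linorder} flag set)"
proof -
  have "{g \<in> GL. flag g \<in> (flag_variety :: 'n flag set)} = GL"
    by (auto simp: flag_variety_def)
  then have "openin flag_topology (flag_variety :: 'n flag set)"
    by (simp add: openin_flag_topology)
  then show ?thesis
    by (meson openin_flag_topology openin_subset openin_topspace subset_antisym)
qed

lemma quotient_map_flag: "quotient_map (top_of_set GL) flag_topology flag"
  by (auto simp: quotient_map_def topspace_flag_topology openin_flag_topology flag_variety_def)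

definition complexify :: "(real, 'n::finite) sqmat \<Rightarrow> (complex, 'n) sqmat" where
  "complexify A = (\<chi> i j. complex_of_real (A $ i $ j))"

text \<open>The image in \<open>Fl\<^sub>n(\<complex>)\<close> of a real matrix; \<open>Fl\<^sub>n(\<real>)\<close> is identified with
  \<open>real_flag ` GL\<close>.\<close>

definition real_flag :: "(real, 'n::{finite,linorder}) sqmat \<Rightarrow> 'n flag" where
  "real_flag g = flag (complexify g)"

definition flags_pos :: "'n::{finite,linorder} flag set" where
  "flags_pos = real_flag ` {A. totally_positive A}"

definition flags_nonneg :: "'n::{finite,linorder} flag set" where
  "flags_nonneg = flag_topology closure_of flags_pos"

subsection \<open>The twist map\<close>

definition delta :: "(real, 'n::{finite,linorder}) sqmat" where
  "delta = (\<chi> i j. if i = j then (-1) ^ card {..<i} else 0)"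

definition iota :: "(real, 'n::{finite,linorder}) sqmat \<Rightarrow> (real, 'n) sqmat" where
  "iota g = delta ** matrix_inv g ** delta"

text \<open>For \<open>V \<in> flags_nonneg\<close> such a representative exists and is unique; elsewhere the value of
  the twist is irrelevant.\<close>

definition orth_rep :: "'n::{finite,linorder} flag \<Rightarrow> (real, 'n) sqmat" where
  "orth_rep V = (THE g. orthogonal_matrix g \<and> (\<forall>I. left_minor g I \<ge> 0) \<and> real_flag g = V)"

definition twist :: "'n::{finite,linorder} flag \<Rightarrow> 'n flag" where
  "twist V = real_flag (iota (orth_rep V))"

subsection \<open>Bruhat order and the cell decomposition\<close>

definition bruhat_le ::
  "('n::{finite,linorder} \<Rightarrow> 'n) \<Rightarrow> ('n \<Rightarrow> 'n) \<Rightarrow> bool" where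
  "bruhat_le v w \<longleftrightarrow> (\<forall>k\<in>{1..CARD('n) - 1}.
     list_all2 (\<le>) (sorted_list_of_set (v ` initial k)) (sorted_list_of_set (w ` initial k)))"

definition signed_perm :: "('n::{finite,linorder} \<Rightarrow> 'n) \<Rightarrow> (real, 'n) sqmat" where
  "signed_perm w = (THE A.
     (\<forall>i j. if i = w j then A $ i $ j \<in> {1, -1} else A $ i $ j = 0) \<and>
     (\<forall>I. left_minor A I \<ge> 0))"

definition cell ::
  "('n::{finite,linorder} \<Rightarrow> 'n) \<Rightarrow> ('n \<Rightarrow> 'n) \<Rightarrow> 'n flag set" where
  "cell v w = {flag (b ** complexify (signed_perm v)) | b. b \<in> lower_B} \<inter>
              {flag (b ** complexify (signed_perm w)) | b. b \<in> upper_B} \<inter>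
              flags_nonneg"

subsection \<open>Smooth maps between subsets of the real flag variety\<close>

primrec Ck_on ::
  "nat \<Rightarrow> ('a::real_normed_vector \<Rightarrow> 'b::real_normed_vector) \<Rightarrow> 'a set \<Rightarrow> bool" where
  "Ck_on 0 f S \<longleftrightarrow> continuous_on S f"
| "Ck_on (Suc k) f S \<longleftrightarrow> (\<forall>x\<in>S. f differentiable at x) \<and>
     (\<forall>v. Ck_on k (\<lambda>x. frechet_derivative f (at x) v) S)"

text \<open>To be used on open sets of finite-dimensional spaces only.\<close>

definition smooth_on ::
  "('a::euclidean_space \<Rightarrow> 'b::euclidean_space) \<Rightarrow> 'a set \<Rightarrow> bool" where
  "smooth_on f S \<longleftrightarrow> (\<forall>k. Ck_on k f S)"

text \<open>The standard atlas of \<open>Fl\<^sub>n(\<real>)\<close>: for \<open>g \<in> GL\<^sub>n(\<real>)\<close>, the vector space of strictly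
  lower-triangular matrices is mapped bijectively onto an open set (a translate of the opposite
  big cell).\<close>

definition strictly_lower :: "(real, 'n::{finite,linorder}) sqmat set" where
  "strictly_lower = {x. \<forall>i j. i \<le> j \<longrightarrow> x $ i $ j = 0}"

definition flag_chart ::
  "(real, 'n::{finite,linorder}) sqmat \<Rightarrow> (real, 'n) sqmat \<Rightarrow> 'n flag" where
  "flag_chart g x = real_flag (g ** (Finite_Cartesian_Product.mat 1 + x))"

text \<open>A map defined on an arbitrary subset \<open>A\<close> of the manifold \<open>Fl\<^sub>n(\<real>)\<close> is smooth if near every
  point of \<open>A\<close> it is the restriction of a smooth map defined on an open subset of \<open>Fl\<^sub>n(\<real>)\<close>. This
  is expressed in charts; when \<open>A\<close> is an embedded submanifold it is smoothness on \<open>A\<close>. A smooth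
  function on an open set of strictly lower-triangular matrices is given by a smooth function on
  an open set of all matrices.\<close>

definition flag_smooth_on ::
  "('n::{finite,linorder} flag \<Rightarrow> 'n flag) \<Rightarrow> 'n flag set \<Rightarrow> bool" where
  "flag_smooth_on f A \<longleftrightarrow> (\<forall>V\<in>A. \<exists>g\<in>GL. \<exists>h\<in>GL. \<exists>x0\<in>strictly_lower. flag_chart g x0 = V \<and>
     (\<exists>W F. open W \<and> x0 \<in> W \<and> smooth_on F W \<and> F ` W \<subseteq> strictly_lower \<and>
        (\<forall>x \<in> W \<inter> strictly_lower. flag_chart g x \<in> A \<longrightarrow>
           f (flag_chart g x) = flag_chart h (F x))))"

definition flag_diffeomorphism ::
  "('n::{finite,linorder} flag \<Rightarrow> 'n flag) \<Rightarrow> 'n flag set \<Rightarrow> 'n flag set \<Rightarrow> bool" where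
  "flag_diffeomorphism f A B \<longleftrightarrow>
     bij_betw f A B \<and> flag_smooth_on f A \<and> flag_smooth_on (inv_into A f) B"

end

(*
  Represent flags by orthogonal matrices g. If all left-justified minors of g are positive and
  g Y = L with Y upper- and L unit lower-triangular, then orthogonality gives Y^T = L^T g. Minors
  of Y^T with an interval of rows and the first m columns are sums of products of nonnegative minors
  of L and positive minors of g, so Fekete's criterion makes all left-justified minors of Y^T
  positive; being lower triangular, Y^T then has positive bottom-justified minors by the same
  criterion, and these are the bottom-justified minors of g. Jacobi's complementary minor formula
  turns them into the left-justified minors of iota(g). The flags with such a representative g
  are exactly the totally positive ones: multiply g by a suitable upper-triangular matrix whose rows
  decrease rapidly. Compactness of the orthogonal group carries this over to the closure.
  On the cells, transposition and inversion of k = b v c, which give the same matrix for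
  orthogonal k, exchange the roles of the triangular factors. Smoothness follows from explicit
  formulas: Gram-Schmidt for the representative and Cramer's rule for the chart.
*)

theory Submission
  imports Defs
begin

subsection \<open>The Cauchy--Binet formula\<close>

text \<open>No totally positive matrix is ever constructed. The converse inclusion in
  \<open>flags_pos_eq\<close> uses an upper-triangular factor of some totally positive matrix, and
  that matrix comes from \<open>flags_pos\<close> being nonempty; if it is empty, so are its closure
  and all cells, and there is nothing to prove.

  On the closure individual left-justified minors may vanish, so they cannot fix the signs of a
  representative in a stable way. For an orthogonal matrix the squares of the left-justified minors
  of one size sum to 1, so nonnegativity forces the sum of these minors to be strictly positive.
  Positivity of the sums already determines the orthogonal representative, and it persists under
  small perturbations, as smoothness requires.

  On orthogonal matrices \<open>iota\<close> is an involution, so the twist is its own inverse on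
  nonnegative flags, and a single smoothness statement serves both directions of the
  diffeomorphism.\<close>

abbreviation tr :: "'a ^ 'n ^ 'm \<Rightarrow> 'a ^ 'm ^ 'n" where
  "tr \<equiv> Finite_Cartesian_Product.transpose"

text \<open>Lists, unlike sets, may be out of order or have repetitions, so that the sign of a
  reordering and the vanishing for a repeated row can be expressed.\<close>

definition list_minor :: "('a::comm_ring_1, 'n::{finite,linorder}) sqmat \<Rightarrow> 'n list \<Rightarrow> 'n list \<Rightarrow> 'a" where
  "list_minor A rs cs = Determinant.det (Matrix.mat (length rs) (length rs) (\<lambda>(i, j). A $ (rs ! i) $ (cs ! j)))"

lemma minor_eq_list_minor:
  "minor A I J = list_minor A (sorted_list_of_set I) (sorted_list_of_set J)"
  by (simp add: minor_def list_minor_def)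

lemma list_minor_transpose:
  assumes "length rs = length cs"
  shows "list_minor (tr A) cs rs = list_minor A rs cs"
proof -
  let ?M = "Matrix.mat (length rs) (length rs) (\<lambda>(i, j). A $ (rs ! i) $ (cs ! j))"
  have "Matrix.mat (length cs) (length cs) (\<lambda>(i, j). tr A $ (cs ! i) $ (rs ! j))
      = transpose_mat ?M"
    using assms by (intro eq_matI) (auto simp: Finite_Cartesian_Product.transpose_def)
  then show ?thesis
    unfolding list_minor_def by (metis Determinant.det_transpose mat_carrier)
qed

lemma minor_transpose:
  assumes "card I = card J"
  shows "minor (tr A) J I = minor A I J"
  by (simp add: minor_eq_list_minor list_minor_transpose assms)

lemma list_minor_eq_0_row:
  assumes "r \<in> set rs" and "length rs = length cs" and "\<And>c. c \<in> set cs \<Longrightarrow> A $ r $ c = 0"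
  shows "list_minor A rs cs = 0"
proof -
  obtain i where i: "i < length rs" "rs ! i = r"
    using assms(1) by (auto simp: in_set_conv_nth)
  have "(\<Prod>k = 0..<length rs. A $ (rs ! k) $ (cs ! p k)) = 0" if "p permutes {0..<length rs}" for p
  proof (rule prod_zero)
    have "p i < length rs"
      using permutes_in_image[OF that, of i] i by simp
    then show "\<exists>k\<in>{0..<length rs}. A $ (rs ! k) $ (cs ! p k) = 0"
      using i assms by (intro bexI[of _ i]) auto
  qed simp
  then have "(\<Sum>p\<in>{p. p permutes {0..<length rs}}. signof p * (\<Prod>k = 0..<length rs. A $ (rs ! k) $ (cs ! p k))) = 0"
    by (intro sum.neutral) simp
  moreover have "list_minor A rs cs = (\<Sum>p\<in>{p. p permutes {0..<length rs}}. signof p * (\<Prod>k = 0..<length rs. A $ (rs ! k) $ (cs ! p k)))"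
    unfolding list_minor_def by (subst det_def'[of _ "length rs"]) (auto intro!: sum.cong prod.cong simp: permutes_in_image)
  ultimately show ?thesis by simp
qed

lemma minor_eq_0_row:
  assumes "r \<in> I" "card I = card J" "\<And>c. c \<in> J \<Longrightarrow> A $ r $ c = 0"
  shows "minor A I J = 0"
  unfolding minor_eq_list_minor using assms by (intro list_minor_eq_0_row[of r]) auto

lemma minor_eq_0_col:
  assumes "c \<in> J" "card I = card J" "\<And>r. r \<in> I \<Longrightarrow> A $ r $ c = 0"
  shows "minor A I J = 0"
proof -
  have "minor (tr A) J I = 0"
    using assms by (intro minor_eq_0_row[of c]) (auto simp: Finite_Cartesian_Product.transpose_def)
  then show ?thesis by (simp add: minor_transpose assms(2))
qed

lemma list_minor_expand:
  "list_minor A rs cs = (\<Sum>p\<in>{p. p permutes {0..<length rs}}.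
     signof p * (\<Prod>k\<in>{0..<length rs}. A $ (rs ! k) $ (cs ! p k)))"
  unfolding list_minor_def
  by (subst det_def'[of _ "length rs"]) (auto intro!: sum.cong prod.cong simp: permutes_in_image)

lemma list_minor_permute_rows:
  assumes "p permutes {0..<length rs}"
  shows "list_minor A (map (\<lambda>i. rs ! p i) [0..<length rs]) cs = signof p * list_minor A rs cs"
proof -
  have "Matrix.mat (length rs) (length rs) (\<lambda>(i, j). A $ (map (\<lambda>i. rs ! p i) [0..<length rs] ! i) $ (cs ! j))
    = Matrix.mat (length rs) (length rs) (\<lambda>(i, j). Matrix.mat (length rs) (length rs) (\<lambda>(i, j). A $ (rs ! i) $ (cs ! j)) $$ (p i, j))"
    using permutes_in_image[OF assms] by (intro eq_matI) auto
  then show ?thesis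
    unfolding list_minor_def
    by (simp add: det_permute_rows[OF _ assms, of "Matrix.mat (length rs) (length rs) (\<lambda>(i, j). A $ (rs ! i) $ (cs ! j))"])
qed

lemma list_minor_not_distinct:
  assumes "\<not> distinct rs"
  shows "list_minor A rs cs = 0"
proof -
  obtain i j where "i < length rs" "j < length rs" "i \<noteq> j" "rs ! i = rs ! j"
    using assms by (auto simp: distinct_conv_nth)
  then show ?thesis
    unfolding list_minor_def
    by (intro det_identical_rows[of _ "length rs" i j]) (auto simp: Matrix.row_def)
qed

text \<open>Multilinearity in the rows: each row of \<open>A ** B\<close> is a combination of rows
  of \<open>B\<close>, and \<open>f\<close> records which row of \<open>B\<close> is picked for each
  of them.\<close>

lemma list_minor_mult_expand:
  fixes A B :: "('a::comm_ring_1, 'n::{finite,linorder}) sqmat"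
  shows "list_minor (A ** B) rs cs = (\<Sum>f\<in>{0..<length rs} \<rightarrow>\<^sub>E (UNIV :: 'n set).
     (\<Prod>k\<in>{0..<length rs}. A $ (rs ! k) $ f k) * list_minor B (map f [0..<length rs]) cs)"
proof -
  let ?N = "{0..<length rs}"
  have "list_minor (A ** B) rs cs = (\<Sum>p\<in>{p. p permutes ?N}.
     signof p * (\<Prod>k\<in>?N. \<Sum>m\<in>UNIV. A $ (rs ! k) $ m * B $ m $ (cs ! p k)))"
    by (simp add: list_minor_expand matrix_matrix_mult_def)
  also have "\<dots> = (\<Sum>p\<in>{p. p permutes ?N}. \<Sum>f\<in>?N \<rightarrow>\<^sub>E UNIV.
     signof p * (\<Prod>k\<in>?N. A $ (rs ! k) $ f k * B $ f k $ (cs ! p k)))"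
    by (simp add: prod_sum_PiE sum_distrib_left)
  also have "\<dots> = (\<Sum>f\<in>?N \<rightarrow>\<^sub>E UNIV. \<Sum>p\<in>{p. p permutes ?N}.
     signof p * (\<Prod>k\<in>?N. A $ (rs ! k) $ f k * B $ f k $ (cs ! p k)))"
    by (rule sum.swap)
  also have "\<dots> = (\<Sum>f\<in>?N \<rightarrow>\<^sub>E UNIV.
     (\<Prod>k\<in>?N. A $ (rs ! k) $ f k) * list_minor B (map f [0..<length rs]) cs)"
    by (auto simp: list_minor_expand prod.distrib sum_distrib_left mult.left_commute intro!: sum.cong)
  finally show ?thesis .
qed

text \<open>In the multilinear expansion a non-injective \<open>f\<close> repeats a row of
  \<open>B\<close> and contributes nothing. An injective \<open>f\<close> amounts to its image
  \<open>K\<close> with a permutation of the sorted list of \<open>K\<close>; the sign of that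
  permutation turns the products of entries of \<open>A\<close> into
  \<open>minor A I K\<close>.\<close>

lemma cauchy_binet:
  fixes A B :: "('a::comm_ring_1, 'n::{finite,linorder}) sqmat"
  shows "minor (A ** B) I J = (\<Sum>K | card K = card I. minor A I K * minor B K J)"
proof -
  define rs where "rs = sorted_list_of_set I"
  define cs where "cs = sorted_list_of_set J"
  define n where "n = length rs"
  let ?N = "{0..<n}"
  let ?G = "\<lambda>f. (\<Prod>k\<in>?N. A $ (rs ! k) $ f k) * list_minor B (map f [0..<n]) cs"
  let ?S = "sorted_list_of_set :: 'n set \<Rightarrow> 'n list"
  let ?h = "\<lambda>(K, p). restrict (\<lambda>i. ?S K ! p i) ?N"
  have n: "n = card I" by (simp add: n_def rs_def)
  have zero: "?G f = 0" if "\<not> inj_on f ?N" for f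
  proof -
    have "\<not> distinct (map f [0..<n])" using that by (simp add: distinct_map)
    then have "list_minor B (map f [0..<n]) cs = 0" by (rule list_minor_not_distinct)
    then show ?thesis by simp
  qed
  have bij: "bij_betw ?h ({K. card K = n} \<times> {p. p permutes ?N}) {f \<in> ?N \<rightarrow>\<^sub>E UNIV. inj_on f ?N}"
  proof (rule bij_betw_imageI)
    have img: "?h (K, p) ` ?N = K" if "card K = n" "p permutes ?N" for K :: "'n set" and p
    proof -
      have "?h (K, p) ` ?N = (!) (?S K) ` (p ` ?N)" by (auto simp: image_image)
      also have "\<dots> = (!) (?S K) ` {0..<length (?S K)}" using that by (simp add: permutes_image)
      also have "\<dots> = set (?S K)" by (metis atLeast0LessThan list.set_map map_nth set_upt)
      finally show ?thesis by simp
    qed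
    show "inj_on ?h ({K. card K = n} \<times> {p. p permutes ?N})"
    proof (rule inj_onI)
      fix x y assume xy: "x \<in> {K. card K = n} \<times> {p. p permutes ?N}" "y \<in> {K. card K = n} \<times> {p. p permutes ?N}" "?h x = ?h y"
      obtain K p L q where eq: "x = (K, p)" "y = (L, q)" by fastforce
      with xy have *: "card K = n" "p permutes ?N" "card L = n" "q permutes ?N" "?h (K, p) = ?h (L, q)" by auto
      then have KL: "K = L" using img by metis
      have "p i = q i" for i
      proof (cases "i < n")
        case True
        then have "?S K ! p i = ?S K ! q i" using fun_cong[OF *(5), of i] KL by simp
        moreover have "p i < length (?S K)" "q i < length (?S K)"
          using True * permutes_in_image[OF *(2), of i] permutes_in_image[OF *(4), of i] by simp_all
        ultimately show ?thesis by (meson distinct_sorted_list_of_set nth_eq_iff_index_eq)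
      next
        case False
        then show ?thesis using * by (simp add: permutes_not_in)
      qed
      then show "x = y" using KL eq by auto
    qed
    show "?h ` ({K. card K = n} \<times> {p. p permutes ?N}) = {f \<in> ?N \<rightarrow>\<^sub>E UNIV. inj_on f ?N}"
    proof (intro equalityI subsetI)
      fix f assume "f \<in> ?h ` ({K. card K = n} \<times> {p. p permutes ?N})"
      then obtain K p where *: "card (K :: 'n set) = n" "p permutes ?N" "f = ?h (K, p)" by auto
      have "card (f ` ?N) = card ?N" using * img by simp
      then have "inj_on f ?N" by (intro eq_card_imp_inj_on) auto
      then show "f \<in> {f \<in> ?N \<rightarrow>\<^sub>E UNIV. inj_on f ?N}" using * by auto
    next
      fix f assume f: "f \<in> {f \<in> ?N \<rightarrow>\<^sub>E (UNIV :: 'n set). inj_on f ?N}"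
      define K where "K = f ` ?N"
      have K: "card K = n" using f by (simp add: K_def card_image)
      \<comment> \<open>The permutation sends \<open>i\<close> to the place of \<open>f i\<close> in
        the sorted image; it is the identity beyond \<open>n\<close> because \<open>permutes\<close>
        demands it.\<close>
      define p where "p i = (if i < n then THE j. j < n \<and> ?S K ! j = f i else i)" for i
      have ex1: "\<exists>!j. j < n \<and> ?S K ! j = f i" if "i < n" for i
      proof -
        have "f i \<in> set (?S K)" using that by (auto simp: K_def)
        then obtain j where "j < n" "?S K ! j = f i" using K unfolding in_set_conv_nth by auto
        then show ?thesis using K by (metis distinct_sorted_list_of_set length_sorted_list_of_set nth_eq_iff_index_eq)
      qed
      have p: "p i < n \<and> ?S K ! p i = f i" if "i < n" for i
        using theI'[OF ex1[OF that]] that by (simp add: p_def)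
      have "inj_on p ?N"
      proof (rule inj_onI)
        fix i j assume "i \<in> ?N" "j \<in> ?N" "p i = p j"
        then have "f i = f j" using p[of i] p[of j] by simp
        then show "i = j" using f \<open>i \<in> ?N\<close> \<open>j \<in> ?N\<close> by (auto dest: inj_onD)
      qed
      moreover have "p ` ?N \<subseteq> ?N" using p by auto
      ultimately have "bij_betw p ?N ?N"
        by (simp add: bij_betw_def endo_inj_surj)
      then have "p permutes ?N" by (rule bij_imp_permutes) (simp add: p_def)
      moreover have "?h (K, p) = f" using f p by (auto simp: restrict_def PiE_def extensional_def)
      ultimately show "f \<in> ?h ` ({K. card K = n} \<times> {p. p permutes ?N})" using K by force
    qed
  qed
  have step: "?G (?h (K, p)) = (signof p * (\<Prod>k\<in>?N. A $ (rs ! k) $ (?S K ! p k))) * minor B K J"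
    if "card K = n" "p permutes ?N" for K p
  proof -
    have "map (?h (K, p)) [0..<n] = map (\<lambda>i. ?S K ! p i) [0..<length (?S K)]"
      using that by simp
    moreover have "list_minor B (map (\<lambda>i. ?S K ! p i) [0..<length (?S K)]) cs = signof p * minor B K J"
      using list_minor_permute_rows[of p "?S K" B cs] that by (simp add: minor_eq_list_minor cs_def)
    ultimately have "list_minor B (map (?h (K, p)) [0..<n]) cs = signof p * minor B K J"
      by metis
    then show ?thesis by (simp add: mult.assoc mult.left_commute)
  qed
  have "minor (A ** B) I J = (\<Sum>f\<in>?N \<rightarrow>\<^sub>E (UNIV :: 'n set). ?G f)"
    unfolding minor_eq_list_minor list_minor_mult_expand rs_def cs_def n_def ..
  also have "\<dots> = (\<Sum>f\<in>{f \<in> ?N \<rightarrow>\<^sub>E UNIV. inj_on f ?N}. ?G f)"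
    using zero by (intro sum.mono_neutral_right) (auto intro: finite_PiE)
  also have "\<dots> = (\<Sum>Kp\<in>{K. card K = n} \<times> {p. p permutes ?N}. ?G (?h Kp))"
    using sum.reindex_bij_betw[OF bij, of ?G] by simp
  also have "\<dots> = (\<Sum>(K, p)\<in>{K. card K = n} \<times> {p. p permutes ?N}.
      (signof p * (\<Prod>k\<in>?N. A $ (rs ! k) $ (?S K ! p k))) * minor B K J)"
    using step by (intro sum.cong) auto
  also have "\<dots> = (\<Sum>K | card K = n. \<Sum>p | p permutes ?N.
      (signof p * (\<Prod>k\<in>?N. A $ (rs ! k) $ (?S K ! p k))) * minor B K J)"
    by (subst sum.cartesian_product) auto
  also have "\<dots> = (\<Sum>K | card K = n. minor A I K * minor B K J)"
    by (simp add: sum_distrib_right minor_eq_list_minor list_minor_expand rs_def[symmetric] n_def[symmetric])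
  finally show ?thesis by (simp add: n)
qed

subsection \<open>The three-term relation and Fekete's criterion\<close>

text \<open>Ranks start at 0, so \<open>pos\<close> is the exponent in \<open>delta\<close>, and
  \<open>initial (pos j)\<close> excludes \<open>j\<close>.\<close>

abbreviation pos :: "'n::{finite,linorder} \<Rightarrow> nat" where
  "pos j \<equiv> card {..<j}"

lemma pos_less_iff: "pos i < pos j \<longleftrightarrow> i < (j :: 'n::{finite,linorder})"
proof
  assume "i < j"
  then have "{..<i} \<subset> {..<j}" by auto
  then show "pos i < pos j" by (intro psubset_card_mono) auto
next
  assume *: "pos i < pos j"
  show "i < j"
  proof (rule ccontr)
    assume "\<not> i < j"
    then have "pos j \<le> pos i" by (intro card_mono) auto
    with * show False by simp
  qed
qed

lemma pos_le_iff: "pos i \<le> pos j \<longleftrightarrow> i \<le> (j :: 'n::{finite,linorder})"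
  by (meson linorder_not_less pos_less_iff)

lemma bij_pos: "bij_betw pos (UNIV :: 'n::{finite,linorder} set) {..<CARD('n)}"
proof -
  have "inj (pos :: 'n \<Rightarrow> nat)"
    by (intro injI) (metis linorder_neq_iff pos_less_iff)
  moreover have "pos i < CARD('n)" for i :: 'n
    by (intro psubset_card_mono) auto
  ultimately show ?thesis
    by (simp add: bij_betw_def card_image card_subset_eq image_subset_iff)
qed

lemma inj_pos: "inj (pos :: 'n::{finite,linorder} \<Rightarrow> nat)"
  by (rule bij_betw_imp_inj_on[OF bij_pos])

lemma mem_initial: "j \<in> initial m \<longleftrightarrow> pos j < m"
  by (simp add: initial_def)

lemma card_initial: "card (initial m :: 'n::{finite,linorder} set) = min m CARD('n)"
proof -
  have "pos ` (initial m :: 'n set) = {..<min m CARD('n)}"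
  proof (intro equalityI subsetI)
    fix x assume "x \<in> {..<min m CARD('n)}"
    then obtain j :: 'n where "x = pos j" using bij_pos by (auto simp: bij_betw_def image_def set_eq_iff)
    then show "x \<in> pos ` (initial m :: 'n set)" using \<open>x \<in> _\<close> by (auto simp: mem_initial)
  qed (use bij_pos in \<open>auto simp: mem_initial bij_betw_def\<close>)
  then show ?thesis
    by (metis card_image card_lessThan inj_on_subset inj_pos subset_UNIV)
qed

lemma card_le_CARD: "card (I :: 'n::finite set) \<le> CARD('n)"
  by (simp add: card_mono)

lemma initial_pos: "initial (pos j) = {..<j}"
  by (auto simp: mem_initial pos_less_iff)

lemma initial_Suc_pos: "initial (Suc (pos j)) = insert j {..<j}"
  by (auto simp: mem_initial less_Suc_eq_le pos_le_iff)

section \<open>Signs from moving rows and columns of a determinant\<close>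

lemma sorted_list_of_set_eqI:
  assumes "sorted_wrt (<) xs" "set xs = A"
  shows "sorted_list_of_set A = xs"
  using assms by (metis sorted_list_of_set.idem_if_sorted_distinct strict_sorted_iff)

lemma mat_of_cols_square: "length vs = k \<Longrightarrow> mat_of_cols k vs \<in> carrier_mat k k"
  using mat_of_cols_carrier(1) by blast

lemma det_mat_of_cols_swap:
  assumes "k = length xs + length ys + 2"
  shows "Determinant.det (mat_of_cols k (xs @ a # b # ys)) = - Determinant.det (mat_of_cols k (xs @ b # a # ys))"
proof -
  let ?i = "length xs"
  let ?M = "mat_of_cols k (xs @ b # a # ys)"
  have "mat_of_cols k (xs @ a # b # ys) = swapcols ?i (Suc ?i) ?M"
  proof (rule eq_matI)
    fix r j assume rj: "r < dim_row (swapcols ?i (Suc ?i) ?M)" "j < dim_col (swapcols ?i (Suc ?i) ?M)"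
    consider "j < ?i" | "j = ?i" | "j = Suc ?i" | "Suc ?i < j" by linarith
    then show "mat_of_cols k (xs @ a # b # ys) $$ (r, j) = swapcols ?i (Suc ?i) ?M $$ (r, j)"
    proof cases
      case 4
      then obtain d where "j = Suc (Suc (?i + d))" by (metis add_Suc less_iff_Suc_add)
      then show ?thesis using rj assms by (simp add: mat_of_cols_index nth_append)
    qed (use rj assms in \<open>simp_all add: mat_of_cols_index nth_append\<close>)
  qed simp_all
  moreover have "?M \<in> carrier_mat k k" by (rule mat_of_cols_square) (simp add: assms)
  ultimately show ?thesis
    by (simp only:) (rule det_swapcols, use assms in simp_all)
qed

lemma det_mat_of_cols_move:
  assumes "k = length xs + length ys + 1"
  shows "Determinant.det (mat_of_cols k (xs @ a # ys)) = (-1) ^ length xs * Determinant.det (mat_of_cols k (a # xs @ ys))"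
  using assms
proof (induction xs arbitrary: ys rule: rev_induct)
  case (snoc z zs)
  have "Determinant.det (mat_of_cols k ((zs @ [z]) @ a # ys)) = - Determinant.det (mat_of_cols k (zs @ a # z # ys))"
    using snoc.prems det_mat_of_cols_swap[of k zs ys z a] by simp
  also have "Determinant.det (mat_of_cols k (zs @ a # z # ys)) = (-1) ^ length zs * Determinant.det (mat_of_cols k (a # zs @ z # ys))"
    using snoc.prems by (intro snoc.IH) simp
  finally show ?case by simp
qed simp

definition column_of :: "('a::comm_ring_1, 'n::{finite,linorder}) sqmat \<Rightarrow> 'n list \<Rightarrow> 'n \<Rightarrow> 'a Matrix.vec" where
  "column_of A rs c = Matrix.vec (length rs) (\<lambda>i. A $ (rs ! i) $ c)"

lemma list_minor_eq_mat_of_cols: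
  assumes "length rs = length cs"
  shows "list_minor A rs cs = Determinant.det (mat_of_cols (length rs) (map (column_of A rs) cs))"
proof -
  have "Matrix.mat (length rs) (length rs) (\<lambda>(i, j). A $ (rs ! i) $ (cs ! j)) = mat_of_cols (length rs) (map (column_of A rs) cs)"
    using assms by (intro eq_matI) (auto simp: mat_of_cols_index column_of_def)
  then show ?thesis by (simp add: list_minor_def)
qed

text \<open>Both sides are compared with the arrangement that has \<open>a\<close> in front; the
  sign of crossing \<open>xs\<close> is common to both, which leaves that of
  \<open>ys\<close>.\<close>

lemma list_minor_move_col:
  assumes "length rs = length xs + length ys + length zs + 1"
  shows "list_minor A rs (xs @ ys @ a # zs) = (-1) ^ length ys * list_minor A rs (xs @ a # ys @ zs)"
proof -
  let ?c = "map (column_of A rs)"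
  have "list_minor A rs (xs @ ys @ a # zs) = Determinant.det (mat_of_cols (length rs) (?c (xs @ ys) @ column_of A rs a # ?c zs))"
    using assms by (simp add: list_minor_eq_mat_of_cols)
  also have "\<dots> = (-1) ^ length (xs @ ys) * Determinant.det (mat_of_cols (length rs) (column_of A rs a # ?c (xs @ ys) @ ?c zs))"
    using assms by (subst det_mat_of_cols_move) auto
  also have "\<dots> = (-1) ^ length ys * ((-1) ^ length xs * Determinant.det (mat_of_cols (length rs) (column_of A rs a # ?c xs @ ?c (ys @ zs))))"
    by (simp add: power_add)
  also have "(-1) ^ length xs * Determinant.det (mat_of_cols (length rs) (column_of A rs a # ?c xs @ ?c (ys @ zs)))
     = Determinant.det (mat_of_cols (length rs) (?c xs @ column_of A rs a # ?c (ys @ zs)))"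
    using assms det_mat_of_cols_move[of "length rs" "?c xs" "?c (ys @ zs)" "column_of A rs a"] by simp
  also have "\<dots> = list_minor A rs (xs @ a # ys @ zs)"
    using assms by (simp add: list_minor_eq_mat_of_cols)
  finally show ?thesis .
qed

lemma list_minor_move_row:
  assumes "length cs = length xs + length ys + length zs + 1"
  shows "list_minor A (xs @ ys @ a # zs) cs = (-1) ^ length ys * list_minor A (xs @ a # ys @ zs) cs"
proof -
  let ?T = "tr A"
  have "list_minor A (xs @ ys @ a # zs) cs = list_minor ?T cs (xs @ ys @ a # zs)"
    "list_minor A (xs @ a # ys @ zs) cs = list_minor ?T cs (xs @ a # ys @ zs)"
    using assms by (simp_all add: list_minor_transpose)
  then show ?thesis using assms by (simp add: list_minor_move_col)
qed

text \<open>Since \<open>w e p \<noteq> 0\<close>, the vectors \<open>e\<close>, \<open>p\<close>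
  and \<open>T\<close> form a basis. In coordinates with respect to it \<open>w x y\<close> is a
  constant times the 2 by 2 determinant of the first two coordinates of \<open>x\<close> and
  \<open>y\<close>, and for such determinants the relation is a polynomial identity.\<close>

lemma plucker_relation:
  fixes e p a b :: "'a::field Matrix.vec"
  assumes k: "k = length T + 2" and T: "set T \<subseteq> carrier_vec k"
    and car: "e \<in> carrier_vec k" "p \<in> carrier_vec k" "a \<in> carrier_vec k" "b \<in> carrier_vec k"
    and w: "\<And>x y. w x y = Determinant.det (mat_of_cols k (x # y # T))"
    and ne: "w e p \<noteq> 0"
  shows "w e p * w a b = w e a * w p b + w e b * w a p"
proof -
  define N where "N = mat_of_cols k (e # p # T)"
  have N: "N \<in> carrier_mat k k" unfolding N_def by (rule mat_of_cols_square) (simp add: k)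
  have "Determinant.det N \<noteq> 0" using ne by (simp add: w N_def)
  then obtain M where M: "M \<in> carrier_mat k k" "N * M = 1\<^sub>m k"
    using det_non_zero_imp_unit[OF N] unfolding Units_def ring_mat_def by auto
  define us where "us = map (unit_vec k :: nat \<Rightarrow> 'a Matrix.vec) [2..<k]"
  have us: "length us = k - 2" "\<And>j. j < k - 2 \<Longrightarrow> us ! j = unit_vec k (j + 2)"
    by (simp_all add: us_def add.commute)
  \<comment> \<open>The identity matrix with its first two columns replaced:
    \<open>N * E x y\<close> keeps the columns \<open>T\<close> of \<open>N\<close> and has
    \<open>N *\<^sub>v x\<close> and \<open>N *\<^sub>v y\<close> in place of \<open>e\<close> and
    \<open>p\<close>.\<close>
  define E where "E x y = mat_of_cols k (x # y # us)" for x y :: "'a Matrix.vec"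
  have nth: "(x # y # us) ! j = (if j = 0 then x else if j = 1 then y else unit_vec k j)" if "j < k" for j x y
    using that us(2)[of "j - 2"] by (auto simp: nth_Cons' numeral_2_eq_2)
  have E: "E x y \<in> carrier_mat k k" for x y
    unfolding E_def by (rule mat_of_cols_square) (use k us in simp)
  have ET: "N * E x y = mat_of_cols k (N *\<^sub>v x # N *\<^sub>v y # T)" if "x \<in> carrier_vec k" "y \<in> carrier_vec k" for x y
  proof (rule eq_matI)
    fix i j assume ij: "i < dim_row (mat_of_cols k (N *\<^sub>v x # N *\<^sub>v y # T))" "j < dim_col (mat_of_cols k (N *\<^sub>v x # N *\<^sub>v y # T))"
    have jk: "j < k" using ij k by simp
    have colE: "col (E x y) j = (if j = 0 then x else if j = 1 then y else unit_vec k j)"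
    proof -
      have "(x # y # us) ! j \<in> carrier_vec k" unfolding nth[OF jk] using that by auto
      then show ?thesis unfolding E_def nth[OF jk, symmetric] using jk us(1) by (intro col_mat_of_cols) auto
    qed
    have "(N * E x y) $$ (i, j) = Matrix.row N i \<bullet> col (E x y) j"
      using ij N E[of x y] jk by (simp add: carrier_matD)
    also have "\<dots> = vec_index (N *\<^sub>v col (E x y) j) i" using ij N by simp
    also have "\<dots> = mat_of_cols k (N *\<^sub>v x # N *\<^sub>v y # T) $$ (i, j)"
    proof (cases "j < 2")
      case True
      then show ?thesis using ij by (auto simp: colE mat_of_cols_index less_2_cases_iff)
    next
      case False
      have "(N *\<^sub>v unit_vec k j) = col N j"
        using col_mult2[OF N one_carrier_mat jk] N jk by simp
      also have "\<dots> = T ! (j - 2)" using False ij k T unfolding N_def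
        by (subst col_mat_of_cols) (auto simp: nth_Cons' numeral_2_eq_2 diff_diff_left)
      finally show ?thesis using False ij by (auto simp: colE mat_of_cols_index nth_Cons' numeral_2_eq_2)
    qed
    finally show "(N * E x y) $$ (i, j) = mat_of_cols k (N *\<^sub>v x # N *\<^sub>v y # T) $$ (i, j)" .
  qed (use N E k in \<open>auto simp: carrier_matD\<close>)
  have detE: "Determinant.det (E x y) = vec_index x 0 * vec_index y 1 - vec_index x 1 * vec_index y 0" for x y
  proof -
    let ?A = "Matrix.mat 2 2 (\<lambda>(i, j). if j = 0 then vec_index x i else vec_index y i)"
    let ?C = "Matrix.mat (k - 2) 2 (\<lambda>(i, j). if j = 0 then vec_index x (i + 2) else vec_index y (i + 2))"
    have "E x y = four_block_mat ?A (0\<^sub>m 2 (k - 2)) ?C (1\<^sub>m (k - 2))"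
    proof (rule eq_matI)
      fix i j assume "i < dim_row (four_block_mat ?A (0\<^sub>m 2 (k - 2)) ?C (1\<^sub>m (k - 2)))"
        "j < dim_col (four_block_mat ?A (0\<^sub>m 2 (k - 2)) ?C (1\<^sub>m (k - 2)))"
      then have ij: "i < k" "j < k" using k by simp_all
      have "E x y $$ (i, j) = vec_index ((x # y # us) ! j) i"
        using ij us(1) unfolding E_def by (subst mat_of_cols_index) auto
      also have "\<dots> = four_block_mat ?A (0\<^sub>m 2 (k - 2)) ?C (1\<^sub>m (k - 2)) $$ (i, j)"
      proof (cases "i < 2")
        case True
        then show ?thesis using ij k unfolding nth[OF ij(2)] by (auto simp: less_2_cases_iff)
      next
        case False
        then obtain l where "i = l + 2" by (metis add.commute le_Suc_ex not_less)
        then show ?thesis using ij k unfolding nth[OF ij(2)] by auto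
      qed
      finally show "E x y $$ (i, j) = four_block_mat ?A (0\<^sub>m 2 (k - 2)) ?C (1\<^sub>m (k - 2)) $$ (i, j)" .
    qed (use E k in \<open>auto simp: carrier_matD\<close>)
    then have "Determinant.det (E x y) = Determinant.det ?A"
      by (simp add: det_four_block_mat_upper_right_zero[of ?A 2 _ "k - 2"])
    also have "\<dots> = vec_index x 0 * vec_index y 1 - vec_index x 1 * vec_index y 0"
    proof -
      have "Determinant.det ?A = (\<Sum>r<2. ?A $$ (r, 0) * cofactor ?A r 0)"
        by (rule laplace_expansion_column[of _ 2]) auto
      also have "\<dots> = vec_index x 0 * cofactor ?A 0 0 + vec_index x 1 * cofactor ?A 1 0"
        by (simp add: numeral_2_eq_2)
      also have "cofactor ?A 0 0 = vec_index y 1"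
        unfolding cofactor_def mat_delete_def by (subst det_single) auto
      also have "cofactor ?A 1 0 = - vec_index y 0"
        unfolding cofactor_def mat_delete_def by (subst det_single) auto
      finally show ?thesis by simp
    qed
    finally show ?thesis .
  qed
  have NM: "N *\<^sub>v (M *\<^sub>v v) = v" if "v \<in> carrier_vec k" for v
    using M that N by (metis assoc_mult_mat_vec one_mult_mat_vec)
  define c where "c v = M *\<^sub>v v" for v
  have carc: "c v \<in> carrier_vec k" if "v \<in> carrier_vec k" for v using M that by (simp add: c_def)
  have wc: "w x y = Determinant.det N * (vec_index (c x) 0 * vec_index (c y) 1 - vec_index (c x) 1 * vec_index (c y) 0)" if "x \<in> carrier_vec k" "y \<in> carrier_vec k" for x y
  proof -
    have "w x y = Determinant.det (N * E (c x) (c y))"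
      using ET[OF carc[OF that(1)] carc[OF that(2)]] NM that by (simp add: c_def w)
    also have "\<dots> = Determinant.det N * Determinant.det (E (c x) (c y))"
      by (rule det_mult[OF N E])
    finally show ?thesis by (simp add: detE)
  qed
  show ?thesis using car by (simp add: wc algebra_simps)
qed

text \<open>An extra unit column deletes a row by Laplace expansion. Minors without row
  \<open>i\<close> thereby become determinants of the same size as those with it and can enter one
  Pluecker relation.\<close>

lemma list_minor_delete_row:
  assumes "length cs = length us + length vs" "k = Suc (length cs)"
  shows "Determinant.det (mat_of_cols k (unit_vec k (length us) # map (column_of A (us @ i # vs)) cs))
     = (-1) ^ length us * list_minor A (us @ vs) cs"
proof -
  let ?M = "mat_of_cols k (unit_vec k (length us) # map (column_of A (us @ i # vs)) cs)"
  have M: "?M \<in> carrier_mat k k" by (rule mat_of_cols_square) (simp add: assms)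
  have lu: "length us < k" using assms by simp
  have "Determinant.det ?M = (\<Sum>r<k. ?M $$ (r, 0) * cofactor ?M r 0)"
    using assms by (intro laplace_expansion_column[OF M]) simp
  also have "\<dots> = (\<Sum>r<k. if r = length us then cofactor ?M r 0 else 0)"
    using lu by (intro sum.cong) (auto simp: mat_of_cols_index)
  also have "\<dots> = cofactor ?M (length us) 0"
    using assms by (simp add: sum.delta')
  also have "mat_delete ?M (length us) 0 = Matrix.mat (length cs) (length cs) (\<lambda>(i, j). A $ ((us @ vs) ! i) $ (cs ! j))"
    using assms by (intro eq_matI) (auto simp: mat_delete_def mat_of_cols_index column_of_def nth_append)
  then have "cofactor ?M (length us) 0 = (-1) ^ length us * list_minor A (us @ vs) cs"
    using assms by (simp add: cofactor_def list_minor_def)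
  finally show ?thesis .
qed

text \<open>With a unit column \<open>e\<close> at the place of row \<open>i\<close>, all six minors
  are, up to sign, determinants with the columns \<open>T\<close> in common and two further columns
  taken from \<open>e\<close>, \<open>a\<close>, \<open>p\<close>, \<open>b\<close>. The claim is
  the Pluecker relation for these four; the rest is bookkeeping of signs.\<close>

lemma minor_three_term:
  fixes A :: "('a::field, 'n::{finite,linorder}) sqmat"
  assumes i: "i \<in> I" and card: "card I = card T + 2"
    and ord: "\<And>t. t \<in> T \<Longrightarrow> a < t" "\<And>t. t \<in> T \<Longrightarrow> t < b" "a < p" "p < b" "p \<notin> T"
    and ne: "minor A (I - {i}) (insert p T) \<noteq> 0"
  shows "minor A (I - {i}) (insert p T) * minor A I (insert a (insert b T)) =
    minor A (I - {i}) (insert a T) * minor A I (insert p (insert b T)) +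
    minor A (I - {i}) (insert b T) * minor A I (insert a (insert p T))"
proof -
  let ?S = "sorted_list_of_set :: 'n set \<Rightarrow> 'n list"
  obtain us vs where uv: "?S I = us @ i # vs"
    using i by (metis finite set_sorted_list_of_set split_list)
  define rs where "rs = us @ i # vs"
  define k where "k = length rs"
  \<comment> \<open>Splitting \<open>T\<close> at \<open>p\<close> gives every column set involved
    an explicit sorted list.\<close>
  define l1 where "l1 = ?S {t \<in> T. t < p}"
  define l2 where "l2 = ?S {t \<in> T. p < t}"
  have sets: "set l1 = {t \<in> T. t < p}" "set l2 = {t \<in> T. p < t}" by (simp_all add: l1_def l2_def)
  have T12: "set l1 \<union> set l2 = T" using ord sets by (auto simp: neq_iff)
  have s: "sorted_wrt (<) l1" "sorted_wrt (<) l2" by (simp_all add: l1_def l2_def)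
  have less12: "x < y" if "x \<in> set l1" "y \<in> set l2" for x y
    using that unfolding sets by (metis (lifting) less_trans mem_Collect_eq)
  have bnd: "\<forall>x\<in>set l1. a < x \<and> x < p \<and> x < b" "\<forall>x\<in>set l2. a < x \<and> p < x \<and> x < b"
    using ord by (simp_all add: sets)
  have l12: "\<forall>x\<in>set l1. \<forall>y\<in>set l2. x < y" using less12 by blast
  have apb: "a < p" "p < b" "a < b" using ord by auto
  have lists1: "?S (insert p T) = l1 @ p # l2"
  proof (rule sorted_list_of_set_eqI)
    show "sorted_wrt (<) (l1 @ p # l2)" using s bnd l12 apb by (simp add: sorted_wrt_append ball_Un)
    show "set (l1 @ p # l2) = insert p T" unfolding T12[symmetric] by auto
  qed
  have lists2: "?S (insert a T) = a # l1 @ l2"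
  proof (rule sorted_list_of_set_eqI)
    show "sorted_wrt (<) (a # l1 @ l2)" using s bnd l12 apb by (simp add: sorted_wrt_append ball_Un)
    show "set (a # l1 @ l2) = insert a T" unfolding T12[symmetric] by auto
  qed
  have lists3: "?S (insert b T) = l1 @ l2 @ [b]"
  proof (rule sorted_list_of_set_eqI)
    show "sorted_wrt (<) (l1 @ l2 @ [b])" using s bnd l12 apb by (simp add: sorted_wrt_append ball_Un)
    show "set (l1 @ l2 @ [b]) = insert b T" unfolding T12[symmetric] by auto
  qed
  have lists4: "?S (insert a (insert b T)) = a # l1 @ l2 @ [b]"
  proof (rule sorted_list_of_set_eqI)
    show "sorted_wrt (<) (a # l1 @ l2 @ [b])" using s bnd l12 apb by (simp add: sorted_wrt_append ball_Un)
    show "set (a # l1 @ l2 @ [b]) = insert a (insert b T)" unfolding T12[symmetric] by auto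
  qed
  have lists5: "?S (insert p (insert b T)) = l1 @ p # l2 @ [b]"
  proof (rule sorted_list_of_set_eqI)
    show "sorted_wrt (<) (l1 @ p # l2 @ [b])" using s bnd l12 apb by (simp add: sorted_wrt_append ball_Un)
    show "set (l1 @ p # l2 @ [b]) = insert p (insert b T)" unfolding T12[symmetric] by auto
  qed
  have lists6: "?S (insert a (insert p T)) = a # l1 @ p # l2"
  proof (rule sorted_list_of_set_eqI)
    show "sorted_wrt (<) (a # l1 @ p # l2)" using s bnd l12 apb by (simp add: sorted_wrt_append ball_Un)
    show "set (a # l1 @ p # l2) = insert a (insert p T)" unfolding T12[symmetric] by auto
  qed
  have rm: "?S (I - {i}) = us @ vs"
  proof (rule sorted_list_of_set_eqI)
    have "sorted_wrt (<) (us @ i # vs)" using uv by (metis strict_sorted_list_of_set)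
    then show "sorted_wrt (<) (us @ vs)" by (auto simp: sorted_wrt_append)
    have "set (us @ i # vs) = I" "distinct (us @ i # vs)" using uv by (metis finite set_sorted_list_of_set, metis distinct_sorted_list_of_set)
    then show "set (us @ vs) = I - {i}" by auto
  qed
  define t1 where "t1 = length l1"
  define t where "t = length l1 + length l2"
  have "card T = t"
  proof -
    have "card T = length (l1 @ l2)" using T12 s less12
      by (metis distinct_card set_append sorted_wrt_append strict_sorted_iff)
    then show ?thesis by (simp add: t_def)
  qed
  have lenrs: "k = t + 2" using card \<open>card T = t\<close> uv unfolding k_def rs_def by (metis length_sorted_list_of_set)
  define c where "c = column_of A rs"
  define e :: "'a Matrix.vec" where "e = unit_vec k (length us)"
  define w where "w x y = Determinant.det (mat_of_cols k (x # y # map c (l1 @ l2)))" for x y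
  have cc: "c x \<in> carrier_vec k" for x by (simp add: c_def column_of_def k_def)
  have anti: "w x y = - w y x" for x y
    using det_mat_of_cols_swap[of k "[]" "map c (l1 @ l2)" x y] lenrs by (simp add: w_def t_def)
  have full: "minor A I J = Determinant.det (mat_of_cols k (map c xs))" if "?S J = xs" "length xs = k" for J xs
    using that by (simp add: minor_eq_list_minor uv rs_def[symmetric] list_minor_eq_mat_of_cols k_def c_def)
  have red: "(-1) ^ length us * minor A (I - {i}) J = Determinant.det (mat_of_cols k (e # map c xs))" if "?S J = xs" "length xs + 1 = k" for J xs
    using that list_minor_delete_row[of xs us vs k A i]
    by (simp add: minor_eq_list_minor rm rs_def k_def c_def e_def)
  have move: "Determinant.det (mat_of_cols k (xs @ v # ys)) = (-1) ^ length xs * Determinant.det (mat_of_cols k (v # xs @ ys))"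
    if "length xs + length ys + 1 = k" for xs ys v
    using det_mat_of_cols_move that by metis
  have 1: "minor A I (insert a (insert b T)) = (-1) ^ (t + 1) * w (c b) (c a)"
    using full[OF lists4] move[of "map c (a # l1 @ l2)" "[]" "c b"] lenrs by (simp add: t_def w_def)
  have 2: "minor A I (insert p (insert b T)) = (-1) ^ (t + 1) * ((-1) ^ (t1 + 1) * w (c p) (c b))"
    using full[OF lists5] move[of "map c (l1 @ p # l2)" "[]" "c b"] move[of "map c l1" "map c l2" "c p"]
      move[of "c b # map c l1" "map c l2" "c p"] lenrs by (simp add: t_def t1_def w_def)
  have 3: "minor A I (insert a (insert p T)) = (-1) ^ (t1 + 1) * w (c p) (c a)"
    using full[OF lists6] move[of "c a # map c l1" "map c l2" "c p"] lenrs by (simp add: t_def t1_def w_def)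
  have 4: "(-1) ^ length us * minor A (I - {i}) (insert p T) = (-1) ^ (t1 + 1) * w (c p) e"
    using red[OF lists1] move[of "e # map c l1" "map c l2" "c p"] lenrs by (simp add: t_def t1_def w_def)
  have 5: "(-1) ^ length us * minor A (I - {i}) (insert a T) = w e (c a)"
    using red[OF lists2] lenrs by (simp add: t_def w_def)
  have 6: "(-1) ^ length us * minor A (I - {i}) (insert b T) = (-1) ^ (t + 1) * w (c b) e"
    using red[OF lists3] move[of "e # map c (l1 @ l2)" "[]" "c b"] lenrs by (simp add: t_def w_def)
  \<comment> \<open>The signs of deleting row \<open>i\<close>, of carrying \<open>b\<close> past
    \<open>T\<close> and one more column, and of carrying \<open>p\<close> past the part of
    \<open>T\<close> before it and one more column.\<close>
  define S where "S = (-1 :: 'a) ^ length us"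
  define P where "P = (-1 :: 'a) ^ (t + 1)"
  define Q where "Q = (-1 :: 'a) ^ (t1 + 1)"
  have sq: "S * S = 1" "P * P = 1" "Q * Q = 1"
    by (simp_all add: S_def P_def Q_def flip: power_add mult_2)
  have inv: "x = S * y" if "S * x = y" for x y
    using that sq(1) by (metis mult.assoc mult_1)
  note eqs = 1[folded P_def] 2[folded P_def Q_def] 3[folded Q_def]
    4[folded S_def Q_def, THEN inv] 5[folded S_def, THEN inv] 6[folded S_def P_def, THEN inv]
  have "w e (c p) \<noteq> 0" using ne eqs(4) anti[of e "c p"] by auto
  then have pl: "w e (c p) * w (c a) (c b) = w e (c a) * w (c p) (c b) + w e (c b) * w (c a) (c p)"
    by (rule plucker_relation[where T = "map c (l1 @ l2)" and k = k, rotated -1])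
      (use cc lenrs in \<open>auto simp: e_def w_def t_def\<close>)
  have "minor A (I - {i}) (insert p T) * minor A I (insert a (insert b T)) = S * P * Q * (w (c p) e * w (c b) (c a))"
    by (simp add: eqs)
  also have "w (c p) e * w (c b) (c a) = w e (c p) * w (c a) (c b)"
    using anti[of "c p" e] anti[of "c b" "c a"] by simp
  also have "\<dots> = w e (c a) * w (c p) (c b) + w (c b) e * w (c p) (c a)"
    using pl anti[of "c p" "c a"] anti[of "c b" e] by simp
  also have "S * P * Q * \<dots> = minor A (I - {i}) (insert a T) * minor A I (insert p (insert b T)) +
    minor A (I - {i}) (insert b T) * minor A I (insert a (insert p T))"
    by (simp add: eqs algebra_simps)
  finally show ?thesis .
qed

lemma psubset_Icc:
  fixes a b x y :: "'a::linorder"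
  assumes "a \<le> x" "x \<le> y" "y \<le> b" "x \<noteq> a \<or> y \<noteq> b"
  shows "{x..y} \<subset> {a..b}"
proof (rule psubsetI)
  show "{x..y} \<subseteq> {a..b}" using assms by auto
  show "{x..y} \<noteq> {a..b}" using assms by (auto simp: Icc_eq_Icc)
qed

lemma minor_empty: "minor A {} {} = 1"
  by (simp add: minor_def)

text \<open>Fekete's criterion. The induction is on the size of the minor and then on the spread of its
  columns: the three-term relation through a gap in the column set only involves
  smaller minors and minors of smaller spread.\<close>

lemma fekete:
  fixes A :: "('a::linordered_field, 'n::{finite,linorder}) sqmat"
  assumes closed: "\<And>I. I \<in> F \<Longrightarrow> I \<noteq> {} \<Longrightarrow> \<exists>i\<in>I. I - {i} \<in> F"
    and interval: "\<And>I x y. I \<in> F \<Longrightarrow> x \<le> y \<Longrightarrow> card I = card {x..y} \<Longrightarrow> minor A I {x..y} > 0"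
    and "I \<in> F" "card I = card J"
  shows "minor A I J > 0"
proof -
  have "minor A I J > 0" if "I \<in> F" "card I = k" "card J = k" "card {Min J..Max J} = d" for k d I J
    using that
  proof (induction k arbitrary: I J d rule: less_induct)
    case (less k)
    note outer = less.IH
    show ?case using less.prems
    proof (induction d arbitrary: J rule: less_induct)
      case (less d)
      show ?case
      proof (cases "J = {}")
        case True
        then show ?thesis using less.prems by (simp add: minor_empty)
      next
        case ne: False
        define a where "a = Min J"
        define b where "b = Max J"
        have ab: "a \<in> J" "b \<in> J" "\<And>x. x \<in> J \<Longrightarrow> a \<le> x \<and> x \<le> b"
          using ne by (auto simp: a_def b_def)
        show ?thesis
        proof (cases "{a..b} \<subseteq> J")
          case True
          then have eq: "J = {a..b}" using ab(3) by (intro equalityI subsetI) auto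
          have "card I = card {a..b}" using less.prems(2,3) unfolding eq[symmetric] by simp
          then have "minor A I {a..b} > 0" using less.prems(1) ab(3)[OF ab(1)] by (intro interval) auto
          then show ?thesis unfolding eq[symmetric] .
        next
          case False
          then obtain p where p: "a \<le> p" "p \<le> b" "p \<notin> J" by (metis atLeastAtMost_iff subsetI)
          then have p': "a < p" "p < b" using ab by (auto simp: order_less_le)
          define T where "T = J - {a, b}"
          have J: "J = insert a (insert b T)" "a \<notin> T" "b \<notin> T" "p \<notin> T" "a \<noteq> b"
            using ab p p' by (auto simp: T_def)
          have cT: "card T + 2 = k" using less.prems J by simp
          obtain i where i: "i \<in> I" "I - {i} \<in> F"
            using closed[of I] less.prems cT by fastforce
          have T: "a < t" "t < b" if "t \<in> T" for t
            using that ab by (auto simp: T_def order_less_le)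
          have smaller: "minor A (I - {i}) (insert q T) > 0" if "q \<notin> T" for q
            using i cT that less.prems by (intro outer[OF _ _ _ _ refl, of "k - 1"]) auto
          \<comment> \<open>One extreme column has been exchanged for the interior gap
            \<open>p\<close>, so the column range shrinks strictly while the size stays the
            same.\<close>
          have spread: "minor A I (insert q (insert p T)) > 0" if "q = a \<or> q = b" for q
          proof -
            let ?K = "insert q (insert p T)"
            have bd: "a \<le> x \<and> x \<le> b" if "x \<in> ?K" for x
              using that \<open>q = a \<or> q = b\<close> T[of x] p' by (auto intro: less_imp_le)
            have mem: "Min ?K \<in> ?K" "Max ?K \<in> ?K" by (rule Min_in Max_in; simp)+
            have "a \<notin> ?K \<or> b \<notin> ?K" using \<open>q = a \<or> q = b\<close> J p' by auto
            then have "Min ?K \<noteq> a \<or> Max ?K \<noteq> b" using mem by metis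
            then have "{Min ?K..Max ?K} \<subset> {a..b}"
              using psubset_Icc bd[OF mem(1)] bd[OF mem(2)] Min_le[OF _ mem(2)] by (metis finite)
            then have d: "card {Min ?K..Max ?K} < d"
              unfolding less.prems(4)[symmetric] a_def b_def by (intro psubset_card_mono) simp_all
            have "q \<notin> insert p T" using that J p' by auto
            then have "card ?K = k" using J(4) cT by simp
            with d show ?thesis
              using less.prems by (intro less.IH[OF _ _ _ _ refl])
          qed
          have "minor A (I - {i}) (insert p T) * minor A I J =
            minor A (I - {i}) (insert a T) * minor A I (insert p (insert b T)) +
            minor A (I - {i}) (insert b T) * minor A I (insert a (insert p T))"
            unfolding J(1) using i T p' J cT less.prems smaller[of p]
            by (intro minor_three_term) auto
          also have "\<dots> > 0"
            using smaller[of a] smaller[of b] spread[of a] spread[of b] J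
            by (simp add: insert_commute add_pos_pos)
          finally show ?thesis
            using smaller[of p] J by (simp add: zero_less_mult_iff)
        qed
      qed
    qed
  qed
  then show ?thesis using assms(3,4) by simp
qed

subsection \<open>Minors of inverse and of triangular matrices\<close>

text \<open>Elements join \<open>I\<close> in increasing order. A new maximum \<open>m\<close>
  crosses the \<open>pos m - card I\<close> smaller indices still outside; summed up and taken
  modulo 2, this is the exponent, written with a plus to avoid truncated subtraction.\<close>

lemma list_minor_complement_sign:
  fixes A :: "('a::comm_ring_1, 'n::{finite,linorder}) sqmat"
  assumes "length cs = CARD('n)"
  shows "list_minor A (sorted_list_of_set I @ sorted_list_of_set (- I)) cs =
    (-1) ^ ((\<Sum>i\<in>I. pos i) + (\<Sum>a<card I. a)) * list_minor A (sorted_list_of_set UNIV) cs"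
proof (induction I rule: finite_linorder_max_induct[OF finite])
  case 1
  show ?case by simp
next
  case (2 m I)
  let ?S = "sorted_list_of_set :: 'n set \<Rightarrow> 'n list"
  define ys where "ys = ?S {c. c \<notin> I \<and> c < m}"
  define zs where "zs = ?S {c. m < c}"
  have m: "m \<notin> I" using 2(2) by blast
  have sets: "set ys = {c. c \<notin> I \<and> c < m}" "set zs = {c. m < c}" by (simp_all add: ys_def zs_def)
  have s: "sorted_wrt (<) ys" "sorted_wrt (<) zs" "sorted_wrt (<) (?S I)" by (simp_all add: ys_def zs_def)
  have 3: "?S (insert m I) = ?S I @ [m]"
    using s 2 by (intro sorted_list_of_set_eqI) (auto simp: sorted_wrt_append)
  have 4: "?S (- I) = ys @ m # zs"
    using s sets 2 by (intro sorted_list_of_set_eqI) (auto simp: sorted_wrt_append)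
  have 5: "?S (- insert m I) = ys @ zs"
    using s sets 2 by (intro sorted_list_of_set_eqI) (auto simp: sorted_wrt_append dest: less_trans)
  have "{..<m} = I \<union> {c. c \<notin> I \<and> c < m}" using 2 by auto
  then have pm: "pos m = card I + length ys"
    by (simp add: ys_def) (subst card_Un_disjoint, auto)
  have len: "length cs = length (?S I) + length ys + length zs + 1"
  proof -
    have "length (?S I @ ?S (- I)) = CARD('n)"
      using card_Un_disjoint[of I "- I"] by simp
    then show ?thesis using assms 4 by simp
  qed
  have "list_minor A (?S (insert m I) @ ?S (- insert m I)) cs = list_minor A (?S I @ m # ys @ zs) cs"
    by (simp add: 3 5)
  also have "\<dots> = (-1) ^ length ys * ((-1) ^ length ys * list_minor A (?S I @ m # ys @ zs) cs)"
    by (simp flip: mult.assoc power_add mult_2)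
  also have "(-1) ^ length ys * list_minor A (?S I @ m # ys @ zs) cs = list_minor A (?S I @ ?S (- I)) cs"
    using list_minor_move_row[OF len, of A m] by (simp add: 4)
  also have "\<dots> = (-1) ^ ((\<Sum>i\<in>I. pos i) + (\<Sum>a<card I. a)) * list_minor A (?S UNIV) cs"
    by (rule 2)
  also have "(-1) ^ length ys * \<dots> = (-1) ^ (length ys + ((\<Sum>i\<in>I. pos i) + (\<Sum>a<card I. a))) * list_minor A (?S UNIV) cs"
    by (simp add: power_add)
  \<comment> \<open>The even power supplies \<open>2 * card I\<close>: one copy turns
    \<open>length ys\<close> into \<open>pos m\<close>, the other is the new summand in the sum over
    \<open>a\<close>.\<close>
  also have "(-1 :: 'a) ^ (length ys + ((\<Sum>i\<in>I. pos i) + (\<Sum>a<card I. a)))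
    = (-1) ^ (2 * card I) * (-1 :: 'a) ^ (length ys + ((\<Sum>i\<in>I. pos i) + (\<Sum>a<card I. a)))"
    by simp
  also have "\<dots> = (-1) ^ ((\<Sum>i\<in>insert m I. pos i) + (\<Sum>a<card (insert m I). a))"
    using m pm by (simp only: sum.insert finite card_insert_disjoint lessThan_Suc sum.insert power_add[symmetric]
      finite_lessThan lessThan_iff order_less_irrefl not_False_eq_True) (rule arg_cong[of _ _ "\<lambda>x. (-1) ^ x"], simp)
  finally show ?case .
qed

text \<open>List the rows of \<open>A\<close> as \<open>I, - I\<close> and its columns as
  \<open>J, - J\<close>. Multiplying by the matrix \<open>X\<close> whose first \<open>k\<close>
  columns are unit vectors and whose other columns come from \<open>B\<close> gives a block
  triangular matrix with determinant \<open>minor A I J\<close>, while \<open>det X\<close> is the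
  complementary minor of \<open>B\<close>. Both reorderings contribute the sum over
  \<open>a < k\<close>, which cancels modulo 2.\<close>

lemma jacobi_complementary_minor:
  fixes A B :: "('a::idom, 'n::{finite,linorder}) sqmat"
  assumes AB: "A ** B = Finite_Cartesian_Product.mat 1" and card: "card I = card J"
  shows "(-1) ^ ((\<Sum>i\<in>I. pos i) + (\<Sum>j\<in>J. pos j)) * minor A I J = minor A UNIV UNIV * minor B (- J) (- I)"
proof -
  let ?S = "sorted_list_of_set :: 'n set \<Rightarrow> 'n list"
  define n where "n = CARD('n)"
  define k where "k = card I"
  define \<sigma> where "\<sigma> = ?S I @ ?S (- I)"
  define \<tau> where "\<tau> = ?S J @ ?S (- J)"
  have k: "k \<le> n" "card J = k" by (simp_all add: k_def n_def card_mono card)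
  have cI: "card (- I) = n - k" "card (- J) = n - k"
    using card by (simp_all add: Compl_eq_Diff_UNIV card_Diff_subset k_def n_def)
  have len: "length \<sigma> = n" "length \<tau> = n" using k cI by (simp_all add: \<sigma>_def \<tau>_def k_def)
  have dist: "distinct \<sigma>" "distinct \<tau>" "set \<tau> = UNIV" by (auto simp: \<sigma>_def \<tau>_def)
  define A' where "A' = Matrix.mat n n (\<lambda>(i, j). A $ (\<sigma> ! i) $ (\<tau> ! j))"
  define X where "X = Matrix.mat n n (\<lambda>(i, j). if j < k then (if i = j then 1 else 0) else B $ (\<tau> ! i) $ (\<sigma> ! j))"
  define P where "P = Matrix.mat k k (\<lambda>(i, j). A $ (?S I ! i) $ (?S J ! j))"
  define R where "R = Matrix.mat (n - k) k (\<lambda>(i, j). A $ (?S (- I) ! i) $ (?S J ! j))"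
  define Q' where "Q' = Matrix.mat k (n - k) (\<lambda>(i, j). B $ (?S J ! i) $ (?S (- I) ! j))"
  define S' where "S' = Matrix.mat (n - k) (n - k) (\<lambda>(i, j). B $ (?S (- J) ! i) $ (?S (- I) ! j))"
  have \<sigma>: "\<sigma> ! i = (if i < k then ?S I ! i else ?S (- I) ! (i - k))" for i
    by (simp add: \<sigma>_def nth_append k_def)
  have \<tau>: "\<tau> ! i = (if i < k then ?S J ! i else ?S (- J) ! (i - k))" for i
    using k by (simp add: \<tau>_def nth_append)
  have sumB: "(\<Sum>l = 0..<n. A $ r $ (\<tau> ! l) * B $ (\<tau> ! l) $ c) = (if r = c then 1 else 0)" for r c
  proof -
    have "bij_betw ((!) \<tau>) {0..<n} UNIV"
      using bij_betw_nth[OF dist(2), of "{0..<n}" UNIV] len dist by (simp add: atLeast0LessThan)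
    then have "(\<Sum>l = 0..<n. A $ r $ (\<tau> ! l) * B $ (\<tau> ! l) $ c) = (\<Sum>m\<in>UNIV. A $ r $ m * B $ m $ c)"
      by (rule sum.reindex_bij_betw)
    also have "\<dots> = (A ** B) $ r $ c" by (simp add: matrix_matrix_mult_def)
    finally show ?thesis by (simp add: AB Finite_Cartesian_Product.mat_def)
  qed
  have prod: "A' * X = four_block_mat P (0\<^sub>m k (n - k)) R (1\<^sub>m (n - k))"
  proof (rule eq_matI)
    fix i j assume "i < dim_row (four_block_mat P (0\<^sub>m k (n - k)) R (1\<^sub>m (n - k)))"
      "j < dim_col (four_block_mat P (0\<^sub>m k (n - k)) R (1\<^sub>m (n - k)))"
    then have ij: "i < n" "j < n" using k by (auto simp: P_def)
    have "(A' * X) $$ (i, j) = (\<Sum>l = 0..<n. A' $$ (i, l) * X $$ (l, j))"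
      using ij by (simp add: A'_def X_def scalar_prod_def)
    also have "\<dots> = (if j < k then A $ (\<sigma> ! i) $ (\<tau> ! j) else if i = j then 1 else 0)"
    proof (cases "j < k")
      case True
      have "(\<Sum>l = 0..<n. A' $$ (i, l) * X $$ (l, j)) = (\<Sum>l = 0..<n. if l = j then A' $$ (i, j) else 0)"
        using ij True by (intro sum.cong) (auto simp: X_def)
      then show ?thesis using ij True by (simp add: A'_def)
    next
      case False
      have "(\<Sum>l = 0..<n. A' $$ (i, l) * X $$ (l, j)) = (if \<sigma> ! i = \<sigma> ! j then 1 else 0)"
        using ij False by (simp add: A'_def X_def sumB)
      also have "\<dots> = (if i = j then 1 else 0)"
        using ij len dist by (simp add: nth_eq_iff_index_eq)
      finally show ?thesis using False by simp
    qed
    also have "\<dots> = four_block_mat P (0\<^sub>m k (n - k)) R (1\<^sub>m (n - k)) $$ (i, j)"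
      using ij k by (auto simp: P_def R_def \<sigma> \<tau>)
    finally show "(A' * X) $$ (i, j) = four_block_mat P (0\<^sub>m k (n - k)) R (1\<^sub>m (n - k)) $$ (i, j)" .
  qed (use k in \<open>auto simp: A'_def X_def P_def\<close>)
  have X: "X = four_block_mat (1\<^sub>m k) Q' (0\<^sub>m (n - k) k) S'"
    using k by (intro eq_matI) (auto simp: X_def Q'_def S'_def \<sigma> \<tau>)
  have detP: "Determinant.det P = minor A I J" by (simp add: P_def minor_def k_def)
  have detS: "Determinant.det S' = minor B (- J) (- I)" by (simp add: S'_def minor_def cI)
  have "Determinant.det (A' * X) = minor A I J"
    unfolding prod detP[symmetric] by (subst det_four_block_mat_upper_right_zero[of _ k _ "n - k"]) (auto simp: P_def R_def)
  moreover have "Determinant.det (A' * X) = Determinant.det A' * Determinant.det X"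
    by (rule det_mult[of _ n]) (auto simp: A'_def X_def)
  moreover have "Determinant.det X = minor B (- J) (- I)"
    unfolding X detS[symmetric] by (subst det_four_block_mat_lower_left_zero[of _ k _ "n - k"]) (auto simp: Q'_def S'_def)
  moreover have "Determinant.det A' = (-1) ^ ((\<Sum>i\<in>I. pos i) + (\<Sum>a<k. a)) * ((-1) ^ ((\<Sum>j\<in>J. pos j) + (\<Sum>a<k. a)) * minor A UNIV UNIV)"
  proof -
    have "Determinant.det A' = list_minor A \<sigma> \<tau>" by (simp add: A'_def list_minor_def len)
    also have "\<dots> = (-1) ^ ((\<Sum>i\<in>I. pos i) + (\<Sum>a<k. a)) * list_minor A (?S UNIV) \<tau>"
      using list_minor_complement_sign[of \<tau> A I] len by (simp add: \<sigma>_def k_def n_def)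
    also have "list_minor A (?S UNIV) \<tau> = list_minor (tr A) \<tau> (?S UNIV)"
      using len by (simp add: list_minor_transpose n_def)
    also have "\<dots> = (-1) ^ ((\<Sum>j\<in>J. pos j) + (\<Sum>a<k. a)) * minor A UNIV UNIV"
      using list_minor_complement_sign[of "?S UNIV" "tr A" J] k
      by (simp add: \<tau>_def minor_transpose flip: minor_eq_list_minor)
    finally show ?thesis .
  qed
  ultimately have "minor A I J = (-1) ^ (2 * (\<Sum>a<k. a)) * (-1) ^ ((\<Sum>i\<in>I. pos i) + (\<Sum>j\<in>J. pos j)) * (minor A UNIV UNIV * minor B (- J) (- I))"
    by (simp only: mult_2 power_add mult_ac)
  then have "minor A I J = (-1) ^ ((\<Sum>i\<in>I. pos i) + (\<Sum>j\<in>J. pos j)) * (minor A UNIV UNIV * minor B (- J) (- I))"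
    by simp
  then show ?thesis by (simp flip: mult.assoc power_add mult_2)
qed

lemma list_minor_scale:
  fixes A :: "('a::comm_ring_1, 'n::{finite,linorder}) sqmat"
  assumes "length rs = length cs"
  shows "list_minor (\<chi> i j. d i * A $ i $ j * e j) rs cs = prod_list (map d rs) * prod_list (map e cs) * list_minor A rs cs"
proof -
  let ?N = "{0..<length rs}"
  have "(\<Prod>k\<in>?N. e (cs ! p k)) = (\<Prod>k\<in>?N. e (cs ! k))" if "p permutes ?N" for p
    using prod.permute[OF that, of "\<lambda>k. e (cs ! k)"] by (simp add: o_def)
  moreover have "prod_list (map f xs) = (\<Prod>k\<in>{0..<length xs}. f (xs ! k))" for f :: "'n \<Rightarrow> 'a" and xs
    by (simp add: prod.list_conv_set_nth)
  ultimately show ?thesis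
    using assms by (simp add: list_minor_expand prod.distrib sum_distrib_left mult_ac)
qed

lemma minor_scale:
  assumes "card I = card J"
  shows "minor (\<chi> i j. d i * A $ i $ j * e j) I J = (\<Prod>i\<in>I. d i) * (\<Prod>j\<in>J. e j) * minor A I J"
  unfolding minor_eq_list_minor using assms
  by (subst list_minor_scale) (simp_all flip: prod.distinct_set_conv_list)

lemma minor_upper_diag:
  fixes U :: "('a::comm_ring_1, 'n::{finite,linorder}) sqmat"
  assumes "\<And>i j. j < i \<Longrightarrow> U $ i $ j = 0"
  shows "minor U J J = (\<Prod>j\<in>J. U $ j $ j)"
proof -
  let ?xs = "sorted_list_of_set J"
  let ?M = "Matrix.mat (card J) (card J) (\<lambda>(i, j). U $ (?xs ! i) $ (?xs ! j))"
  have "upper_triangular ?M"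
    using sorted_wrt_nth_less[OF strict_sorted_list_of_set[of J]] assms
    by (auto simp: upper_triangular_def)
  then have "Determinant.det ?M = prod_list (diag_mat ?M)"
    by (rule det_upper_triangular[OF _ mat_carrier])
  also have "diag_mat ?M = map (\<lambda>j. U $ j $ j) ?xs"
    by (auto simp: diag_mat_def intro!: nth_equalityI)
  finally show ?thesis
    by (simp add: minor_def flip: prod.distinct_set_conv_list)
qed

lemma obtain_outside:
  assumes "card K = card (J :: 'n::finite set)" "K \<noteq> J"
  obtains i where "i \<in> K" "i \<notin> J"
  using assms by (metis card_subset_eq finite subsetI)

text \<open>In the Cauchy--Binet sum only \<open>K = initial m\<close> survives: any other
  \<open>K\<close> of this size contains a row at or beyond rank \<open>m\<close>, where the first
  \<open>m\<close> columns of \<open>U\<close> vanish. The next two lemmas are the transposed and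
  the bottom-justified versions.\<close>

lemma minor_mult_upper:
  fixes A U :: "('a::comm_ring_1, 'n::{finite,linorder}) sqmat"
  assumes U: "\<And>i j. j < i \<Longrightarrow> U $ i $ j = 0" and card: "card I = card (initial m :: 'n set)"
  shows "minor (A ** U) I (initial m) = minor A I (initial m) * (\<Prod>j\<in>initial m. U $ j $ j)"
proof -
  have "minor A I K * minor U K (initial m) = (if K = initial m then minor A I (initial m) * (\<Prod>j\<in>initial m. U $ j $ j) else 0)"
    if K: "card K = card I" for K
  proof (cases "K = initial m")
    case False
    then obtain i where i: "i \<in> K" "i \<notin> initial m"
      using K card obtain_outside by metis
    have "minor U K (initial m) = 0"
      using i K card U by (intro minor_eq_0_row[of i]) (auto simp: mem_initial simp flip: pos_less_iff)
    then show ?thesis using False by simp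
  qed (simp add: minor_upper_diag U)
  then show ?thesis using card by (simp add: cauchy_binet sum.delta)
qed

lemma minor_lower_mult:
  fixes A L :: "('a::comm_ring_1, 'n::{finite,linorder}) sqmat"
  assumes L: "\<And>i j. i < j \<Longrightarrow> L $ i $ j = 0" and card: "card J = card (initial m :: 'n set)"
  shows "minor (L ** A) (initial m) J = (\<Prod>j\<in>initial m. L $ j $ j) * minor A (initial m) J"
proof -
  have "minor (L ** A) (initial m) J = minor (tr A ** tr L) J (initial m)"
    using minor_transpose[of "initial m" J "L ** A"] card by (simp add: matrix_transpose_mul)
  also have "\<dots> = minor (tr A) J (initial m) * (\<Prod>j\<in>initial m. L $ j $ j)"
    using L card by (subst minor_mult_upper) (auto simp: Finite_Cartesian_Product.transpose_def)
  finally show ?thesis using card by (simp add: minor_transpose mult.commute)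
qed

lemma minor_upper_mult_final:
  fixes A U :: "('a::comm_ring_1, 'n::{finite,linorder}) sqmat"
  assumes U: "\<And>i j. j < i \<Longrightarrow> U $ i $ j = 0" and card: "card J = card (- initial m :: 'n set)"
  shows "minor (U ** A) (- initial m) J = (\<Prod>j\<in>- initial m. U $ j $ j) * minor A (- initial m) J"
proof -
  have "minor U (- initial m) K * minor A K J = (if K = - initial m then (\<Prod>j\<in>- initial m. U $ j $ j) * minor A (- initial m) J else 0)"
    if K: "card K = card (- initial m :: 'n set)" for K
  proof (cases "K = - initial m")
    case False
    then obtain c where c: "c \<in> K" "c \<notin> - initial m"
      using K obtain_outside by metis
    have "minor U (- initial m) K = 0"
      using c K U by (intro minor_eq_0_col[of c]) (auto simp: mem_initial simp flip: pos_less_iff)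
    then show ?thesis using False by simp
  qed (simp add: minor_upper_diag U)
  then show ?thesis by (simp add: cauchy_binet sum.delta)
qed

text \<open>Bordering by the rows and columns before \<open>x\<close> gives a block lower-triangular
  matrix. If \<open>J\<close> is an interval starting at \<open>x\<close>, the bordered minor is
  left-justified; this reduces minors on interval columns to left-justified ones.\<close>

lemma minor_lower_block:
  fixes M :: "('a::idom, 'n::{finite,linorder}) sqmat"
  assumes M: "\<And>i j. i < j \<Longrightarrow> M $ i $ j = 0"
    and I: "\<And>i. i \<in> I \<Longrightarrow> x \<le> i" and J: "\<And>j. j \<in> J \<Longrightarrow> x \<le> j" and card: "card I = card J"
  shows "minor M ({..<x} \<union> I) ({..<x} \<union> J) = (\<Prod>j<x. M $ j $ j) * minor M I J"
proof -
  let ?S = "sorted_list_of_set :: 'n set \<Rightarrow> 'n list"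
  have ST: "?S ({..<x} \<union> K) = ?S {..<x} @ ?S K" if "\<And>i. i \<in> K \<Longrightarrow> x \<le> i" for K
    using that by (intro sorted_list_of_set_eqI) (auto simp: sorted_wrt_append dest: order_less_le_trans)
  define a where "a = card {..<x}"
  define k where "k = card I"
  have cc: "card ({..<x} \<union> I) = a + k"
  proof -
    have "{..<x} \<inter> I = {}" using I not_le by blast
    then show ?thesis by (simp add: a_def k_def card_Un_disjoint)
  qed
  define P where "P = Matrix.mat a a (\<lambda>(i, j). M $ (?S {..<x} ! i) $ (?S {..<x} ! j))"
  define R where "R = Matrix.mat k a (\<lambda>(i, j). M $ (?S I ! i) $ (?S {..<x} ! j))"
  define T where "T = Matrix.mat k k (\<lambda>(i, j). M $ (?S I ! i) $ (?S J ! j))"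
  have zero: "M $ (?S {..<x} ! i) $ (?S J ! j) = 0" if "i < a" "j < k" for i j
  proof (rule M)
    have "?S {..<x} ! i \<in> {..<x}" using that nth_mem[of i "?S {..<x}"] by (simp add: a_def)
    moreover have "?S J ! j \<in> J" using that nth_mem[of j "?S J"] card by (simp add: k_def)
    ultimately show "?S {..<x} ! i < ?S J ! j" using J by fastforce
  qed
  have "Matrix.mat (a + k) (a + k) (\<lambda>(i, j). M $ (?S ({..<x} \<union> I) ! i) $ (?S ({..<x} \<union> J) ! j))
    = four_block_mat P (0\<^sub>m a k) R T"
    using zero by (intro eq_matI) (auto simp: ST I J nth_append P_def R_def T_def a_def[symmetric])
  then have "minor M ({..<x} \<union> I) ({..<x} \<union> J) = Determinant.det (four_block_mat P (0\<^sub>m a k) R T)"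
    by (simp add: minor_def cc)
  also have "\<dots> = Determinant.det P * Determinant.det T"
    by (rule det_four_block_mat_upper_right_zero) (auto simp: P_def R_def T_def)
  also have "Determinant.det P = minor M {..<x} {..<x}" by (simp add: P_def minor_def a_def)
  also have "\<dots> = minor (tr M) {..<x} {..<x}" by (simp add: minor_transpose)
  also have "\<dots> = (\<Prod>j<x. M $ j $ j)"
    using M by (subst minor_upper_diag) (auto simp: Finite_Cartesian_Product.transpose_def)
  also have "Determinant.det T = minor M I J" by (simp add: T_def minor_def k_def)
  finally show ?thesis .
qed

subsection \<open>Triangular matrices\<close>

lemma tr_nth [simp]: "tr A $ i $ j = A $ j $ i"
  by (simp add: Finite_Cartesian_Product.transpose_def)

lemma mat_1_nth [simp]: "Finite_Cartesian_Product.mat 1 $ i $ j = (if i = j then 1 else 0)"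
  by (simp add: Finite_Cartesian_Product.mat_def)

lemma pos_induct [case_names less]:
  fixes j :: "'n::{finite,linorder}"
  assumes "\<And>j. (\<And>i. i < j \<Longrightarrow> P i) \<Longrightarrow> P j"
  shows "P j"
proof (induction j rule: measure_induct_rule[where f = pos])
  case (less j)
  then show ?case using assms pos_less_iff by metis
qed

text \<open>Induction along the columns: once \<open>c\<close> is known to vanish below the diagonal
  in earlier columns, entry \<open>(i, j)\<close> of \<open>c ** b\<close> with
  \<open>i \<ge> j\<close> collapses to \<open>c $ i $ j * b $ j $ j\<close>.\<close>

lemma inverse_upper:
  fixes b c :: "('a::field, 'n::{finite,linorder}) sqmat"
  assumes cb: "c ** b = mat 1" and b: "\<And>i j. j < i \<Longrightarrow> b $ i $ j = 0"
  shows "b $ j $ j \<noteq> 0 \<and> (\<forall>i>j. c $ i $ j = 0)"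
proof (induction j rule: pos_induct)
  case (less j)
  have *: "c $ i $ j * b $ j $ j = (if i = j then 1 else 0)" if "i \<ge> j" for i
  proof -
    have eq: "c $ i $ l * b $ l $ j = (if l = j then c $ i $ j * b $ j $ j else 0)" for l
      using b[of j l] less.IH[of l] that by (cases l j rule: linorder_cases) auto
    have "(\<Sum>l\<in>UNIV. c $ i $ l * b $ l $ j) = c $ i $ j * b $ j $ j"
      unfolding sum.cong[OF refl eq] by simp
    moreover have "(\<Sum>l\<in>UNIV. c $ i $ l * b $ l $ j) = (c ** b) $ i $ j"
      by (simp add: matrix_matrix_mult_def)
    ultimately show ?thesis by (simp add: cb)
  qed
  then have ne: "b $ j $ j \<noteq> 0" by (metis mult_zero_right order_refl zero_neq_one)
  moreover have "c $ i $ j = 0" if "i > j" for i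
  proof -
    have "c $ i $ j * b $ j $ j = 0" using *[of i] that by simp
    then show ?thesis using ne by simp
  qed
  ultimately show ?case by blast
qed

lemma invertible_matrix_inv:
  fixes A :: "('a::field, 'n::finite) sqmat"
  assumes "invertible A"
  shows "A ** matrix_inv A = mat 1" "matrix_inv A ** A = mat 1"
  using someI_ex[OF assms[unfolded invertible_def]] by (simp_all add: matrix_inv_def)

lemma invertibleI:
  fixes A :: "('a::field, 'n::finite) sqmat"
  assumes "A ** B = mat 1"
  shows "invertible A" "invertible B"
  using assms invertible_left_inverse invertible_right_inverse by blast+

lemma invertible_transpose:
  fixes A :: "('a::field, 'n::finite) sqmat"
  shows "invertible (tr A) \<longleftrightarrow> invertible A"
proof -
  have "invertible (tr A)" if "invertible A" for A :: "('a, 'n) sqmat"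
    using invertible_matrix_inv(2)[OF that] invertibleI(1)[of "tr A" "tr (matrix_inv A)"]
    by (simp flip: matrix_transpose_mul)
  then show ?thesis by (metis Finite_Cartesian_Product.transpose_transpose)
qed

lemma upper_B_zero: "b \<in> upper_B \<Longrightarrow> j < i \<Longrightarrow> b $ i $ j = 0"
  by (simp add: upper_B_def)

lemma upper_B_diag_nonzero: "b \<in> upper_B \<Longrightarrow> b $ j $ j \<noteq> 0"
  using inverse_upper[of "matrix_inv b" b j] by (auto simp: upper_B_def invertible_matrix_inv)

lemma upper_B_inverse:
  assumes "b \<in> upper_B" "c ** b = mat 1"
  shows "c \<in> upper_B"
  using inverse_upper[of c b] assms invertibleI[of c b] by (auto simp: upper_B_def)

lemma upper_B_matrix_inv: "b \<in> upper_B \<Longrightarrow> matrix_inv b \<in> upper_B"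
  by (rule upper_B_inverse) (auto simp: upper_B_def invertible_matrix_inv)

lemma upper_B_mult:
  assumes "a \<in> upper_B" "b \<in> upper_B"
  shows "a ** b \<in> upper_B"
proof -
  have "(\<Sum>l\<in>UNIV. a $ i $ l * b $ l $ j) = 0" if "j < i" for i j
    using assms that by (intro sum.neutral ballI) (metis (no_types, lifting) linorder_not_less mult_eq_0_iff order_le_less_trans upper_B_zero)
  then show ?thesis using assms
    by (simp add: upper_B_def invertible_mult) (simp add: matrix_matrix_mult_def)
qed

lemma upper_B_mat_1: "mat 1 \<in> upper_B"
  by (auto simp: upper_B_def intro: invertibleI[of "mat 1" "mat 1"])

lemma transpose_upper_B: "tr b \<in> lower_B \<longleftrightarrow> b \<in> upper_B"
  by (auto simp: upper_B_def lower_B_def invertible_transpose)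

lemma transpose_lower_B: "tr b \<in> upper_B \<longleftrightarrow> b \<in> lower_B"
  by (auto simp: upper_B_def lower_B_def invertible_transpose)

lemma lower_B_mult: "a \<in> lower_B \<Longrightarrow> b \<in> lower_B \<Longrightarrow> a ** b \<in> lower_B"
  by (metis matrix_transpose_mul transpose_lower_B upper_B_mult)

lemma invertible_lower:
  fixes L :: "('a::field, 'n::{finite,linorder}) sqmat"
  assumes L: "\<And>i j. i < j \<Longrightarrow> L $ i $ j = 0" and d: "\<And>i. L $ i $ i \<noteq> 0"
  shows "invertible L"
proof -
  have "x = 0" if "L *v x = 0" for x
  proof -
    have "x $ j = 0" for j
    proof (induction j rule: pos_induct)
      case (less j)
      have eq: "L $ j $ l * x $ l = (if l = j then L $ j $ j * x $ j else 0)" for l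
        using L[of j l] less.IH[of l] by (cases l j rule: linorder_cases) auto
      have "(\<Sum>l\<in>UNIV. L $ j $ l * x $ l) = L $ j $ j * x $ j"
        unfolding sum.cong[OF refl eq] by simp
      moreover have "(L *v x) $ j = (\<Sum>l\<in>UNIV. L $ j $ l * x $ l)" by (simp add: matrix_vector_mult_def)
      ultimately show ?case using that d by simp
    qed
    then show ?thesis by (simp add: Finite_Cartesian_Product.vec_eq_iff)
  qed
  then show ?thesis
    unfolding invertible_left_inverse matrix_left_invertible_ker by blast
qed

section \<open>Linear systems, Cramer's rule and unit lower-triangular form\<close>

lemma sum_UNIV_if: "(\<Sum>l\<in>UNIV. if P l then f l else 0) = sum f {l :: 'n::finite. P l}"
  using sum.inter_filter[of UNIV f P] by simp

text \<open>The bridge between minors and the type-indexed determinant: invertibility is deduced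
  from a trivial kernel, so the two determinants never have to be compared.\<close>

lemma minor_kernel:
  fixes A :: "('a::field, 'n::{finite,linorder}) sqmat"
  assumes ne: "minor A I J \<noteq> 0" and card: "card I = card J"
    and ker: "\<And>i. i \<in> I \<Longrightarrow> (\<Sum>j\<in>J. A $ i $ j * x j) = 0" and j: "j \<in> J"
  shows "x j = 0"
proof -
  let ?S = "sorted_list_of_set :: 'n set \<Rightarrow> 'n list"
  define k where "k = card I"
  define P where "P = Matrix.mat k k (\<lambda>(a, b). A $ (?S I ! a) $ (?S J ! b))"
  define v where "v = Matrix.vec k (\<lambda>b. x (?S J ! b))"
  have P: "P \<in> carrier_mat k k" by (simp add: P_def)
  have bij: "bij_betw ((!) (?S J)) {0..<k} J"
    using bij_betw_nth[of "?S J" "{0..<k}" J] card by (simp add: k_def atLeast0LessThan)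
  have "P *\<^sub>v v = 0\<^sub>v k"
  proof (rule eq_vecI)
    fix a assume "a < dim_vec (0\<^sub>v k :: 'a Matrix.vec)"
    then have a: "a < k" by simp
    then have "?S I ! a \<in> I" using nth_mem[of a "?S I"] by (simp add: k_def)
    have "vec_index (P *\<^sub>v v) a = (\<Sum>b = 0..<k. A $ (?S I ! a) $ (?S J ! b) * x (?S J ! b))"
      using a by (simp add: P_def v_def scalar_prod_def)
    also have "\<dots> = (\<Sum>j\<in>J. A $ (?S I ! a) $ j * x j)"
      by (rule sum.reindex_bij_betw[OF bij, of "\<lambda>j. A $ (?S I ! a) $ j * x j"])
    finally show "vec_index (P *\<^sub>v v) a = vec_index (0\<^sub>v k) a"
      using ker \<open>?S I ! a \<in> I\<close> a by simp
  qed (simp add: P_def)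
  moreover have "Determinant.det P \<noteq> 0" using ne by (simp add: P_def minor_def k_def)
  moreover have "v \<in> carrier_vec k" by (simp add: v_def)
  ultimately have "v = 0\<^sub>v k" using det_0_iff_vec_prod_zero_field[OF P] by blast
  moreover obtain b where "b < k" "?S J ! b = j"
    using j bij by (metis atLeastLessThan_iff bij_betw_iff_bijections)
  ultimately show ?thesis by (metis index_vec index_zero_vec(1) v_def)
qed

text \<open>Column operations that bring \<open>B\<close> to unit lower-triangular form: the \<open>j\<close>-th of them solves a
  linear system with matrix \<open>leading_mat B j\<close>, so by Cramer's rule the entries of the
  result are rational functions of those of \<open>B\<close>.\<close>

definition leading_mat :: "('a::field, 'n::{finite,linorder}) sqmat \<Rightarrow> 'n \<Rightarrow> ('a, 'n) sqmat" where
  "leading_mat B j = (\<chi> r c. if c \<le> j then B $ r $ c else if r = c then 1 else 0)"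

definition reduced :: "('a::field, 'n::{finite,linorder}) sqmat \<Rightarrow> ('a, 'n) sqmat" where
  "reduced B = (\<chi> i j. if j < i then
     - (det (\<chi> r c. if c = i then (if r = j then 1 else 0) else leading_mat B j $ r $ c) / det (leading_mat B j))
     else 0)"

lemma column_reduction:
  fixes B :: "('a::field, 'n::{finite,linorder}) sqmat"
  assumes ne: "\<And>j. det (leading_mat B j) \<noteq> 0"
  obtains Y where "\<And>i j. j < i \<Longrightarrow> Y $ i $ j = 0" "B ** Y = mat 1 + reduced B"
proof
  \<comment> \<open>Cramer's solution of \<open>leading_mat B j *v y j = axis j 1\<close>. Its
    components up to \<open>j\<close> form column \<open>j\<close> of \<open>Y\<close>; the later
    ones, negated, are what remains of \<open>B ** Y\<close> below the diagonal.\<close>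
  define y :: "'n \<Rightarrow> ('a, 'n) Finite_Cartesian_Product.vec" where
    "y j = (\<chi> k. det (\<chi> r c. if c = k then (axis j 1) $ r else leading_mat B j $ r $ c) / det (leading_mat B j))" for j
  define Y :: "('a, 'n) sqmat" where "Y = (\<chi> l j. if l \<le> j then y j $ l else 0)"
  show "Y $ i $ j = 0" if "j < i" for i j using that by (simp add: Y_def)
  have red: "reduced B $ i $ j = (if j < i then - y j $ i else 0)" for i j
    by (simp add: reduced_def y_def axis_def if_distrib cong: if_cong)
  have solve: "leading_mat B j *v y j = axis j 1" for j
    using cramer[OF ne, of j "y j" "axis j 1"] by (simp add: y_def)
  have "(B ** Y) $ i $ j = (if i = j then 1 else 0) + reduced B $ i $ j" for i j
  proof -
    have "(if i = j then 1 else 0) = (leading_mat B j *v y j) $ i"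
      by (simp add: solve axis_def)
    also have "\<dots> = (\<Sum>l\<in>UNIV. B $ i $ l * Y $ l $ j + (if l = i then (if j < i then y j $ i else 0) else 0))"
      by (auto simp: matrix_vector_mult_def leading_mat_def Y_def intro!: sum.cong)
    also have "\<dots> = (B ** Y) $ i $ j + (if j < i then y j $ i else 0)"
      by (simp add: sum.distrib matrix_matrix_mult_def)
    finally show ?thesis by (simp add: red algebra_simps)
  qed
  then show "B ** Y = mat 1 + reduced B" by (simp add: Finite_Cartesian_Product.vec_eq_iff)
qed

lemma reduced_upper_zero: "i \<le> j \<Longrightarrow> reduced B $ i $ j = 0"
  by (simp add: reduced_def)

lemma invertible_unit_lower:
  fixes x :: "('a::field, 'n::{finite,linorder}) sqmat"
  assumes "\<And>i j. i \<le> j \<Longrightarrow> x $ i $ j = 0"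
  shows "invertible (mat 1 + x)"
  by (rule invertible_lower) (use assms in auto)

lemma column_reduction_upper_B:
  fixes B :: "('a::field, 'n::{finite,linorder}) sqmat"
  assumes "\<And>j. det (leading_mat B j) \<noteq> 0"
  obtains Y where "Y \<in> upper_B" "B ** Y = mat 1 + reduced B"
proof -
  obtain Y where Y: "\<And>i j. j < i \<Longrightarrow> Y $ i $ j = 0" "B ** Y = mat 1 + reduced B"
    using column_reduction[OF assms] by blast
  have "invertible (B ** Y)" unfolding Y(2) by (rule invertible_unit_lower) (rule reduced_upper_zero)
  then obtain C where "C ** (B ** Y) = mat 1" using invertible_left_inverse by blast
  then have "(C ** B) ** Y = mat 1" by (simp add: matrix_mul_assoc)
  then have "invertible Y" by (rule invertibleI)
  then have "Y \<in> upper_B" using Y(1) by (simp add: upper_B_def)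
  then show ?thesis using Y(2) by (rule that)
qed

text \<open>For a kernel vector the rows up to \<open>j\<close> involve only the components up to
  \<open>j\<close>, which vanish because of the minor; the remaining rows then say that the other
  components vanish.\<close>

lemma det_leading_mat_nonzero:
  fixes B :: "('a::field, 'n::{finite,linorder}) sqmat"
  assumes "minor B {..j} {..j} \<noteq> 0"
  shows "det (leading_mat B j) \<noteq> 0"
proof -
  have "x = 0" if x: "leading_mat B j *v x = 0" for x
  proof -
    have eq: "(\<Sum>l\<le>j. B $ i $ l * x $ l) + (if j < i then x $ i else 0) = 0" for i
    proof -
      have "(\<Sum>l\<in>UNIV. (if l \<in> {..j} then B $ i $ l * x $ l else 0) + (if l = i then (if j < i then x $ i else 0) else 0))
        = (leading_mat B j *v x) $ i"
        by (auto simp: matrix_vector_mult_def leading_mat_def intro!: sum.cong)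
      then show ?thesis by (simp add: x sum.distrib sum_UNIV_if atMost_def)
    qed
    have low: "x $ l = 0" if "l \<le> j" for l
    proof (rule minor_kernel[OF assms refl])
      show "(\<Sum>l\<le>j. B $ i $ l * x $ l) = 0" if "i \<in> {..j}" for i
        using eq[of i] that by (auto split: if_splits)
    qed (use that in simp)
    moreover have "x $ i = 0" if "j < i" for i
      using eq[of i] that low by simp
    ultimately have "x $ i = 0" for i by (meson not_le)
    then show ?thesis by (simp add: Finite_Cartesian_Product.vec_eq_iff)
  qed
  then show ?thesis
    unfolding invertible_det_nz[symmetric] invertible_left_inverse matrix_left_invertible_ker by blast
qed

subsection \<open>Gram--Schmidt orthonormalization\<close>

function gram_schmidt :: "(real, 'n::{finite,linorder}) sqmat \<Rightarrow> 'n \<Rightarrow> (real, 'n) Finite_Cartesian_Product.vec" where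
  "gram_schmidt A j =
    (let v = column j A - (\<Sum>i<j. (gram_schmidt A i \<bullet> column j A) *\<^sub>R gram_schmidt A i)
     in (1 / norm v) *\<^sub>R v)"
  by pat_completeness auto
termination
  by (relation "Wellfounded.measure (\<lambda>(A, j). pos j)") (auto simp: pos_less_iff)

declare gram_schmidt.simps [simp del]

definition orth_residue :: "(real, 'n::{finite,linorder}) sqmat \<Rightarrow> 'n \<Rightarrow> (real, 'n) Finite_Cartesian_Product.vec" where
  "orth_residue A j = column j A - (\<Sum>i<j. (gram_schmidt A i \<bullet> column j A) *\<^sub>R gram_schmidt A i)"

lemma gram_schmidt_eq: "gram_schmidt A j = (1 / norm (orth_residue A j)) *\<^sub>R orth_residue A j"
  by (subst gram_schmidt.simps) (simp add: orth_residue_def Let_def)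

definition gs_matrix :: "(real, 'n::{finite,linorder}) sqmat \<Rightarrow> (real, 'n) sqmat" where
  "gs_matrix A = (\<chi> r c. gram_schmidt A c $ r)"

context
  fixes A :: "(real, 'n::{finite,linorder}) sqmat"
  assumes inv: "invertible A"
begin

text \<open>The coefficient 1 at \<open>j\<close> makes \<open>w\<close> nonzero, so an invertible
  \<open>A\<close> cannot annihilate it and normalization is legitimate.\<close>

lemma orth_residue_span: "\<exists>w. orth_residue A j = A *v w \<and> w $ j = 1 \<and> (\<forall>l>j. w $ l = 0)"
proof (induction j rule: pos_induct)
  case (less j)
  have "\<exists>w. gram_schmidt A i = A *v w \<and> (\<forall>l>i. w $ l = 0)" if i: "i < j" for i
  proof -
    obtain w where "orth_residue A i = A *v w" "\<forall>l>i. w $ l = 0" using less.IH[OF i] by blast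
    then show ?thesis
      by (intro exI[of _ "(1 / norm (orth_residue A i)) *\<^sub>R w"])
        (simp add: gram_schmidt_eq matrix_vector_mult_scaleR)
  qed
  then obtain w where w: "\<And>i. i < j \<Longrightarrow> gram_schmidt A i = A *v w i" "\<And>i l. i < j \<Longrightarrow> l > i \<Longrightarrow> w i $ l = 0"
    by metis
  define u where "u = axis j 1 - (\<Sum>i<j. (gram_schmidt A i \<bullet> column j A) *\<^sub>R w i)"
  have "A *v u = orth_residue A j"
    by (simp add: u_def orth_residue_def w(1) linear_diff linear_sum matrix_vector_mult_basis
      linear_scale matrix_vector_mult_diff_distrib matrix_vector_mult_scaleR linear_sum[OF matrix_vector_mul_linear])
  moreover have "u $ j = 1" "\<And>l. l > j \<Longrightarrow> u $ l = 0"
    by (auto simp: u_def axis_def w(2))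
  ultimately show ?case by metis
qed

lemma orth_residue_nonzero: "orth_residue A j \<noteq> 0"
proof
  assume "orth_residue A j = 0"
  then obtain w where w: "A *v w = 0" "w $ j = 1" using orth_residue_span[of j] by metis
  have "w = matrix_inv A *v (A *v w)"
    by (simp add: matrix_vector_mul_assoc invertible_matrix_inv inv)
  with w show False by simp
qed

lemma norm_gram_schmidt: "norm (gram_schmidt A j) = 1"
  using orth_residue_nonzero by (simp add: gram_schmidt_eq)

lemma gram_schmidt_orthogonal: "i < j \<Longrightarrow> gram_schmidt A i \<bullet> gram_schmidt A j = 0"
proof (induction j arbitrary: i rule: pos_induct)
  case (less j)
  have *: "gram_schmidt A i \<bullet> gram_schmidt A l = (if l = i then 1 else 0)" if "l < j" for l
  proof (cases i l rule: linorder_cases)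
    case equal
    then show ?thesis using norm_gram_schmidt[of i] by (simp add: norm_eq_1)
  next
    case greater
    then show ?thesis using less.IH[OF less.prems greater] by (simp add: inner_commute)
  qed (use less.IH[OF that] in auto)
  have "gram_schmidt A i \<bullet> orth_residue A j = gram_schmidt A i \<bullet> column j A
      - (\<Sum>l<j. (gram_schmidt A l \<bullet> column j A) * (gram_schmidt A i \<bullet> gram_schmidt A l))"
    by (simp add: orth_residue_def inner_diff_right inner_sum_right)
  also have "(\<Sum>l<j. (gram_schmidt A l \<bullet> column j A) * (gram_schmidt A i \<bullet> gram_schmidt A l))
    = (\<Sum>l<j. if l = i then gram_schmidt A i \<bullet> column j A else 0)"
    by (intro sum.cong) (auto simp: *)
  finally have "gram_schmidt A i \<bullet> orth_residue A j = 0" using less.prems by simp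
  then show ?case by (simp add: gram_schmidt_eq[of A j])
qed

lemma orthogonal_gs_matrix: "orthogonal_matrix (gs_matrix A)"
proof -
  have "column c (gs_matrix A) = gram_schmidt A c" for c
    by (simp add: column_def gs_matrix_def Finite_Cartesian_Product.vec_eq_iff)
  moreover have "real_inner_class.orthogonal (gram_schmidt A i) (gram_schmidt A j)" if "i \<noteq> j" for i j
    using that gram_schmidt_orthogonal[of i j] gram_schmidt_orthogonal[of j i]
    by (auto simp: real_inner_class.orthogonal_def inner_commute neq_iff)
  ultimately show ?thesis
    by (simp add: orthogonal_matrix_orthonormal_columns norm_gram_schmidt)
qed

text \<open>The positive diagonal of \<open>R\<close> matters: multiplication by \<open>R\<close>
  then preserves the signs of left-justified minors.\<close>

lemma qr_decomposition:
  obtains R where "R \<in> upper_B" "\<And>j. R $ j $ j > 0" "A = gs_matrix A ** R"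
proof
  define R where "R = (\<chi> i j. if i < j then gram_schmidt A i \<bullet> column j A
    else if i = j then norm (orth_residue A j) else 0)"
  show "R $ j $ j > 0" for j using orth_residue_nonzero by (simp add: R_def)
  have "(gs_matrix A ** R) $ r $ j = A $ r $ j" for r j
  proof -
    have "(gs_matrix A ** R) $ r $ j = (\<Sum>i\<in>UNIV. (if i \<in> {..<j} then (gram_schmidt A i \<bullet> column j A) * gram_schmidt A i $ r else 0)
       + (if i = j then norm (orth_residue A j) * gram_schmidt A j $ r else 0))"
      by (auto simp: matrix_matrix_mult_def gs_matrix_def R_def intro!: sum.cong)
    also have "\<dots> = (\<Sum>i<j. (gram_schmidt A i \<bullet> column j A) * gram_schmidt A i $ r) + orth_residue A j $ r"
      using orth_residue_nonzero[of j] by (simp add: sum.distrib gram_schmidt_eq[of A j] sum_UNIV_if lessThan_def)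
    also have "\<dots> = A $ r $ j" by (simp add: orth_residue_def column_def)
    finally show ?thesis .
  qed
  then show A: "A = gs_matrix A ** R" by (simp add: Finite_Cartesian_Product.vec_eq_iff)
  have "invertible R"
    using inv A invertibleI(2)[of "matrix_inv A ** gs_matrix A" R]
    by (simp add: invertible_matrix_inv flip: matrix_mul_assoc)
  then show "R \<in> upper_B" by (auto simp: upper_B_def R_def)
qed

end

section \<open>Column sets \<open>initial m\<close> and left-justified minors\<close>

lemma card_initial_le: "card (initial m :: 'n::{finite,linorder} set) \<le> m"
  by (simp add: card_initial)

lemma initial_card_initial: "initial (card (initial m :: 'n::{finite,linorder} set)) = (initial m :: 'n set)"
proof -
  have "pos j < CARD('n)" for j :: 'n using bij_pos by (auto simp: bij_betw_def)
  then show ?thesis by (auto simp: mem_initial card_initial)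
qed

lemma atMost_eq_initial: "{..j} = initial (Suc (pos j))"
  by (auto simp: initial_Suc_pos)

lemma lessThan_eq_initial: "{..<j} = initial (pos j)"
  by (simp add: initial_pos)

lemma minor_lower_diag:
  fixes L :: "('a::comm_ring_1, 'n::{finite,linorder}) sqmat"
  assumes "\<And>i j. i < j \<Longrightarrow> L $ i $ j = 0"
  shows "minor L J J = (\<Prod>j\<in>J. L $ j $ j)"
  using minor_upper_diag[of "tr L" J] assms by (simp add: minor_transpose)

text \<open>Sizes are compared with \<open>card (initial m)\<close> rather than \<open>m\<close>,
  because \<open>initial m\<close> is the whole index set for large \<open>m\<close>; this spares
  side conditions bounding \<open>m\<close>.\<close>

lemma left_minor_initial:
  "card I = card (initial m :: 'n::{finite,linorder} set) \<Longrightarrow> left_minor A I = minor A I (initial m :: 'n set)"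
  by (simp add: left_minor_def initial_card_initial)

lemma left_minor_eq:
  obtains m where "card I = card (initial m :: 'n::{finite,linorder} set)" "left_minor A I = minor A I (initial m :: 'n set)"
proof
  show "card I = card (initial (card I) :: 'n set)" by (simp add: card_initial card_le_CARD)
qed (simp add: left_minor_def)

lemma invertible_if_minor:
  fixes A :: "('a::field, 'n::{finite,linorder}) sqmat"
  assumes "minor A UNIV UNIV \<noteq> 0"
  shows "invertible A"
proof -
  have "x = 0" if x: "A *v x = 0" for x
  proof -
    have "x $ j = 0" for j
    proof (rule minor_kernel[OF assms refl])
      show "(\<Sum>j\<in>UNIV. A $ i $ j * x $ j) = 0" for i
        using arg_cong[OF x, of "\<lambda>v. v $ i"] by (simp add: matrix_vector_mult_def)
    qed simp
    then show ?thesis by (simp add: Finite_Cartesian_Product.vec_eq_iff)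
  qed
  then show ?thesis
    unfolding invertible_left_inverse matrix_left_invertible_ker by blast
qed

lemma minor_leading_nonzero_if_pos:
  fixes A :: "(real, 'n::{finite,linorder}) sqmat"
  assumes "\<And>I. left_minor A I > 0"
  shows "det (leading_mat A j) \<noteq> 0"
proof (rule det_leading_mat_nonzero)
  have "left_minor A {..j} = minor A {..j} {..j}"
    unfolding atMost_eq_initial by (rule left_minor_initial) simp
  then show "minor A {..j} {..j} \<noteq> 0" using assms[of "{..j}"] by simp
qed

subsection \<open>The involution on orthogonal matrices\<close>

lemma delta_nth: "delta $ i $ j = (if i = j then (-1) ^ pos i else 0)"
  by (simp add: delta_def)

lemma delta_mult_nth: "(delta ** A) $ i $ j = (-1) ^ pos i * A $ i $ j"
proof -
  have "(delta ** A) $ i $ j = (\<Sum>l\<in>UNIV. delta $ i $ l * A $ l $ j)"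
    by (simp add: matrix_matrix_mult_def)
  also have "\<dots> = (\<Sum>l\<in>UNIV. if l = i then (-1) ^ pos i * A $ i $ j else 0)"
    by (intro sum.cong) (auto simp: delta_nth)
  finally show ?thesis by simp
qed

lemma mult_delta_nth: "(A ** delta) $ i $ j = A $ i $ j * (-1) ^ pos j"
proof -
  have "(A ** delta) $ i $ j = (\<Sum>l\<in>UNIV. A $ i $ l * delta $ l $ j)"
    by (simp add: matrix_matrix_mult_def)
  also have "\<dots> = (\<Sum>l\<in>UNIV. if l = j then A $ i $ j * (-1) ^ pos j else 0)"
    by (intro sum.cong) (auto simp: delta_nth)
  finally show ?thesis by simp
qed

lemma delta_conj_nth: "(delta ** A ** delta) $ i $ j = (-1) ^ pos i * A $ i $ j * (-1) ^ pos j"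
  by (simp add: mult_delta_nth delta_mult_nth)

lemma delta_delta: "delta ** delta = mat 1"
  by (simp add: Finite_Cartesian_Product.vec_eq_iff delta_mult_nth delta_nth flip: power_add mult_2)

lemma tr_delta: "tr delta = delta"
  by (simp add: Finite_Cartesian_Product.vec_eq_iff delta_nth)

lemma orthogonal_delta: "orthogonal_matrix delta"
  by (simp add: orthogonal_matrix tr_delta delta_delta)

lemma orthogonal_matrixD:
  fixes g :: "(real, 'n::finite) sqmat"
  assumes "orthogonal_matrix g"
  shows "tr g ** g = mat 1" "g ** tr g = mat 1"
  using assms by (simp_all add: orthogonal_matrix_def)

lemma invertible_orthogonal: "orthogonal_matrix (g :: (real, 'n::finite) sqmat) \<Longrightarrow> invertible g"
  by (meson invertibleI(2) orthogonal_matrixD(1))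

lemma matrix_inv_eqI:
  fixes A B :: "('a::field, 'n::finite) sqmat"
  assumes "A ** B = mat 1"
  shows "matrix_inv A = B"
proof -
  have "matrix_inv A = matrix_inv A ** (A ** B)" by (simp add: assms)
  also have "\<dots> = B" using invertible_matrix_inv(2)[OF invertibleI(1)[OF assms]] by (simp add: matrix_mul_assoc)
  finally show ?thesis .
qed

lemma iota_orthogonal: "orthogonal_matrix g \<Longrightarrow> iota g = delta ** tr g ** delta"
  by (simp add: iota_def matrix_inv_eqI[OF orthogonal_matrixD(2)])

lemma orthogonal_iota: "orthogonal_matrix g \<Longrightarrow> orthogonal_matrix (iota g)"
  by (simp add: iota_orthogonal orthogonal_matrix_mul orthogonal_delta)

lemma iota_iota:
  assumes "orthogonal_matrix g"
  shows "iota (iota g) = g"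
proof -
  have sign: "(-1 :: real) ^ a * ((-1) ^ a * ((-1) ^ b * ((-1) ^ b * x))) = x" "(-1 :: real) ^ a * ((-1) ^ b * ((-1) ^ a * (-1) ^ b)) = 1" for a b x
    by (cases "even a"; cases "even b"; simp)+
  have "iota (iota g) = delta ** tr (delta ** tr g ** delta) ** delta"
    using assms iota_orthogonal orthogonal_iota by metis
  also have "\<dots> = g"
    by (simp add: Finite_Cartesian_Product.vec_eq_iff delta_conj_nth mult_ac sign)
  finally show ?thesis .
qed

definition orth_pos :: "(real, 'n::{finite,linorder}) sqmat set" where
  "orth_pos = {g. orthogonal_matrix g \<and> (\<forall>I. left_minor g I > 0)}"

text \<open>The key positivity statement. For \<open>g Y = L\<close> with \<open>L\<close> unit lower- and \<open>Y\<close> upper-triangular,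
  orthogonality gives \<open>Y\<^sup>T = L\<^sup>T g\<close>; this makes \<open>Y\<^sup>T\<close> a lower-triangular matrix whose left-justified
  minors are positive, and two applications of Fekete's criterion give positivity of its bottom-justified
  minors, which are those of \<open>g\<close>.\<close>

lemma bottom_minor_pos:
  fixes g :: "(real, 'n::{finite,linorder}) sqmat"
  assumes g: "g \<in> orth_pos" and card: "card J = card (- initial m :: 'n set)"
  shows "minor g (- initial m) J > 0"
proof -
  have orth: "orthogonal_matrix g" and posg: "\<And>I. left_minor g I > 0" using g by (auto simp: orth_pos_def)
  have posg': "minor g I (initial m) > 0" if "card I = card (initial m :: 'n set)" for I m
    using posg[of I] left_minor_initial[OF that, of g] by simp
  obtain Y where Y: "Y \<in> upper_B" and gY: "g ** Y = mat 1 + reduced g"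
    using column_reduction_upper_B[of g] minor_leading_nonzero_if_pos[OF posg] by blast
  define L where "L = mat 1 + reduced g"
  have L: "\<And>i j. i < j \<Longrightarrow> L $ i $ j = 0" "\<And>j. L $ j $ j = 1"
    by (simp_all add: L_def reduced_upper_zero)
  \<comment> \<open>These minors are those of \<open>g\<close> times a product of diagonal entries
    of \<open>Y\<close>. The product is positive because for the rows \<open>initial m\<close> the
    minor of \<open>L\<close> is 1.\<close>
  have Lm: "minor L I (initial m) > 0" if "card I = card (initial m :: 'n set)" for I m
  proof -
    have *: "minor L I (initial m) = minor g I (initial m) * (\<Prod>j\<in>initial m. Y $ j $ j)"
      if "card I = card (initial m :: 'n set)" for I
      unfolding L_def gY[symmetric] using that Y by (intro minor_mult_upper upper_B_zero)
    have "minor L (initial m) (initial m) = 1" by (simp add: minor_lower_diag L)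
    then have "minor g (initial m) (initial m) * (\<Prod>j\<in>initial m. Y $ j $ j) > 0"
      unfolding *[OF refl] by simp
    then have "(\<Prod>j\<in>initial m. Y $ j $ j) > 0"
      by (rule zero_less_mult_pos[OF _ posg'[OF refl]])
    then show ?thesis using *[OF that] posg'[OF that] by simp
  qed
  \<comment> \<open>A row before \<open>x\<close> vanishes on these columns, as \<open>L\<close> is
    lower-triangular; without such a row, bordering by \<open>{..<x}\<close> makes the minor
    left-justified.\<close>
  have Lint: "minor L K {x..y} \<ge> 0" if c: "card K = card {x..y}" and xy: "x \<le> y" for K x y
  proof (cases "\<exists>i\<in>K. i < x")
    case True
    then obtain i where "i \<in> K" "i < x" by blast
    then have "minor L K {x..y} = 0" using c L by (intro minor_eq_0_row[of i]) auto
    then show ?thesis by simp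
  next
    case False
    have ic: "{..<x} \<union> {x..y} = initial (Suc (pos y))"
      unfolding atMost_eq_initial[symmetric] using xy by auto
    have "minor L ({..<x} \<union> K) ({..<x} \<union> {x..y}) = (\<Prod>j<x. L $ j $ j) * minor L K {x..y}"
      using False c L by (intro minor_lower_block) (auto simp: not_less)
    moreover have "card ({..<x} \<union> K) = card ({..<x} \<union> {x..y})"
      using False c by (subst (1 2) card_Un_disjoint) (auto simp: not_less)
    ultimately have "minor L K {x..y} > 0" using Lm[of "{..<x} \<union> K" "Suc (pos y)"] by (simp add: ic L)
    then show ?thesis by simp
  qed
  have YL: "tr Y = tr L ** g"
  proof -
    have "tr L ** g = tr Y ** (tr g ** g)"
      unfolding L_def gY[symmetric] by (simp add: matrix_transpose_mul matrix_mul_assoc)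
    then show ?thesis by (simp add: orthogonal_matrixD[OF orth])
  qed
  have Ytop: "minor Y (initial m) K > 0" if "card (initial m :: 'n set) = card K" for m K
  proof (rule fekete[where F = "range initial"])
    show "\<exists>i\<in>I. I - {i} \<in> range initial" if I: "I \<in> range initial" "I \<noteq> {}" for I :: "'n set"
    proof
      obtain m where m: "I = initial m" using I by blast
      show "Max I \<in> I" using I by simp
      have "I - {Max I} = {..<Max I}"
      proof (intro equalityI subsetI)
        fix i assume "i \<in> I - {Max I}"
        then show "i \<in> {..<Max I}" by (auto simp: order_less_le)
      next
        fix i assume "i \<in> {..<Max I}"
        then have "pos i < pos (Max I)" by (simp add: pos_less_iff)
        then show "i \<in> I - {Max I}" using \<open>Max I \<in> I\<close> by (auto simp: m mem_initial)
      qed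
      then show "I - {Max I} \<in> range initial" using initial_pos[of "Max I"] by (metis rangeI)
    qed
  next
    fix I :: "'n set" and x y assume "I \<in> range initial" and xy: "x \<le> y" and c: "card I = card {x..y :: 'n}"
    then obtain m where m: "I = initial m" by blast
    have "minor Y I {x..y} = minor (tr Y) {x..y} (initial m)"
      using c by (simp add: minor_transpose m)
    also have "\<dots> = (\<Sum>K | card K = card {x..y}. minor L K {x..y} * minor g K (initial m))"
      unfolding YL cauchy_binet by (intro sum.cong) (simp_all add: minor_transpose)
    \<comment> \<open>No term is negative, and the term \<open>K = {x..y}\<close> is positive since
      \<open>L\<close> has ones on its diagonal.\<close>
    also have "\<dots> > 0"
    proof (rule sum_pos2[where i = "{x..y}"])
      show "0 < minor L {x..y} {x..y} * minor g {x..y} (initial m)"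
        using posg'[of "{x..y}" m] c by (simp add: minor_lower_diag L m)
      show "0 \<le> minor L K {x..y} * minor g K (initial m)" if "K \<in> {K. card K = card {x..y}}" for K
        using Lint[of K x y] posg'[of K m] xy c m that by simp
    qed (use c in auto)
    finally show "minor Y I {x..y} > 0" .
  qed (use that in auto)
  define M where "M = tr Y"
  have M: "\<And>i j. i < j \<Longrightarrow> M $ i $ j = 0" using Y by (simp add: M_def upper_B_zero)
  have Mleft: "minor M K (initial m) > 0" if "card K = card (initial m :: 'n set)" for m K
    using Ytop[of m K] that by (simp add: M_def minor_transpose)
  have "minor M (- initial m) J > 0"
  proof (rule fekete[where F = "range (\<lambda>m. - initial m)"])
    show "\<exists>i\<in>I. I - {i} \<in> range (\<lambda>m. - initial m)" if I: "I \<in> range (\<lambda>m. - initial m)" "I \<noteq> {}" for I :: "'n set"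
    proof
      obtain m where m: "I = - initial m" using I by blast
      show mem: "Min I \<in> I" using I by simp
      have "I - {Min I} = - initial (Suc (pos (Min I)))"
      proof (intro equalityI subsetI)
        fix i assume "i \<in> I - {Min I}"
        then have "Min I < i" by (auto simp: order_less_le)
        then show "i \<in> - initial (Suc (pos (Min I)))" by (simp add: mem_initial less_Suc_eq_le pos_le_iff)
      next
        fix i :: 'n assume "i \<in> - initial (Suc (pos (Min I)))"
        then have "Min I < i" by (simp add: mem_initial less_Suc_eq_le pos_le_iff)
        moreover then have "pos (Min I) < pos i" by (simp add: pos_less_iff)
        ultimately show "i \<in> I - {Min I}" using mem by (auto simp: m mem_initial)
      qed
      then show "I - {Min I} \<in> range (\<lambda>m. - initial m)" by simp
    qed
  next
    fix I :: "'n set" and x y assume "I \<in> range (\<lambda>m. - initial m)" and xy: "x \<le> y" and c: "card I = card {x..y :: 'n}"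
    then obtain m where m: "I = - initial m" by blast
    \<comment> \<open>A final segment of the size of \<open>{x..y}\<close> starts no earlier than
      \<open>x\<close>, since \<open>{x..y}\<close> itself fits between \<open>x\<close> and the
      largest index. So bordering by \<open>{..<x}\<close> applies to the rows as well.\<close>
    have "card ({..<x} \<union> {x..y}) \<le> CARD('n)" by (rule card_le_CARD)
    then have "pos x + card {x..y} \<le> CARD('n)"
      by (subst (asm) card_Un_disjoint) auto
    moreover have "card (initial m :: 'n set) + card I = CARD('n)"
      using card_Un_disjoint[of "initial m" "- initial m :: 'n set"] by (simp add: m)
    ultimately have "pos x \<le> m" using c card_initial_le[of m, where 'n = 'n] by linarith
    then have xI: "x \<le> i" if "i \<in> I" for i
      using that by (simp add: m mem_initial flip: pos_le_iff)
    have ic: "{..<x} \<union> {x..y} = initial (Suc (pos y))"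
      unfolding atMost_eq_initial[symmetric] using xy by auto
    have "minor M ({..<x} \<union> I) ({..<x} \<union> {x..y}) = (\<Prod>j<x. M $ j $ j) * minor M I {x..y}"
      using xI c M by (intro minor_lower_block) auto
    moreover have "card ({..<x} \<union> I) = card ({..<x} \<union> {x..y})"
      using xI c by (subst (1 2) card_Un_disjoint) (auto simp: leD)
    moreover have "(\<Prod>j<x. M $ j $ j) > 0"
      using Mleft[of "{..<x}" "pos x"] by (simp add: minor_lower_diag M flip: lessThan_eq_initial)
    ultimately show "minor M I {x..y} > 0"
      using Mleft[of "{..<x} \<union> I" "Suc (pos y)"] by (simp add: ic zero_less_mult_iff)
  qed (use card in auto)
  \<comment> \<open>Since \<open>tr L\<close> is unit upper-triangular, \<open>M\<close> and
    \<open>g\<close> have the same bottom-justified minors.\<close>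
  moreover have "minor M (- initial m) J = (\<Prod>j\<in>- initial m. tr L $ j $ j) * minor g (- initial m) J"
    unfolding M_def YL using L card by (intro minor_upper_mult_final) auto
  ultimately show ?thesis by (simp add: L)
qed

lemma minor_iota_sign:
  fixes A :: "(real, 'n::{finite,linorder}) sqmat"
  assumes "card I = card J"
  shows "minor (delta ** A ** delta) I J = (-1) ^ ((\<Sum>i\<in>I. pos i) + (\<Sum>j\<in>J. pos j)) * minor A I J"
proof -
  have "delta ** A ** delta = (\<chi> i j. (-1) ^ pos i * A $ i $ j * (-1) ^ pos j)"
    by (simp add: Finite_Cartesian_Product.vec_eq_iff delta_conj_nth)
  then show ?thesis using assms by (simp add: minor_scale power_sum power_add)
qed

text \<open>Conjugation by \<open>delta\<close> produces exactly the sign in Jacobi's formula: ranks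
  over a set and its complement add up to a constant, so the total exponent is even. Thus
  \<open>det g\<close> times a left-justified minor of \<open>iota g\<close> is a bottom-justified
  minor of \<open>g\<close>.\<close>

lemma iota_orth_pos:
  fixes g :: "(real, 'n::{finite,linorder}) sqmat"
  assumes g: "g \<in> orth_pos"
  shows "iota g \<in> orth_pos"
proof -
  have orth: "orthogonal_matrix g" and posg: "\<And>I. left_minor g I > 0" using g by (auto simp: orth_pos_def)
  have "left_minor (iota g) I > 0" for I
  proof -
    obtain m where m: "card I = card (initial m :: 'n set)" "left_minor (iota g) I = minor (iota g) I (initial m)"
      using left_minor_eq by blast
    let ?s = "\<lambda>K :: 'n set. \<Sum>i\<in>K. pos i"
    have compl: "?s K + ?s (- K) = ?s UNIV" for K
      by (subst sum.union_disjoint[symmetric]) auto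
    have cc: "card (- initial m :: 'n set) = card (- I)"
      using m by (simp add: Compl_eq_Diff_UNIV card_Diff_subset)
    have gU: "minor g UNIV UNIV > 0"
    proof -
      have "(UNIV :: 'n set) = initial (CARD('n))" using bij_pos[where 'n = 'n] by (auto simp: bij_betw_def mem_initial)
      then show ?thesis using posg[of UNIV] by (simp add: left_minor_def)
    qed
    have "minor g UNIV UNIV * minor (iota g) I (initial m)
      = (-1) ^ (?s I + ?s (initial m)) * (minor g UNIV UNIV * minor (tr g) I (initial m))"
      using m by (simp add: iota_orthogonal orth minor_iota_sign)
    also have "minor g UNIV UNIV * minor (tr g) I (initial m) = (-1) ^ (?s (- initial m) + ?s (- I)) * minor g (- initial m) (- I)"
      using jacobi_complementary_minor[OF orthogonal_matrixD(2)[OF orth] cc] by simp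
    also have "(-1) ^ (?s I + ?s (initial m)) * \<dots> = (-1) ^ ((?s I + ?s (- I)) + (?s (initial m) + ?s (- initial m))) * minor g (- initial m) (- I)"
      by (simp add: power_add)
    also have "\<dots> = minor g (- initial m) (- I)"
      unfolding compl by (simp flip: mult_2)
    finally show ?thesis
      using gU bottom_minor_pos[OF g cc[symmetric]] m(2) by (metis zero_less_mult_pos)
  qed
  then show ?thesis using orth by (simp add: orth_pos_def orthogonal_iota)
qed

subsection \<open>Normalized orthogonal representatives\<close>

text \<open>The sums whose positivity defines the set \<open>S\<close> in the extension of the twist
  to a neighborhood.\<close>

definition left_sum :: "(real, 'n::{finite,linorder}) sqmat \<Rightarrow> nat \<Rightarrow> real" where
  "left_sum g m = (\<Sum>I | card I = card (initial m :: 'n set). minor g I (initial m))"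

text \<open>Cauchy--Binet for \<open>tr g ** g = mat 1\<close>.\<close>

lemma sum_left_minor_sq:
  fixes g :: "(real, 'n::{finite,linorder}) sqmat"
  assumes "orthogonal_matrix g"
  shows "(\<Sum>I | card I = card (initial m :: 'n set). (minor g I (initial m))\<^sup>2) = 1"
proof -
  have "1 = minor (tr g ** g) (initial m) (initial m)"
    by (simp add: orthogonal_matrixD(1)[OF assms] minor_upper_diag)
  also have "\<dots> = (\<Sum>I | card I = card (initial m :: 'n set). (minor g I (initial m))\<^sup>2)"
    unfolding cauchy_binet by (intro sum.cong) (simp_all add: minor_transpose power2_eq_square)
  finally show ?thesis by simp
qed

lemma left_sum_pos:
  fixes g :: "(real, 'n::{finite,linorder}) sqmat"
  assumes "orthogonal_matrix g" "\<And>I. left_minor g I \<ge> 0"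
  shows "left_sum g m > 0"
proof -
  have nn: "minor g I (initial m) \<ge> 0" if "card I = card (initial m :: 'n set)" for I
    using assms(2)[of I] left_minor_initial[OF that, of g] by simp
  have "left_sum g m \<ge> 0" unfolding left_sum_def using nn by (intro sum_nonneg) simp
  moreover have "left_sum g m \<noteq> 0"
  proof
    assume "left_sum g m = 0"
    then have "minor g I (initial m) = 0" if "card I = card (initial m :: 'n set)" for I
      using that nn sum_nonneg_eq_0_iff[of "{I. card I = card (initial m :: 'n set)}" "\<lambda>I. minor g I (initial m)"]
      by (simp add: left_sum_def)
    then show False using sum_left_minor_sq[OF assms(1), of m] by simp
  qed
  ultimately show ?thesis by simp
qed

text \<open>The inverse of \<open>b\<close> is upper-triangular and equals its transpose, so
  \<open>b\<close> is diagonal with entries 1 or -1. Passing from \<open>k\<close> to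
  \<open>k ** b\<close> multiplies the sum for \<open>m\<close> by the first \<open>m\<close>
  diagonal entries, so all these products are positive, and hence every entry is.\<close>

lemma orthogonal_upper_unique:
  fixes k b :: "(real, 'n::{finite,linorder}) sqmat"
  assumes b: "\<And>i j. j < i \<Longrightarrow> b $ i $ j = 0" "orthogonal_matrix b"
    and s: "\<And>m. left_sum k m > 0" "\<And>m. left_sum (k ** b) m > 0"
  shows "b = mat 1"
proof -
  have off: "b $ i $ j = 0" if "i \<noteq> j" for i j
    using inverse_upper[of "tr b" b i] orthogonal_matrixD(1)[OF b(2)] b(1) that by (cases i j rule: linorder_cases) auto
  have sq: "b $ j $ j * b $ j $ j = 1" for j
  proof -
    have "(tr b ** b) $ j $ j = (\<Sum>l\<in>UNIV. b $ l $ j * b $ l $ j)"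
      by (simp add: matrix_matrix_mult_def)
    also have "\<dots> = (\<Sum>l\<in>UNIV. if l = j then b $ j $ j * b $ j $ j else 0)"
      by (intro sum.cong) (auto simp: off)
    finally show ?thesis by (simp add: orthogonal_matrixD(1)[OF b(2)])
  qed
  have prod: "(\<Prod>j\<in>initial m. b $ j $ j) > 0" for m
  proof -
    have "left_sum (k ** b) m = left_sum k m * (\<Prod>j\<in>initial m. b $ j $ j)"
      unfolding left_sum_def sum_distrib_right using b(1) by (intro sum.cong) (auto intro!: minor_mult_upper)
    then show ?thesis using s[of m] by (simp add: zero_less_mult_iff)
  qed
  have "b $ j $ j = 1" for j
  proof -
    have "(\<Prod>i\<in>initial (Suc (pos j)). b $ i $ i) = b $ j $ j * (\<Prod>i\<in>initial (pos j). b $ i $ i)"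
      by (simp add: initial_Suc_pos initial_pos)
    then have "b $ j $ j > 0" using prod[of "Suc (pos j)"] prod[of "pos j"] by (simp add: zero_less_mult_iff)
    then show ?thesis using sq[of j] by (auto simp: square_eq_1_iff)
  qed
  then show ?thesis using off by (simp add: Finite_Cartesian_Product.vec_eq_iff)
qed

subsection \<open>Real flags\<close>

lemma flag_mult_upper: "b \<in> upper_B \<Longrightarrow> flag (g ** b) = flag g"
proof (intro equalityI subsetI)
  fix h assume b: "b \<in> upper_B"
  show "h \<in> flag g" if "h \<in> flag (g ** b)"
    using that b upper_B_mult by (auto simp: flag_def simp flip: matrix_mul_assoc)
  show "h \<in> flag (g ** b)" if h: "h \<in> flag g"
  proof -
    obtain c where c: "c \<in> upper_B" "h = g ** c" using h by (auto simp: flag_def)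
    have "g ** c = g ** b ** (matrix_inv b ** c)"
      using b by (simp add: matrix_mul_assoc) (simp add: invertible_matrix_inv upper_B_def flip: matrix_mul_assoc)
    then show ?thesis using c b upper_B_mult upper_B_matrix_inv unfolding flag_def by blast
  qed
qed

lemma flag_eq_iff: "flag g = flag h \<longleftrightarrow> (\<exists>b\<in>upper_B. h = g ** b)"
proof
  assume "flag g = flag h"
  moreover have "h \<in> flag h" using upper_B_mat_1 by (force simp: flag_def)
  ultimately show "\<exists>b\<in>upper_B. h = g ** b" by (auto simp: flag_def)
qed (auto simp: flag_mult_upper)

lemma complexify_nth [simp]: "complexify A $ i $ j = complex_of_real (A $ i $ j)"
  by (simp add: complexify_def)

lemma complexify_mult: "complexify (A ** B) = complexify A ** complexify B"
  by (simp add: Finite_Cartesian_Product.vec_eq_iff matrix_matrix_mult_def)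

lemma complexify_mat_1: "complexify (mat 1) = mat 1"
  by (simp add: Finite_Cartesian_Product.vec_eq_iff)

lemma complexify_tr: "complexify (tr A) = tr (complexify A)"
  by (simp add: Finite_Cartesian_Product.vec_eq_iff)

lemma invertible_complexify: "invertible A \<Longrightarrow> invertible (complexify A)"
  by (metis complexify_mat_1 complexify_mult invertibleI(1) invertible_matrix_inv(1))

lemma complexify_upper_B: "b \<in> upper_B \<Longrightarrow> complexify b \<in> upper_B"
  by (simp add: upper_B_def invertible_complexify)

lemma real_flag_mult_upper: "b \<in> upper_B \<Longrightarrow> real_flag (g ** b) = real_flag g"
  by (simp add: real_flag_def complexify_mult flag_mult_upper complexify_upper_B)

text \<open>The complex triangular factor relating the two matrices is the complexification of
  \<open>matrix_inv g ** h\<close>, hence real: real flags are not identified further over the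
  complex numbers.\<close>

lemma real_flag_eqD:
  assumes "real_flag g = real_flag h" "invertible g" "invertible h"
  shows "matrix_inv g ** h \<in> upper_B"
proof -
  obtain b where b: "b \<in> upper_B" "complexify h = complexify g ** b"
    using assms(1) by (auto simp: real_flag_def flag_eq_iff)
  have "complexify (matrix_inv g ** h) = complexify (matrix_inv g ** g) ** b"
    by (simp add: complexify_mult b(2) matrix_mul_assoc)
  then have eq: "complexify (matrix_inv g ** h) = b"
    by (simp add: invertible_matrix_inv assms complexify_mat_1)
  have "(matrix_inv g ** h) $ i $ j = 0" if "j < i" for i j
    using upper_B_zero[OF b(1) that] by (simp flip: eq)
  moreover have "invertible (matrix_inv g ** h)"
    by (rule invertible_mult[OF invertibleI(1)[OF invertible_matrix_inv(2)[OF assms(2)]] assms(3)])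
  ultimately show ?thesis by (simp add: upper_B_def)
qed

lemma orthogonal_rep_unique:
  fixes k k' :: "(real, 'n::{finite,linorder}) sqmat"
  assumes "orthogonal_matrix k" "orthogonal_matrix k'" "real_flag k = real_flag k'"
    and "\<And>m. left_sum k m > 0" "\<And>m. left_sum k' m > 0"
  shows "k' = k"
proof -
  have inv: "matrix_inv k = tr k" using matrix_inv_eqI[OF orthogonal_matrixD(2)] assms(1) by blast
  have b: "tr k ** k' \<in> upper_B"
    using real_flag_eqD[OF assms(3)] assms(1,2) inv invertible_orthogonal by metis
  have eq: "k ** (tr k ** k') = k'"
    by (simp add: matrix_mul_assoc orthogonal_matrixD(2)[OF assms(1)])
  have "tr k ** k' = mat 1"
    using orthogonal_upper_unique[of "tr k ** k'" k] assms upper_B_zero[OF b] eq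
    by (simp add: orthogonal_matrix_mul)
  then show ?thesis using eq by simp
qed

subsection \<open>Totally positive flags\<close>

lemma totally_positive_left_minor: "totally_positive A \<Longrightarrow> left_minor A I > 0"
  by (simp add: totally_positive_def left_minor_def card_initial card_le_CARD)

lemma flags_pos_subset: "(flags_pos :: 'n::{finite,linorder} flag set) \<subseteq> real_flag ` orth_pos"
proof
  fix V :: "'n flag" assume "V \<in> flags_pos"
  then obtain A where A: "totally_positive A" "V = real_flag A" by (auto simp: flags_pos_def)
  have "minor A UNIV UNIV > 0" using A(1) by (simp add: totally_positive_def)
  then have "invertible A" by (intro invertible_if_minor) simp
  then obtain R where R: "R \<in> upper_B" "\<And>j. R $ j $ j > 0" "A = gs_matrix A ** R" and orth: "orthogonal_matrix (gs_matrix A)"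
    using qr_decomposition orthogonal_gs_matrix by metis
  have "left_minor (gs_matrix A) I > 0" for I
  proof -
    obtain m where m: "card I = card (initial m :: 'n set)" using left_minor_eq by blast
    have "left_minor A I = left_minor (gs_matrix A) I * (\<Prod>j\<in>initial m. R $ j $ j)"
      unfolding left_minor_initial[OF m] using minor_mult_upper[OF upper_B_zero[OF R(1)] m, of "gs_matrix A"] R(3) by simp
    moreover have "(\<Prod>j\<in>initial m. R $ j $ j) > 0" using R(2) by (intro prod_pos) simp
    ultimately show ?thesis using totally_positive_left_minor[OF A(1), of I] by (simp add: zero_less_mult_iff)
  qed
  moreover have "V = real_flag (gs_matrix A)"
    using A(2) R(1,3) real_flag_mult_upper by metis
  ultimately show "V \<in> real_flag ` orth_pos" using orth by (simp add: orth_pos_def)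
qed

text \<open>Exchange argument: \<open>K\<close> and \<open>initial m\<close> differ by equally many
  elements on each side, of rank at least \<open>m\<close> in \<open>K\<close> and less than
  \<open>m\<close> in \<open>initial m\<close>.\<close>

lemma sum_pos_initial_less:
  fixes K :: "'n::{finite,linorder} set"
  assumes "card K = card (initial m :: 'n set)" "K \<noteq> initial m"
  shows "(\<Sum>j\<in>(initial m :: 'n set). pos j) < (\<Sum>j\<in>K. pos j)"
proof -
  let ?J = "initial m :: 'n set"
  have eq: "card (K - ?J) = card (?J - K)"
    using assms(1) by (metis card_Diff_subset_Int finite Int_commute)
  obtain i where "i \<in> K" "i \<notin> ?J" using obtain_outside assms by metis
  then have c0: "card (?J - K) > 0" unfolding eq[symmetric] by (auto simp: card_gt_0_iff)
  have "(\<Sum>j\<in>?J - K. pos j) < (\<Sum>j\<in>?J - K. m)"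
    using c0 by (intro sum_strict_mono) (auto simp: mem_initial card_gt_0_iff)
  also have "\<dots> = (\<Sum>j\<in>K - ?J. m)" by (simp add: eq)
  also have "\<dots> \<le> (\<Sum>j\<in>K - ?J. pos j)" by (intro sum_mono) (auto simp: mem_initial)
  finally have "(\<Sum>j\<in>?J - K. pos j) < (\<Sum>j\<in>K - ?J. pos j)" .
  moreover have "(\<Sum>j\<in>?J. pos j) = (\<Sum>j\<in>?J - K. pos j) + (\<Sum>j\<in>?J \<inter> K. pos j)"
    by (subst sum.union_disjoint[symmetric]) (auto intro: arg_cong[of _ _ "sum pos"])
  moreover have "(\<Sum>j\<in>K. pos j) = (\<Sum>j\<in>K - ?J. pos j) + (\<Sum>j\<in>?J \<inter> K. pos j)"
    by (subst sum.union_disjoint[symmetric]) (auto intro: arg_cong[of _ _ "sum pos"])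
  ultimately show ?thesis by linarith
qed

text \<open>Scaling the rows of \<open>U\<close> by rapidly decreasing factors makes the term with the left-justified minor of \<open>g\<close>
  dominate in the Cauchy--Binet expansion of every minor of the product.\<close>

lemma left_minor_pos_dominant:
  fixes g U :: "(real, 'n::{finite,linorder}) sqmat"
  assumes g: "\<And>I. left_minor g I > 0" and U: "U \<in> upper_B"
    and top: "\<And>m J. card J = card (initial m :: 'n set) \<Longrightarrow> minor U (initial m) J > 0"
  shows "\<exists>b\<in>upper_B. totally_positive (g ** b)"
proof -
  define b :: "real \<Rightarrow> (real, 'n) sqmat" where "b e = (\<chi> i j. e ^ pos i * U $ i $ j * 1)" for e
  have ev: "eventually (\<lambda>e. minor (g ** b e) I J > 0) (at_right 0)" if c: "card I = card J" for I J
  proof -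
    obtain m where m: "card I = card (initial m :: 'n set)" "left_minor g I = minor g I (initial m)"
      using left_minor_eq by blast
    let ?s = "\<lambda>K :: 'n set. \<Sum>i\<in>K. pos i"
    \<comment> \<open>The minor of \<open>g ** b e\<close> with its lowest power of \<open>e\<close>
      divided out, so that a limit at 0 exists and reveals the sign.\<close>
    define f where "f e = (\<Sum>K | card K = card I. minor g I K * minor U K J * e ^ (?s K - ?s (initial m)))" for e :: real
    have le: "?s (initial m) \<le> ?s K" if "card K = card I" for K
      using sum_pos_initial_less[of K m] that m(1) by (cases "K = initial m") auto
    have minor_b: "minor (g ** b e) I J = e ^ ?s (initial m) * f e" for e
      unfolding cauchy_binet f_def sum_distrib_left
    proof (intro sum.cong refl)
      fix K :: "'n set" assume K: "K \<in> {K. card K = card I}"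
      have "minor (b e) K J = e ^ ?s K * minor U K J"
        unfolding b_def using K c by (subst minor_scale) (simp_all add: power_sum)
      moreover have "e ^ ?s K = e ^ ?s (initial m) * e ^ (?s K - ?s (initial m))"
        using le[of K] K by (simp flip: power_add)
      ultimately show "minor g I K * minor (b e) K J
        = e ^ ?s (initial m) * (minor g I K * minor U K J * e ^ (?s K - ?s (initial m)))" by simp
    qed
    \<comment> \<open>As \<open>0 ^ 0 = 1\<close>, exactly the term with the least exponent
      survives.\<close>
    have "f 0 = (\<Sum>K | card (K :: 'n set) = card I. if K = initial m then minor g I (initial m) * minor U (initial m) J else 0)"
      unfolding f_def
    proof (rule sum.cong[OF refl])
      fix K :: "'n set" assume "K \<in> {K. card K = card I}"
      then show "minor g I K * minor U K J * 0 ^ (?s K - ?s (initial m)) =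
        (if K = initial m then minor g I (initial m) * minor U (initial m) J else 0)"
        using sum_pos_initial_less[of K m] m(1) by auto
    qed
    then have "f 0 > 0" using g[of I] m top[of J m] c by (simp add: sum.delta)
    moreover have "(f \<longlongrightarrow> f 0) (at_right 0)"
      unfolding f_def by (intro tendsto_intros)
    ultimately have "eventually (\<lambda>e. f e > 0) (at_right 0)" by (metis order_tendstoD(1))
    then show ?thesis
      using eventually_at_right_less by eventually_elim (simp add: minor_b)
  qed
  \<comment> \<open>There are finitely many pairs of index sets, so one \<open>e\<close> serves all
    minors.\<close>
  have "eventually (\<lambda>e. \<forall>p\<in>{(I, J). card I = card J}. minor (g ** b e) (fst p) (snd p) > 0) (at_right 0)"
    using ev by (intro eventually_ball_finite) auto
  then have "eventually (\<lambda>e. totally_positive (g ** b e) \<and> e > 0) (at_right 0)"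
    using eventually_at_right_less by eventually_elim (auto simp: totally_positive_def)
  then obtain e where e: "totally_positive (g ** b e)" "e > 0"
    using eventually_happens' trivial_limit_at_right_real by blast
  have "invertible (tr (b e))"
    using U e(2) by (intro invertible_lower) (auto simp: b_def upper_B_zero upper_B_diag_nonzero)
  then have "b e \<in> upper_B"
    using U by (auto simp: upper_B_def b_def invertible_transpose)
  then show ?thesis using e by blast
qed

text \<open>Nonemptiness provides a totally positive \<open>A\<close>. In
  \<open>A = (mat 1 + reduced A) ** U\<close> the left factor is unit lower-triangular, so the
  top-justified minors of \<open>U\<close> are those of \<open>A\<close>; hence \<open>U\<close>
  qualifies for \<open>left_minor_pos_dominant\<close>.\<close>

lemma flags_pos_eq:
  assumes "(flags_pos :: 'n::{finite,linorder} flag set) \<noteq> {}"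
  shows "(flags_pos :: 'n flag set) = real_flag ` orth_pos"
proof
  show "real_flag ` orth_pos \<subseteq> (flags_pos :: 'n flag set)"
  proof
    fix V :: "'n flag" assume "V \<in> real_flag ` orth_pos"
    then obtain g where g: "orthogonal_matrix g" "\<And>I. left_minor g I > 0" "V = real_flag g"
      by (auto simp: orth_pos_def)
    obtain A :: "(real, 'n) sqmat" where A: "totally_positive A" using assms by (auto simp: flags_pos_def)
    obtain Y where Y: "Y \<in> upper_B" "A ** Y = mat 1 + reduced A"
      using column_reduction_upper_B minor_leading_nonzero_if_pos totally_positive_left_minor[OF A] by metis
    define U where "U = matrix_inv Y"
    have U: "U \<in> upper_B" "A = (mat 1 + reduced A) ** U"
      using Y invertible_matrix_inv[of Y]
      by (simp_all add: U_def upper_B_matrix_inv flip: Y(2) matrix_mul_assoc) (simp add: upper_B_def)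
    have "minor U (initial m) J > 0" if "card J = card (initial m :: 'n set)" for m J
    proof -
      have "minor A (initial m) J = (\<Prod>j\<in>initial m. (mat 1 + reduced A) $ j $ j) * minor U (initial m) J"
        by (subst U(2)) (rule minor_lower_mult, simp_all add: reduced_upper_zero that)
      moreover have "minor A (initial m) J > 0" using A that unfolding totally_positive_def by metis
      ultimately show ?thesis by (simp add: reduced_upper_zero)
    qed
    then obtain b where "b \<in> upper_B" "totally_positive (g ** b)"
      using left_minor_pos_dominant[OF g(2) U(1)] by blast
    then show "V \<in> flags_pos"
      using g(3) real_flag_mult_upper[of b g] unfolding flags_pos_def by (metis image_eqI mem_Collect_eq)
  qed
qed (rule flags_pos_subset)

subsection \<open>The closure of the positive flags\<close>

text \<open>Taken as a closure, not by nonnegative minors, so that invariance under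
  \<open>iota\<close> follows by continuity; nonnegativity is only derived from it.\<close>

definition orth_nonneg :: "(real, 'n::{finite,linorder}) sqmat set" where
  "orth_nonneg = closure orth_pos"

lemma continuous_on_minor: "continuous_on S (\<lambda>A :: (real, 'n::{finite,linorder}) sqmat. minor A I J)"
  unfolding minor_eq_list_minor list_minor_expand by (intro continuous_intros)

lemma orth_nonnegD:
  fixes k :: "(real, 'n::{finite,linorder}) sqmat"
  assumes "k \<in> orth_nonneg"
  shows "orthogonal_matrix k" "left_minor k I \<ge> 0"
proof -
  let ?C = "{g :: (real, 'n) sqmat. (\<forall>i j. (\<Sum>l\<in>UNIV. g $ l $ i * g $ l $ j) = (if i = j then 1 else 0)) \<and>
    (\<forall>I. 0 \<le> minor g I (initial (card I)))}"
  have orth: "orthogonal_matrix g \<longleftrightarrow> (\<forall>i j. (\<Sum>l\<in>UNIV. g $ l $ i * g $ l $ j) = (if i = j then 1 else 0))"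
    for g :: "(real, 'n) sqmat"
    by (simp add: orthogonal_matrix Finite_Cartesian_Product.vec_eq_iff matrix_matrix_mult_def)
  have "closed ?C"
    by (intro closed_Collect_conj closed_Collect_all closed_Collect_eq closed_Collect_le
      continuous_on_minor continuous_intros)
  moreover have "orth_pos \<subseteq> ?C"
    using orth by (auto simp: orth_pos_def left_minor_def intro: less_imp_le)
  ultimately have "orth_nonneg \<subseteq> ?C" unfolding orth_nonneg_def by (rule closure_minimal[rotated])
  then have "k \<in> ?C" using assms by blast
  then show "orthogonal_matrix k" "left_minor k I \<ge> 0"
    using orth by (auto simp: left_minor_def)
qed

lemma orth_nonneg_left_sum: "k \<in> orth_nonneg \<Longrightarrow> left_sum k m > 0"
  by (intro left_sum_pos orth_nonnegD)

lemma orth_pos_subset_nonneg: "orth_pos \<subseteq> orth_nonneg"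
  by (simp add: orth_nonneg_def closure_subset)

lemma compact_orth_nonneg: "compact (orth_nonneg :: (real, 'n::{finite,linorder}) sqmat set)"
proof -
  have "norm g \<le> real CARD('n)" if "g \<in> orth_nonneg" for g :: "(real, 'n) sqmat"
  proof -
    have "norm (g $ i) = 1" for i
      using orth_nonnegD(1)[OF that] by (simp add: orthogonal_matrix_orthonormal_rows Finite_Cartesian_Product.row_def)
    then show ?thesis
      using L2_set_le_sum[of UNIV "\<lambda>i. norm (g $ i)"] by (simp add: norm_vec_def)
  qed
  then have "bounded (orth_nonneg :: (real, 'n) sqmat set)" by (auto simp: bounded_iff)
  then show ?thesis by (simp add: compact_eq_bounded_closed orth_nonneg_def)
qed

lemma iota_orth_nonneg:
  fixes k :: "(real, 'n::{finite,linorder}) sqmat"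
  assumes "k \<in> orth_nonneg"
  shows "iota k \<in> orth_nonneg"
proof -
  \<comment> \<open>A linear formula that agrees with \<open>iota\<close> on orthogonal matrices and
    is continuous everywhere, unlike \<open>matrix_inv\<close>.\<close>
  define h where "h g = (\<chi> i j. (-1) ^ pos i * g $ j $ i * (-1) ^ pos j)" for g :: "(real, 'n) sqmat"
  have h: "h g = delta ** tr g ** delta" for g
    by (simp add: h_def Finite_Cartesian_Product.vec_eq_iff delta_conj_nth)
  have "continuous_on UNIV h" unfolding h_def by (intro continuous_intros)
  moreover have "h ` orth_pos \<subseteq> orth_nonneg"
  proof
    fix x assume "x \<in> h ` orth_pos"
    then obtain g where g: "g \<in> orth_pos" "x = h g" by blast
    then have "x = iota g" by (simp add: h iota_orthogonal orth_pos_def)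
    then show "x \<in> orth_nonneg" using iota_orth_pos[OF g(1)] orth_pos_subset_nonneg by blast
  qed
  ultimately have "h ` orth_nonneg \<subseteq> orth_nonneg"
    unfolding orth_nonneg_def by (intro image_closure_subset) (auto intro: continuous_on_subset)
  moreover have "iota k = h k" using orth_nonnegD(1)[OF assms] by (simp add: h iota_orthogonal)
  ultimately show ?thesis using assms by auto
qed

lemma real_flag_in_variety: "invertible g \<Longrightarrow> real_flag g \<in> flag_variety"
  by (simp add: real_flag_def flag_variety_def GL_def invertible_complexify)

lemma continuous_on_complexify: "continuous_on S complexify"
  unfolding complexify_def by (intro continuous_intros)

text \<open>In the quotient topology closedness is tested on the preimage in \<open>GL\<close>. If
  \<open>x n\<close> tends to \<open>l\<close> and has representatives \<open>k n\<close>,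
  compactness yields a convergent subsequence of these; the triangular matrices
  \<open>tr (k n) ** x n\<close> converge along it, and the limit is triangular and
  invertible.\<close>

lemma closedin_flags_orth_nonneg:
  "closedin flag_topology (real_flag ` (orth_nonneg :: (real, 'n::{finite,linorder}) sqmat set))"
proof -
  let ?C = "real_flag ` (orth_nonneg :: (real, 'n) sqmat set)"
  have "l \<in> {g \<in> GL. flag g \<in> ?C}" if x: "\<And>n. x n \<in> {g \<in> GL. flag g \<in> ?C}" and l: "l \<in> GL" "x \<longlonglongrightarrow> l" for x :: "nat \<Rightarrow> (complex, 'n) sqmat" and l
  proof -
    have "\<exists>k. \<forall>n. k n \<in> orth_nonneg \<and> flag (x n) = real_flag (k n)"
      using x by (intro choice) blast
    then obtain k where k: "\<And>n. k n \<in> orth_nonneg" "\<And>n. flag (x n) = real_flag (k n)" by blast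
    obtain k0 r where r: "k0 \<in> orth_nonneg" "strict_mono r" "(k \<circ> r) \<longlonglongrightarrow> k0"
      using compact_orth_nonneg k(1) unfolding compact_def by metis
    define b where "b = tr (complexify k0) ** l"
    have upper: "(tr (complexify (k n)) ** x n) $ i $ j = 0" if "j < i" for n i j
    proof -
      obtain c where c: "c \<in> upper_B" "x n = complexify (k n) ** c"
        using k(2)[of n] unfolding real_flag_def by (metis flag_eq_iff)
      have "tr (complexify (k n)) ** x n = complexify (tr (k n) ** k n) ** c"
        by (simp add: c(2) complexify_mult complexify_tr matrix_mul_assoc)
      also have "\<dots> = c" by (simp add: orthogonal_matrixD orth_nonnegD(1)[OF k(1)] complexify_mat_1)
      finally show ?thesis using upper_B_zero[OF c(1) that] by simp
    qed
    have lim: "(\<lambda>n. (tr (complexify (k (r n))) ** x (r n)) $ i $ j) \<longlonglongrightarrow> b $ i $ j" for i j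
    proof -
      have "(\<lambda>n. x (r n)) \<longlonglongrightarrow> l" using LIMSEQ_subseq_LIMSEQ[OF l(2) r(2)] by (simp add: o_def)
      moreover have "(\<lambda>n. k (r n)) \<longlonglongrightarrow> k0" using r(3) by (simp add: o_def)
      ultimately show ?thesis
        unfolding b_def matrix_matrix_mult_def by (simp, intro tendsto_intros)
    qed
    have "b $ i $ j = 0" if "j < i" for i j
      using lim[of i j] upper[OF that] by (simp add: LIMSEQ_const_iff)
    moreover have "invertible b"
      using l(1) orth_nonnegD(1)[OF r(1)] unfolding b_def GL_def complexify_tr[symmetric]
      by (intro invertible_mult invertible_complexify) (auto simp: invertible_transpose invertible_orthogonal)
    ultimately have "b \<in> upper_B" by (simp add: upper_B_def)
    moreover have "l = complexify k0 ** b"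
      by (simp add: b_def matrix_mul_assoc orthogonal_matrixD orth_nonnegD(1)[OF r(1)] complexify_mat_1
        flip: complexify_tr complexify_mult)
    ultimately have "flag l = real_flag k0" by (simp add: real_flag_def flag_mult_upper)
    then show ?thesis using l(1) r(1) by blast
  qed
  then have "closedin (top_of_set GL) {g \<in> GL. flag g \<in> ?C}"
    unfolding closedin_limpt islimpt_sequential by blast
  then have "openin (top_of_set GL) (GL - {g \<in> GL. flag g \<in> ?C})"
    by (rule openin_diff[rotated]) simp
  moreover have "GL - {g \<in> GL. flag g \<in> ?C} = {g \<in> GL. flag g \<in> flag_variety - ?C}"
    by (auto simp: flag_variety_def)
  moreover have "?C \<subseteq> flag_variety"
    using orth_nonnegD(1) by (auto intro!: real_flag_in_variety invertible_orthogonal)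
  ultimately show ?thesis
    by (simp add: closedin_def topspace_flag_topology openin_flag_topology)
qed

text \<open>One inclusion is closedness of the right-hand side. For the other, an open set of flags
  around \<open>real_flag k\<close> is pulled back to matrices near \<open>k\<close>, among which
  there are elements of \<open>orth_pos\<close>.\<close>

lemma flags_nonneg_eq:
  assumes "(flags_pos :: 'n::{finite,linorder} flag set) \<noteq> {}"
  shows "(flags_nonneg :: 'n flag set) = real_flag ` orth_nonneg"
proof
  show "flags_nonneg \<subseteq> real_flag ` (orth_nonneg :: (real, 'n) sqmat set)"
    unfolding flags_nonneg_def
    using flags_pos_subset orth_pos_subset_nonneg
    by (intro closure_of_minimal closedin_flags_orth_nonneg) blast
  show "real_flag ` (orth_nonneg :: (real, 'n) sqmat set) \<subseteq> flags_nonneg"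
  proof
    fix V :: "'n flag" assume "V \<in> real_flag ` orth_nonneg"
    then obtain k where k: "k \<in> orth_nonneg" "V = real_flag k" by blast
    have inv: "invertible k" using orth_nonnegD(1)[OF k(1)] by (rule invertible_orthogonal)
    have "\<exists>W\<in>flags_pos. W \<in> T" if T: "V \<in> T" "openin flag_topology T" for T
    proof -
      have "openin (top_of_set GL) {g \<in> GL. flag g \<in> T}" using T(2) by (simp add: openin_flag_topology)
      then obtain Q where Q: "open Q" "{g \<in> GL. flag g \<in> T} = GL \<inter> Q" by (auto simp: openin_open)
      have "complexify k \<in> {g \<in> GL. flag g \<in> T}"
        using T(1) k(2) inv by (simp add: GL_def invertible_complexify real_flag_def)
      then have "k \<in> complexify -` Q" using Q(2) by blast
      moreover have "open (complexify -` Q)"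
        using Q(1) continuous_on_complexify by (intro open_vimage) auto
      ultimately obtain k' where k': "k' \<in> orth_pos" "complexify k' \<in> Q"
        using k(1) unfolding orth_nonneg_def closure_iff_nhds_not_empty by (metis disjoint_iff vimage_eq order_refl)
      have "complexify k' \<in> GL"
        using k'(1) by (simp add: GL_def invertible_complexify invertible_orthogonal orth_pos_def)
      then have "real_flag k' \<in> T" using k'(2) Q(2) unfolding real_flag_def by blast
      then show ?thesis using k'(1) flags_pos_eq[OF assms] by blast
    qed
    then show "V \<in> flags_nonneg"
      using real_flag_in_variety[OF inv] k(2) unfolding flags_nonneg_def in_closure_of topspace_flag_topology by blast
  qed
qed

section \<open>The twist on positive and nonnegative flags\<close>

lemma flags_nonneg_imp_ne:
  "V \<in> (flags_nonneg :: 'n::{finite,linorder} flag set) \<Longrightarrow> (flags_pos :: 'n flag set) \<noteq> {}"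
  by (auto simp: flags_nonneg_def)

lemma flags_nonnegE:
  assumes "V \<in> flags_nonneg"
  obtains k where "k \<in> orth_nonneg" "V = real_flag k"
  using assms flags_nonneg_eq[OF flags_nonneg_imp_ne[OF assms]] by blast

lemma orth_rep_real_flag:
  fixes k :: "(real, 'n::{finite,linorder}) sqmat"
  assumes "k \<in> orth_nonneg"
  shows "orth_rep (real_flag k) = k"
  unfolding orth_rep_def
proof (rule the_equality)
  show "orthogonal_matrix k \<and> (\<forall>I. left_minor k I \<ge> 0) \<and> real_flag k = real_flag k"
    using orth_nonnegD[OF assms] by blast
  show "g = k" if "orthogonal_matrix g \<and> (\<forall>I. left_minor g I \<ge> 0) \<and> real_flag g = real_flag k" for g
    using that orthogonal_rep_unique[of k g] orth_nonnegD[OF assms] left_sum_pos by metis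
qed

lemma twist_real_flag: "k \<in> orth_nonneg \<Longrightarrow> twist (real_flag k) = real_flag (iota k)"
  by (simp add: twist_def orth_rep_real_flag)

lemma twist_twist: "V \<in> flags_nonneg \<Longrightarrow> twist (twist V) = V"
  by (elim flags_nonnegE) (simp add: twist_real_flag iota_orth_nonneg iota_iota orth_nonnegD)

lemma twist_flags_nonneg:
  assumes "V \<in> flags_nonneg"
  shows "twist V \<in> flags_nonneg"
proof -
  obtain k where k: "k \<in> orth_nonneg" "V = real_flag k" using assms by (rule flags_nonnegE)
  then show ?thesis
    using flags_nonneg_eq[OF flags_nonneg_imp_ne[OF assms]] iota_orth_nonneg[OF k(1)]
    by (auto simp: twist_real_flag)
qed

lemma flags_pos_subset_nonneg: "(flags_pos :: 'n::{finite,linorder} flag set) \<subseteq> flags_nonneg"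
proof -
  have "(flags_pos :: 'n flag set) \<subseteq> topspace flag_topology"
    using flags_pos_subset orth_nonnegD(1) orth_pos_subset_nonneg
    by (fastforce simp: topspace_flag_topology intro!: real_flag_in_variety invertible_orthogonal)
  then show ?thesis unfolding flags_nonneg_def by (rule closure_of_subset)
qed

lemma twist_flags_pos:
  assumes "V \<in> flags_pos"
  shows "twist V \<in> flags_pos"
proof -
  have eq: "(flags_pos :: 'a flag set) = real_flag ` orth_pos" using assms flags_pos_eq by blast
  then obtain k where "k \<in> orth_pos" "V = real_flag k" using assms by blast
  then show ?thesis
    using eq iota_orth_pos orth_pos_subset_nonneg by (metis image_eqI subsetD twist_real_flag)
qed

lemma twist_image_pos: "twist ` flags_pos = flags_pos"
proof
  show "twist ` flags_pos \<subseteq> flags_pos" using twist_flags_pos by blast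
  show "flags_pos \<subseteq> twist ` flags_pos"
  proof
    fix V assume V: "V \<in> flags_pos"
    then have "V = twist (twist V)" using twist_twist flags_pos_subset_nonneg by (metis subsetD)
    then show "V \<in> twist ` flags_pos" using twist_flags_pos[OF V] by (rule image_eqI)
  qed
qed

lemma twist_image_nonneg: "twist ` flags_nonneg = flags_nonneg"
proof
  show "twist ` flags_nonneg \<subseteq> flags_nonneg" using twist_flags_nonneg by blast
  show "flags_nonneg \<subseteq> twist ` flags_nonneg"
  proof
    fix V assume V: "V \<in> flags_nonneg"
    then have "V = twist (twist V)" by (simp add: twist_twist)
    then show "V \<in> twist ` flags_nonneg" using twist_flags_nonneg[OF V] by (rule image_eqI)
  qed
qed

subsection \<open>Signed permutation matrices and cells\<close>

definition monomial :: "('n::finite \<Rightarrow> 'n) \<Rightarrow> (real, 'n) sqmat \<Rightarrow> bool" where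
  "monomial w A \<longleftrightarrow> (\<forall>i j. if i = w j then A $ i $ j \<in> {1, -1} else A $ i $ j = 0)"

lemma monomialD:
  assumes "monomial w A"
  shows "A $ w j $ j * A $ w j $ j = 1" "i \<noteq> w j \<Longrightarrow> A $ i $ j = 0"
proof -
  have "A $ w j $ j \<in> {1, -1}" using assms unfolding monomial_def by presburger
  then show "A $ w j $ j * A $ w j $ j = 1" by auto
  show "A $ i $ j = 0" if "i \<noteq> w j" using assms that unfolding monomial_def by presburger
qed

lemma monomial_tr_mult:
  assumes "monomial w A" "monomial w B" "w permutes UNIV"
  shows "(tr A ** B) $ i $ j = (if i = j then A $ w i $ i * B $ w i $ i else 0)"
proof -
  have "(tr A ** B) $ i $ j = (\<Sum>l\<in>UNIV. A $ l $ i * B $ l $ j)"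
    by (simp add: matrix_matrix_mult_def)
  also have "\<dots> = (\<Sum>l\<in>UNIV. if l = w i then A $ w i $ i * B $ w i $ j else 0)"
    by (intro sum.cong) (auto simp: monomialD(2)[OF assms(1)])
  also have "\<dots> = A $ w i $ i * B $ w i $ j" by simp
  also have "\<dots> = (if i = j then A $ w i $ i * B $ w i $ i else 0)"
    using monomialD(2)[OF assms(2), of "w i" j] permutes_inj[OF assms(3)] by (auto dest: injD)
  finally show ?thesis .
qed

lemma monomial_orthogonal:
  assumes "monomial w A" "w permutes UNIV"
  shows "orthogonal_matrix A"
  unfolding orthogonal_matrix
  by (simp add: Finite_Cartesian_Product.vec_eq_iff monomial_tr_mult[OF assms(1,1,2)] monomialD(1)[OF assms(1)])

lemma monomial_minor_zero:
  fixes A :: "(real, 'n::{finite,linorder}) sqmat"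
  assumes "monomial w A" "w permutes UNIV" "card I = card (initial m :: 'n set)" "I \<noteq> w ` initial m"
  shows "minor A I (initial m) = 0"
proof -
  have "card (w ` initial m) = card (initial m :: 'n set)"
    using permutes_inj[OF assms(2)] by (intro card_image) (auto intro: inj_on_subset)
  then obtain i where "i \<in> I" "i \<notin> w ` initial m"
    using assms(3,4) obtain_outside by metis
  then show ?thesis
    using assms(3) by (intro minor_eq_0_row[of i]) (auto intro!: monomialD(2)[OF assms(1)])
qed

text \<open>For the unsigned permutation matrix \<open>P\<close>, the only possibly nonzero minor on
  the columns \<open>initial m\<close> is \<open>e m\<close>, and it is 1 or -1. The column signs
  \<open>s j\<close> are quotients of consecutive \<open>e m\<close>, so their products telescope to
  \<open>e m\<close> and each left-justified minor becomes a square or 0.\<close>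

lemma signed_perm_exists:
  fixes w :: "'n::{finite,linorder} \<Rightarrow> 'n"
  assumes w: "w permutes UNIV"
  shows "\<exists>A. monomial w A \<and> (\<forall>I. left_minor A I \<ge> 0)"
proof -
  define P :: "(real, 'n) sqmat" where "P = (\<chi> i j. if i = w j then 1 else 0)"
  have P: "monomial w P" by (simp add: P_def monomial_def)
  define e where "e m = minor P (w ` initial m) (initial m)" for m
  have ee: "e m * e m = 1" for m
  proof -
    have "1 = (\<Sum>I | card I = card (initial m :: 'n set). (minor P I (initial m))\<^sup>2)"
      using sum_left_minor_sq[OF monomial_orthogonal[OF P w]] by simp
    also have "\<dots> = (\<Sum>I | card I = card (initial m :: 'n set). if I = w ` initial m then e m * e m else 0)"
      using monomial_minor_zero[OF P w, of _ m] by (intro sum.cong) (auto simp: e_def power2_eq_square)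
    also have "\<dots> = e m * e m"
      using permutes_inj[OF w] by (subst sum.delta) (auto intro!: card_image intro: inj_on_subset)
    finally show ?thesis by simp
  qed
  define s where "s j = e (pos j) * e (Suc (pos j))" for j :: 'n
  have prod_s: "(\<Prod>j\<in>initial m. s j) = e m" for m
  proof (induction m)
    case 0
    have "initial 0 = ({} :: 'n set)" by (auto simp: mem_initial)
    then show ?case by (simp add: e_def minor_empty)
  next
    case (Suc m)
    show ?case
    proof (cases "\<exists>j :: 'n. pos j = m")
      case True
      then obtain j :: 'n where j: "m = pos j" by blast
      have "(\<Prod>i\<in>initial (Suc m). s i) = s j * (\<Prod>i\<in>initial m. s i)"
        unfolding j initial_Suc_pos initial_pos by simp
      also have "\<dots> = (e m * e m) * e (Suc m)" unfolding Suc.IH by (simp add: s_def j)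
      finally show ?thesis by (simp add: ee)
    next
      case False
      then have "initial (Suc m) = (initial m :: 'n set)" by (auto simp: mem_initial less_Suc_eq)
      then show ?thesis using Suc.IH by (simp add: e_def)
    qed
  qed
  define A where "A = (\<chi> i j. 1 * P $ i $ j * s j)"
  have "s j \<in> {1, -1}" for j
    using ee[of "pos j"] ee[of "Suc (pos j)"] by (auto simp: s_def square_eq_1_iff)
  then have "monomial w A" by (auto simp: A_def P_def monomial_def)
  moreover have "left_minor A I \<ge> 0" for I
  proof -
    obtain m where m: "card I = card (initial m :: 'n set)" using left_minor_eq by blast
    have "left_minor A I = e m * minor P I (initial m)"
      unfolding left_minor_initial[OF m] A_def minor_scale[OF m] by (simp add: prod_s)
    also have "\<dots> \<ge> 0"
    proof (cases "I = w ` initial m")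
      case True
      then have "e m * minor P I (initial m) = e m * e m" by (simp add: e_def)
      then show ?thesis by (simp add: ee)
    qed (simp add: monomial_minor_zero[OF P w m])
    finally show ?thesis .
  qed
  ultimately show ?thesis by blast
qed

text \<open>Unfolding the definite description needs uniqueness: two candidates differ by a diagonal
  orthogonal factor, and \<open>orthogonal_upper_unique\<close> makes it the identity.\<close>

lemma monomial_signed_perm:
  fixes w :: "'n::{finite,linorder} \<Rightarrow> 'n"
  assumes w: "w permutes UNIV"
  shows "monomial w (signed_perm w)"
proof -
  have "\<exists>!A. monomial w A \<and> (\<forall>I. left_minor A I \<ge> 0)"
  proof (rule ex_ex1I[OF signed_perm_exists[OF w]])
    fix A B assume A: "monomial w A \<and> (\<forall>I. left_minor A I \<ge> 0)" and B: "monomial w B \<and> (\<forall>I. left_minor B I \<ge> 0)"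
    have orth: "orthogonal_matrix A" "orthogonal_matrix B" using A B w monomial_orthogonal by blast+
    have AB: "A ** (tr A ** B) = B" by (simp add: matrix_mul_assoc orthogonal_matrixD[OF orth(1)])
    have "tr A ** B = mat 1"
    proof (rule orthogonal_upper_unique)
      show "(tr A ** B) $ i $ j = 0" if "j < i" for i j
        using A B that monomial_tr_mult[of w A B i j] w by auto
      show "orthogonal_matrix (tr A ** B)" using orth by (simp add: orthogonal_matrix_mul)
      show "left_sum A m > 0" for m using A orth by (intro left_sum_pos) auto
      show "left_sum (A ** (tr A ** B)) m > 0" for m unfolding AB using B orth by (intro left_sum_pos) auto
    qed
    then show "A = B" using AB by simp
  qed
  from theI'[OF this] show ?thesis unfolding signed_perm_def monomial_def by blast
qed

section \<open>The involution on the cells\<close>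

lemma complexify_delta: "complexify delta \<in> upper_B" "complexify delta \<in> lower_B"
  "complexify delta ** complexify delta = mat 1"
proof -
  show dd: "complexify delta ** complexify delta = mat 1"
    by (simp add: delta_delta complexify_mat_1 flip: complexify_mult)
  then show "complexify delta \<in> upper_B" "complexify delta \<in> lower_B"
    by (auto simp: upper_B_def lower_B_def delta_nth intro: invertibleI)
qed

text \<open>Both sides are signed permutation matrices of the inverse of \<open>v\<close>, possibly
  with different signs. The correction \<open>D\<close> is diagonal, so it can be absorbed into a
  lower- or an upper-triangular factor alike.\<close>

lemma iota_signed_perm:
  fixes v :: "'n::{finite,linorder} \<Rightarrow> 'n"
  assumes v: "v permutes UNIV"
  obtains D where "complexify D \<in> upper_B" "complexify D \<in> lower_B"
    "delta ** tr (signed_perm v) ** delta = D ** signed_perm (inv_into UNIV v)"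
proof
  let ?X = "delta ** tr (signed_perm v) ** delta"
  let ?Q = "signed_perm (inv_into UNIV v)"
  define D where "D = ?X ** tr ?Q"
  have v': "inv_into UNIV v permutes UNIV" using permutes_inv[OF v] .
  have Q: "monomial (inv_into UNIV v) ?Q" by (rule monomial_signed_perm[OF v'])
  have P: "monomial v (signed_perm v)" by (rule monomial_signed_perm[OF v])
  have orth: "orthogonal_matrix ?Q" "orthogonal_matrix ?X"
    using monomial_orthogonal[OF Q v'] monomial_orthogonal[OF P v]
    by (simp_all add: orthogonal_matrix_mul orthogonal_delta)
  have trQ: "monomial v (tr ?Q)"
    using Q permutes_inverses[OF v] unfolding monomial_def by (metis tr_nth)
  have trX: "monomial v (tr ?X)"
    using P unfolding monomial_def by (auto simp: delta_conj_nth minus_one_power_iff split: if_splits)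
  have "D = tr (tr ?X) ** tr ?Q" by (simp add: D_def)
  then have D0: "D $ i $ j = 0" if "i \<noteq> j" for i j
    using monomial_tr_mult[OF trX trQ v, of i j] that by simp
  have "invertible (complexify D)"
    using orth unfolding D_def by (intro invertible_complexify invertible_mult invertible_orthogonal) auto
  then show "complexify D \<in> upper_B" "complexify D \<in> lower_B"
    by (auto simp: upper_B_def lower_B_def D0)
  have "D ** ?Q = ?X ** (tr ?Q ** ?Q)" by (simp add: D_def matrix_mul_assoc)
  then show "?X = D ** ?Q" by (simp add: orthogonal_matrixD[OF orth(1)])
qed

text \<open>Transposition exchanges the factors of \<open>B\<^sup>- v B\<close> and inversion those of \<open>B w B\<close>; for
  orthogonal \<open>k\<close> both compute \<open>\<iota>(k)\<close>.\<close>

lemma iota_lower_cell: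
  fixes k :: "(real, 'n::{finite,linorder}) sqmat"
  assumes v: "v permutes UNIV" and k: "orthogonal_matrix k"
    and cell: "real_flag k \<in> {flag (b ** complexify (signed_perm v)) | b. b \<in> lower_B}"
  shows "real_flag (iota k) \<in> {flag (b ** complexify (signed_perm (inv_into UNIV v))) | b. b \<in> lower_B}"
proof -
  let ?d = "complexify delta :: (complex, 'n) sqmat"
  let ?P = "signed_perm v"
  obtain b where b: "b \<in> lower_B" "real_flag k = flag (b ** complexify ?P)" using cell by blast
  then obtain c where c: "c \<in> upper_B" "complexify k = b ** complexify ?P ** c"
    unfolding real_flag_def by (metis flag_eq_iff)
  obtain D where D: "complexify D \<in> lower_B" "delta ** tr ?P ** delta = D ** signed_perm (inv_into UNIV v)"
    using iota_signed_perm[OF v] by blast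
  \<comment> \<open>Transposition puts the lower-triangular \<open>tr c\<close> on the left and the
    upper-triangular \<open>tr b\<close> on the right; the diagonal \<open>?d\<close> changes
    neither shape. The right factor \<open>r\<close> disappears in the flag.\<close>
  define r where "r = ?d ** tr b ** ?d"
  define l where "l = ?d ** tr c ** ?d ** complexify D"
  have r: "r \<in> upper_B"
    unfolding r_def using b(1) by (intro upper_B_mult complexify_delta) (simp add: transpose_lower_B)
  have l: "l \<in> lower_B"
    unfolding l_def using c(1) D(1) by (intro lower_B_mult complexify_delta) (simp_all add: transpose_upper_B)
  have "complexify (iota k) = ?d ** tr c ** (?d ** ?d) ** complexify (tr ?P) ** (?d ** ?d) ** tr b ** ?d"
    using c(2) by (simp add: iota_orthogonal[OF k] complexify_mult complexify_tr matrix_transpose_mul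
      complexify_delta(3) matrix_mul_assoc)
  also have "\<dots> = ?d ** tr c ** ?d ** complexify (delta ** tr ?P ** delta) ** r"
    by (simp add: r_def complexify_mult matrix_mul_assoc)
  also have "\<dots> = l ** complexify (signed_perm (inv_into UNIV v)) ** r"
    by (simp add: D(2) l_def complexify_mult matrix_mul_assoc)
  finally have "real_flag (iota k) = flag (l ** complexify (signed_perm (inv_into UNIV v)))"
    using r by (simp add: real_flag_def flag_mult_upper)
  then show ?thesis using l by blast
qed

lemma iota_upper_cell:
  fixes k :: "(real, 'n::{finite,linorder}) sqmat"
  assumes w: "w permutes UNIV" and k: "orthogonal_matrix k"
    and cell: "real_flag k \<in> {flag (b ** complexify (signed_perm w)) | b. b \<in> upper_B}"
  shows "real_flag (iota k) \<in> {flag (b ** complexify (signed_perm (inv_into UNIV w))) | b. b \<in> upper_B}"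
proof -
  let ?d = "complexify delta :: (complex, 'n) sqmat"
  let ?P = "signed_perm w"
  obtain b where b: "b \<in> upper_B" "real_flag k = flag (b ** complexify ?P)" using cell by blast
  then obtain c where c: "c \<in> upper_B" "complexify k = b ** complexify ?P ** c"
    unfolding real_flag_def by (metis flag_eq_iff)
  obtain D where D: "complexify D \<in> upper_B" "delta ** tr ?P ** delta = D ** signed_perm (inv_into UNIV w)"
    using iota_signed_perm[OF w] by blast
  let ?bi = "matrix_inv b"
  let ?ci = "matrix_inv c"
  have inv: "b ** ?bi = mat 1" "c ** ?ci = mat 1"
    using b(1) c(1) by (simp_all add: upper_B_def invertible_matrix_inv)
  have "complexify k ** (?ci ** complexify (tr ?P) ** ?bi) = b ** complexify ?P ** (c ** ?ci) ** complexify (tr ?P) ** ?bi"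
    by (simp add: c(2) matrix_mul_assoc)
  also have "\<dots> = b ** complexify (?P ** tr ?P) ** ?bi"
    by (simp add: inv complexify_mult matrix_mul_assoc)
  also have "\<dots> = mat 1"
    by (simp add: orthogonal_matrixD(2)[OF monomial_orthogonal[OF monomial_signed_perm[OF w] w]] complexify_mat_1 inv)
  finally have "matrix_inv (complexify k) = ?ci ** complexify (tr ?P) ** ?bi" by (rule matrix_inv_eqI)
  moreover have "matrix_inv (complexify k) = complexify (tr k)"
    by (rule matrix_inv_eqI) (simp add: orthogonal_matrixD(2)[OF k] complexify_mat_1 flip: complexify_mult)
  ultimately have k': "complexify (tr k) = ?ci ** complexify (tr ?P) ** ?bi" by simp
  \<comment> \<open>Inversion also reverses the order but keeps both outer factors
    upper-triangular.\<close>
  define r where "r = ?d ** ?bi ** ?d"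
  define l where "l = ?d ** ?ci ** ?d ** complexify D"
  have r: "r \<in> upper_B"
    unfolding r_def using b(1) by (intro upper_B_mult complexify_delta upper_B_matrix_inv)
  have l: "l \<in> upper_B"
    unfolding l_def using c(1) D(1) by (intro upper_B_mult complexify_delta upper_B_matrix_inv)
  have "complexify (iota k) = ?d ** ?ci ** (?d ** ?d) ** complexify (tr ?P) ** (?d ** ?d) ** ?bi ** ?d"
    by (simp add: iota_orthogonal[OF k] complexify_mult k' complexify_delta(3) matrix_mul_assoc)
  also have "\<dots> = ?d ** ?ci ** ?d ** complexify (delta ** tr ?P ** delta) ** r"
    by (simp add: r_def complexify_mult matrix_mul_assoc)
  also have "\<dots> = l ** complexify (signed_perm (inv_into UNIV w)) ** r"
    by (simp add: D(2) l_def complexify_mult matrix_mul_assoc)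
  finally have "real_flag (iota k) = flag (l ** complexify (signed_perm (inv_into UNIV w)))"
    using r by (simp add: real_flag_def flag_mult_upper)
  then show ?thesis using l by blast
qed

lemma twist_cell:
  assumes "v permutes UNIV" "w permutes UNIV" "V \<in> cell v w"
  shows "twist V \<in> cell (inv_into UNIV v) (inv_into UNIV w)"
proof -
  have nn: "V \<in> flags_nonneg" using assms(3) by (simp add: cell_def)
  then obtain k where k: "k \<in> orth_nonneg" "V = real_flag k" by (rule flags_nonnegE)
  then show ?thesis
    using assms(3) iota_lower_cell[OF assms(1) orth_nonnegD(1)[OF k(1)]] iota_upper_cell[OF assms(2) orth_nonnegD(1)[OF k(1)]]
      twist_flags_nonneg[OF nn] twist_real_flag[OF k(1)]
    unfolding cell_def by simp
qed

lemma bij_betw_twist_cell: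
  assumes "v permutes UNIV" "w permutes UNIV"
  shows "bij_betw twist (cell v w) (cell (inv_into UNIV v) (inv_into UNIV w))"
proof (rule bij_betw_byWitness[where f' = twist])
  have nn: "cell v w \<subseteq> flags_nonneg" for v w :: "'a \<Rightarrow> 'a" by (auto simp: cell_def)
  show "\<forall>V\<in>cell v w. twist (twist V) = V" "\<forall>V\<in>cell (inv_into UNIV v) (inv_into UNIV w). twist (twist V) = V"
    using nn twist_twist by blast+
  show "twist ` cell v w \<subseteq> cell (inv_into UNIV v) (inv_into UNIV w)"
    using twist_cell[OF assms] by blast
  show "twist ` cell (inv_into UNIV v) (inv_into UNIV w) \<subseteq> cell v w"
    using twist_cell[OF permutes_inv[OF assms(1)] permutes_inv[OF assms(2)]]
      permutes_inv_inv[OF assms(1)] permutes_inv_inv[OF assms(2)] by auto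
qed

subsection \<open>Smoothness\<close>

text \<open>A class of functions closed under directional derivatives; its members are therefore smooth.\<close>

inductive smooth_expr :: "'a::euclidean_space set \<Rightarrow> ('a \<Rightarrow> real) \<Rightarrow> bool" for S where
  smooth_const: "smooth_expr S (\<lambda>x. c)"
| smooth_linear: "bounded_linear f \<Longrightarrow> smooth_expr S f"
| smooth_add: "smooth_expr S f \<Longrightarrow> smooth_expr S g \<Longrightarrow> smooth_expr S (\<lambda>x. f x + g x)"
| smooth_mult: "smooth_expr S f \<Longrightarrow> smooth_expr S g \<Longrightarrow> smooth_expr S (\<lambda>x. f x * g x)"
| smooth_inverse: "smooth_expr S f \<Longrightarrow> (\<And>x. x \<in> S \<Longrightarrow> f x \<noteq> 0) \<Longrightarrow> smooth_expr S (\<lambda>x. inverse (f x))"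
| smooth_rsqrt: "smooth_expr S f \<Longrightarrow> (\<And>x. x \<in> S \<Longrightarrow> f x > 0) \<Longrightarrow> smooth_expr S (\<lambda>x. inverse (sqrt (f x)))"
| smooth_cong: "smooth_expr S f \<Longrightarrow> (\<And>x. x \<in> S \<Longrightarrow> f x = g x) \<Longrightarrow> smooth_expr S g"

lemma smooth_expr_subset: "smooth_expr S f \<Longrightarrow> T \<subseteq> S \<Longrightarrow> smooth_expr T f"
proof (induction rule: smooth_expr.induct)
  case (smooth_inverse f)
  then show ?case by (intro smooth_expr.smooth_inverse) auto
next
  case (smooth_rsqrt f)
  then show ?case by (intro smooth_expr.smooth_rsqrt) auto
next
  case (smooth_cong f g)
  then show ?case by (intro smooth_expr.smooth_cong[of T f g]) auto
qed (auto intro: smooth_expr.intros)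

lemma smooth_uminus: "smooth_expr S f \<Longrightarrow> smooth_expr S (\<lambda>x. - f x)"
  using smooth_mult[OF smooth_const[of S "-1"], of f] by simp

lemma smooth_diff: "smooth_expr S f \<Longrightarrow> smooth_expr S g \<Longrightarrow> smooth_expr S (\<lambda>x. f x - g x)"
  using smooth_add[OF _ smooth_uminus, of S f g] by simp

lemma smooth_divide:
  "smooth_expr S f \<Longrightarrow> smooth_expr S g \<Longrightarrow> (\<And>x. x \<in> S \<Longrightarrow> g x \<noteq> 0) \<Longrightarrow> smooth_expr S (\<lambda>x. f x / g x)"
  using smooth_mult[OF _ smooth_inverse, of S f g] by (simp add: divide_inverse)

lemma smooth_sum: "(\<And>i. i \<in> A \<Longrightarrow> smooth_expr S (f i)) \<Longrightarrow> smooth_expr S (\<lambda>x. \<Sum>i\<in>A. f i x)"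
  by (induction A rule: infinite_finite_induct) (simp_all add: smooth_const smooth_add)

lemma smooth_prod: "(\<And>i. i \<in> A \<Longrightarrow> smooth_expr S (f i)) \<Longrightarrow> smooth_expr S (\<lambda>x. \<Prod>i\<in>A. f i x)"
  by (induction A rule: infinite_finite_induct) (simp_all add: smooth_const smooth_mult)

text \<open>The direction is the first argument of \<open>D\<close>, so that for fixed
  \<open>v\<close> the directional derivative is again a function in the class and can be
  differentiated further.\<close>

lemma smooth_expr_has_derivative:
  assumes "smooth_expr S f" "open S"
  shows "\<exists>D. (\<forall>x\<in>S. (f has_derivative (\<lambda>v. D v x)) (at x)) \<and> (\<forall>v. smooth_expr S (D v))"
  using assms
proof (induction rule: smooth_expr.induct)
  case (smooth_const c)
  then show ?case by (intro exI[of _ "\<lambda>v x. 0"]) (simp add: smooth_expr.smooth_const)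
next
  case (smooth_linear f)
  then show ?case
    by (intro exI[of _ "\<lambda>v x. f v"]) (simp add: smooth_expr.smooth_const bounded_linear_imp_has_derivative)
next
  case (smooth_add f g)
  then obtain D E where "\<forall>x\<in>S. (f has_derivative (\<lambda>v. D v x)) (at x)" "\<forall>v. smooth_expr S (D v)"
    "\<forall>x\<in>S. (g has_derivative (\<lambda>v. E v x)) (at x)" "\<forall>v. smooth_expr S (E v)" by blast
  then show ?case
    by (intro exI[of _ "\<lambda>v x. D v x + E v x"]) (auto intro: smooth_expr.smooth_add has_derivative_add)
next
  case (smooth_mult f g)
  then obtain D E where "\<forall>x\<in>S. (f has_derivative (\<lambda>v. D v x)) (at x)" "\<forall>v. smooth_expr S (D v)"
    "\<forall>x\<in>S. (g has_derivative (\<lambda>v. E v x)) (at x)" "\<forall>v. smooth_expr S (E v)" by blast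
  note DE = this
  have "\<forall>v. smooth_expr S (\<lambda>x. f x * E v x + D v x * g x)"
    using DE smooth_mult.hyps by (simp add: smooth_expr.smooth_add smooth_expr.smooth_mult)
  moreover have "\<forall>x\<in>S. ((\<lambda>x. f x * g x) has_derivative (\<lambda>v. f x * E v x + D v x * g x)) (at x)"
    by (intro ballI has_derivative_mult) (use DE in blast)+
  ultimately show ?case by (intro exI[of _ "\<lambda>v x. f x * E v x + D v x * g x"]) blast
next
  case (smooth_inverse f)
  then obtain D where D: "\<forall>x\<in>S. (f has_derivative (\<lambda>v. D v x)) (at x)" "\<forall>v. smooth_expr S (D v)" by blast
  have inv: "smooth_expr S (\<lambda>x. inverse (f x))"
    using smooth_inverse.hyps by (intro smooth_expr.smooth_inverse)
  have "\<forall>x\<in>S. ((\<lambda>x. inverse (f x)) has_derivative (\<lambda>v. - (inverse (f x) * D v x * inverse (f x)))) (at x)"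
    by (intro ballI Deriv.has_derivative_inverse) (use D(1) smooth_inverse.hyps(2) in blast)+
  moreover have "\<forall>v. smooth_expr S (\<lambda>x. - (inverse (f x) * D v x * inverse (f x)))"
    using D(2) inv by (intro allI smooth_uminus smooth_expr.smooth_mult) auto
  ultimately show ?case by (intro exI[of _ "\<lambda>v x. - (inverse (f x) * D v x * inverse (f x))"]) blast
next
  case (smooth_rsqrt f)
  then obtain D where D: "\<forall>x\<in>S. (f has_derivative (\<lambda>v. D v x)) (at x)" "\<forall>v. smooth_expr S (D v)" by blast
  let ?r = "\<lambda>x. inverse (sqrt (f x))"
  have inv: "smooth_expr S ?r"
    using smooth_rsqrt.hyps by (intro smooth_expr.smooth_rsqrt)
  \<comment> \<open>This derivative is a multiple of the cube of the function itself, so the class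
    stays closed.\<close>
  have deriv: "((\<lambda>y. inverse (sqrt y)) has_real_derivative - (1/2) * (inverse (sqrt y) * inverse (sqrt y) * inverse (sqrt y))) (at y)"
    if "y > 0" for y :: real
    using that by (auto intro!: derivative_eq_intros simp: field_simps power2_eq_square)
  have "\<forall>x\<in>S. (?r has_derivative (\<lambda>v. D v x * (- (1/2) * (?r x * ?r x * ?r x)))) (at x)"
    using DERIV_compose_FDERIV[OF deriv] D(1) smooth_rsqrt.hyps(2) by blast
  moreover have "\<forall>v. smooth_expr S (\<lambda>x. D v x * (- (1/2) * (?r x * ?r x * ?r x)))"
    using D(2) inv by (intro allI smooth_expr.smooth_mult smooth_expr.smooth_const) auto
  ultimately show ?case by (intro exI[of _ "\<lambda>v x. D v x * (- (1/2) * (?r x * ?r x * ?r x))"]) blast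
next
  case (smooth_cong f g)
  then obtain D where D: "\<forall>x\<in>S. (f has_derivative (\<lambda>v. D v x)) (at x)" "\<forall>v. smooth_expr S (D v)" by blast
  have "(g has_derivative (\<lambda>v. D v x)) (at x)" if "x \<in> S" for x
    using D(1) that smooth_cong.hyps(2) smooth_cong.prems
    by (intro has_derivative_transform_within_open[of f _ x UNIV S g]) auto
  with D(2) show ?case by blast
qed

lemma smooth_expr_continuous:
  assumes "smooth_expr S f" "open S"
  shows "continuous_on S f"
proof -
  obtain D where "\<forall>x\<in>S. (f has_derivative (\<lambda>v. D v x)) (at x)"
    using smooth_expr_has_derivative[OF assms] by blast
  then have "\<forall>x\<in>S. isCont f x" using has_derivative_continuous by blast
  then show ?thesis by (simp add: continuous_at_imp_continuous_on)
qed

lemma smooth_expr_Ck_on: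
  fixes F :: "'a::euclidean_space \<Rightarrow> 'b::euclidean_space"
  assumes "open S" "\<And>i. i \<in> Basis \<Longrightarrow> smooth_expr S (\<lambda>x. F x \<bullet> i)"
  shows "Ck_on k F S"
  using assms(2)
proof (induction k arbitrary: F)
  case (0 F)
  then have "continuous_on S (\<lambda>x. F x \<bullet> i)" if "i \<in> Basis" for i
    using that assms(1) smooth_expr_continuous by blast
  then have "continuous_on S F" by (subst continuous_on_componentwise) blast
  then show ?case by simp
next
  case (Suc k F)
  have "\<forall>i\<in>Basis. \<exists>D. (\<forall>x\<in>S. ((\<lambda>x. F x \<bullet> i) has_derivative (\<lambda>v. D v x)) (at x)) \<and> (\<forall>v. smooth_expr S (D v))"
    using Suc.prems smooth_expr_has_derivative[OF _ assms(1)] by blast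
  then obtain D where D: "\<And>i x. i \<in> Basis \<Longrightarrow> x \<in> S \<Longrightarrow> ((\<lambda>x. F x \<bullet> i) has_derivative (\<lambda>v. D i v x)) (at x)"
    "\<And>i v. i \<in> Basis \<Longrightarrow> smooth_expr S (D i v)"
    by metis
  define F' where "F' x v = (\<Sum>i\<in>Basis. D i v x *\<^sub>R i)" for x v
  have F'_inner: "F' x v \<bullet> i = D i v x" if "i \<in> Basis" for x v i
    using that by (simp add: F'_def inner_sum_left inner_Basis if_distrib cong: if_cong)
  have F': "(F has_derivative F' x) (at x)" if "x \<in> S" for x
    using D(1)[OF _ that] by (subst has_derivative_componentwise_within) (simp add: F'_inner)
  have "Ck_on k (\<lambda>x. frechet_derivative F (at x) v) S" for v
  proof (rule Suc.IH)
    fix i :: 'b assume i: "i \<in> Basis"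
    have "frechet_derivative F (at x) v \<bullet> i = D i v x" if "x \<in> S" for x
      using frechet_derivative_at[OF F'[OF that]] F'_inner[OF i] by metis
    \<comment> \<open>The derivative is identified on \<open>S\<close> only;
      \<open>smooth_cong\<close> disregards values elsewhere.\<close>
    then show "smooth_expr S (\<lambda>x. frechet_derivative F (at x) v \<bullet> i)"
      by (intro smooth_cong[OF D(2)[OF i, of v]]) simp
  qed
  moreover have "F differentiable at x" if "x \<in> S" for x
    using F'[OF that] by (auto simp: differentiable_def)
  ultimately show ?case by simp
qed

lemma smooth_on_matrix:
  fixes F :: "'a::euclidean_space \<Rightarrow> (real, 'n::finite) sqmat"
  assumes "open S" "\<And>i j. smooth_expr S (\<lambda>x. F x $ i $ j)"
  shows "smooth_on F S"
  unfolding smooth_on_def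
proof (intro allI smooth_expr_Ck_on assms(1))
  fix b :: "(real, 'n) sqmat" assume "b \<in> Basis"
  then obtain i j where "b = axis i (axis j 1)" by (auto simp: Basis_vec_def)
  then show "smooth_expr S (\<lambda>x. F x \<bullet> b)" using assms(2)[of i j] by (simp add: inner_axis)
qed

lemma smooth_entry: "smooth_expr S (\<lambda>x :: (real, 'n::finite) sqmat. x $ i $ j)"
  by (rule smooth_linear) (intro bounded_linear_compose[OF bounded_linear_vec_nth bounded_linear_vec_nth])

lemma smooth_matrix_mult:
  assumes "\<And>i j. smooth_expr S (\<lambda>x. F x $ i $ j)" "\<And>i j. smooth_expr S (\<lambda>x. G x $ i $ j)"
  shows "smooth_expr S (\<lambda>x. (F x ** G x) $ i $ j)"
  by (simp add: matrix_matrix_mult_def) (intro smooth_sum smooth_mult assms)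

lemma smooth_det:
  assumes "\<And>i j. smooth_expr S (\<lambda>x. F x $ i $ j)"
  shows "smooth_expr S (\<lambda>x. det (F x))"
  unfolding Determinants.det_def by (intro smooth_sum smooth_mult smooth_prod smooth_const assms)

lemma smooth_minor:
  assumes "\<And>i j. smooth_expr S (\<lambda>x. F x $ i $ j)"
  shows "smooth_expr S (\<lambda>x. minor (F x) I J)"
  unfolding minor_eq_list_minor list_minor_expand
  by (intro smooth_sum smooth_mult smooth_prod smooth_const assms)

text \<open>By induction on rank. The norm enters as the square root of a sum of squares, positive
  since the residue of an invertible matrix is nonzero.\<close>

lemma smooth_gram_schmidt:
  fixes A :: "'a::euclidean_space \<Rightarrow> (real, 'n::{finite,linorder}) sqmat"
  assumes A: "\<And>i j. smooth_expr S (\<lambda>x. A x $ i $ j)" and inv: "\<And>x. x \<in> S \<Longrightarrow> invertible (A x)"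
  shows "smooth_expr S (\<lambda>x. gram_schmidt (A x) j $ r)"
proof (induction j arbitrary: r rule: pos_induct)
  case (less j)
  have res: "smooth_expr S (\<lambda>x. orth_residue (A x) j $ r)" for r
    unfolding orth_residue_def
    by (simp add: inner_vec_def column_def)
      (intro smooth_diff smooth_sum smooth_mult A less.IH; simp)
  have "smooth_expr S (\<lambda>x. \<Sum>l\<in>UNIV. orth_residue (A x) j $ l * orth_residue (A x) j $ l)"
    by (intro smooth_sum smooth_mult res)
  then have "smooth_expr S (\<lambda>x. orth_residue (A x) j \<bullet> orth_residue (A x) j)"
    by (simp add: inner_vec_def)
  then have "smooth_expr S (\<lambda>x. inverse (sqrt (orth_residue (A x) j \<bullet> orth_residue (A x) j)) * orth_residue (A x) j $ r)"
    using orth_residue_nonzero[OF inv] by (intro smooth_mult smooth_rsqrt res) simp_all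
  then show ?case
    by (simp add: gram_schmidt_eq[of _ j] norm_eq_sqrt_inner divide_inverse)
qed

lemma smooth_reduced:
  fixes B :: "'a::euclidean_space \<Rightarrow> (real, 'n::{finite,linorder}) sqmat"
  assumes B: "\<And>i j. smooth_expr S (\<lambda>x. B x $ i $ j)"
    and ne: "\<And>x j. x \<in> S \<Longrightarrow> det (leading_mat (B x) j) \<noteq> 0"
  shows "smooth_expr S (\<lambda>x. reduced (B x) $ i $ j)"
proof -
  have lead: "smooth_expr S (\<lambda>x. leading_mat (B x) j $ r $ c)" for r c
    by (cases "c \<le> j") (simp_all add: leading_mat_def B smooth_const)
  have num: "smooth_expr S (\<lambda>x. det (\<chi> r c. if c = i then (if r = j then 1 else 0) else leading_mat (B x) j $ r $ c))"
  proof (rule smooth_det)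
    fix r c
    show "smooth_expr S (\<lambda>x. (\<chi> r c. if c = i then (if r = j then 1 else 0) else leading_mat (B x) j $ r $ c) $ r $ c)"
      by (cases "c = i") (simp_all add: smooth_const lead)
  qed
  show ?thesis
  proof (cases "j < i")
    case True
    then show ?thesis unfolding reduced_def
      by simp (intro smooth_uminus smooth_divide num smooth_det lead ne)
  qed (simp add: reduced_def smooth_const)
qed

section \<open>The twist in charts of the real flag variety\<close>

lemma left_sum_gs_matrix:
  fixes A :: "(real, 'n::{finite,linorder}) sqmat"
  assumes "invertible A" "left_sum A m > 0"
  shows "left_sum (gs_matrix A) m > 0"
proof -
  obtain R where R: "R \<in> upper_B" "\<And>j. R $ j $ j > 0" "A = gs_matrix A ** R"
    using qr_decomposition[OF assms(1)] by blast
  have "left_sum A m = left_sum (gs_matrix A) m * (\<Prod>j\<in>initial m. R $ j $ j)"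
    unfolding left_sum_def sum_distrib_right
    by (intro sum.cong refl) (subst R(3), rule minor_mult_upper, use upper_B_zero[OF R(1)] in auto)
  moreover have "(\<Prod>j\<in>initial m. R $ j $ j) > 0" using R(2) by (intro prod_pos) simp
  ultimately show ?thesis using assms(2) by (simp add: zero_less_mult_iff)
qed

lemma real_flag_gs_matrix: "invertible A \<Longrightarrow> real_flag (gs_matrix A) = real_flag A"
  using qr_decomposition real_flag_mult_upper by metis

lemma left_sum_card: "left_sum (A :: (real, 'n::{finite,linorder}) sqmat) (card (initial m :: 'n set)) = left_sum A m"
  by (simp add: left_sum_def initial_card_initial)

text \<open>Near \<open>V = k B\<close> the orthogonal representative is the Gram--Schmidt orthonormalization, since positivity
  of the sums of left-justified minors, an open condition, fixes the signs.\<close>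

lemma flag_smooth_on_twist:
  fixes A :: "'n::{finite,linorder} flag set"
  assumes "A \<subseteq> flags_nonneg" "\<And>V. V \<in> A \<Longrightarrow> f V = twist V"
  shows "flag_smooth_on f A"
  unfolding flag_smooth_on_def
proof
  fix V assume "V \<in> A"
  then obtain k where k: "k \<in> orth_nonneg" "V = real_flag k" using assms(1) flags_nonnegE by blast
  have orth: "orthogonal_matrix k" by (rule orth_nonnegD[OF k(1)])
  have invk: "invertible k" using orth by (rule invertible_orthogonal)
  \<comment> \<open>Centering the target chart here makes \<open>B 0\<close> the identity, so all
    determinants of \<open>leading_mat (B x) j\<close> are nonzero at the base point and hence
    nearby.\<close>
  define h where "h = iota k"
  have h: "orthogonal_matrix h" using orth by (simp add: h_def orthogonal_iota)
  define M where "M x = k ** (mat 1 + x)" for x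
  define S where "S = {x. det (M x) \<noteq> 0}"
  define q where "q x = gs_matrix (M x)" for x
  \<comment> \<open>For \<open>x\<close> in \<open>S\<close> the product \<open>h ** B x\<close> is
    \<open>iota (q x)\<close>; column reduction of \<open>B x\<close> therefore yields the
    coordinates of its flag in the chart at \<open>h\<close>.\<close>
  define B where "B x = tr h ** (delta ** tr (q x) ** delta)" for x
  \<comment> \<open>Since \<open>left_sum\<close> depends on \<open>m\<close> only through
    \<open>card (initial m)\<close>, finitely many conditions suffice, which keeps \<open>S1\<close>
    open.\<close>
  define S1 where "S1 = S \<inter> (\<Inter>m\<in>{..CARD('n)}. {x. left_sum (M x) m > 0})"
  define W where "W = S1 \<inter> (\<Inter>j. S1 \<inter> (\<lambda>x. det (leading_mat (B x) j)) -` (- {0}))"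
  have M_smooth: "smooth_expr T (\<lambda>x. M x $ i $ j)" for T i j
  proof -
    have "smooth_expr T (\<lambda>x. (mat 1 + x) $ i $ j)" for i j :: 'n
      unfolding vector_add_component by (intro smooth_add smooth_const smooth_entry)
    then show ?thesis unfolding M_def by (intro smooth_matrix_mult smooth_const)
  qed
  have inv: "invertible (M x)" if "x \<in> S" for x
    using that by (simp add: S_def invertible_det_nz)
  have "open S"
    unfolding S_def
    by (intro open_Collect_neq smooth_expr_continuous[OF smooth_det] continuous_on_const M_smooth open_UNIV)
  moreover have "open {x. left_sum (M x) m > 0}" for m
    unfolding left_sum_def
    by (intro open_Collect_less smooth_expr_continuous smooth_sum smooth_minor continuous_on_const M_smooth open_UNIV)
  ultimately have "open S1" unfolding S1_def by (intro open_Int open_INT) auto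
  have orthq: "orthogonal_matrix (q x)" if "x \<in> S" for x
    unfolding q_def by (rule orthogonal_gs_matrix[OF inv[OF that]])
  have q_sum: "left_sum (q x) m > 0" if x: "x \<in> S1" for x m
  proof -
    have "left_sum (M x) (card (initial m :: 'n set)) > 0"
      using x by (auto simp: S1_def card_initial)
    then show ?thesis
      unfolding q_def left_sum_card by (intro left_sum_gs_matrix inv) (use x in \<open>auto simp: S1_def\<close>)
  qed
  have q_smooth: "smooth_expr S1 (\<lambda>x. q x $ i $ j)" for i j
    unfolding q_def gs_matrix_def
    by simp (intro smooth_gram_schmidt M_smooth inv, simp add: S1_def)
  have B_smooth: "smooth_expr S1 (\<lambda>x. B x $ i $ j)" for i j
    unfolding B_def by (intro smooth_matrix_mult smooth_const) (simp add: q_smooth)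
  have lead_smooth: "smooth_expr S1 (\<lambda>x. det (leading_mat (B x) j))" for j
  proof (rule smooth_det)
    show "smooth_expr S1 (\<lambda>x. leading_mat (B x) j $ r $ c)" for r c
      by (cases "c \<le> j") (simp_all add: leading_mat_def B_smooth smooth_const)
  qed
  have "open (S1 \<inter> (\<lambda>x. det (leading_mat (B x) j)) -` (- {0}))" for j
    using smooth_expr_continuous[OF lead_smooth \<open>open S1\<close>] \<open>open S1\<close> by (rule continuous_open_preimage) auto
  then have "open W" unfolding W_def using \<open>open S1\<close> by (intro open_Int open_INT) auto
  have M0: "M 0 = k" by (simp add: M_def)
  have "0 \<in> S1"
    using invk orth_nonneg_left_sum[OF k(1)] by (simp add: S1_def S_def M0 invertible_det_nz[symmetric])
  have q0: "q 0 = k"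
  proof (rule orthogonal_rep_unique[OF orth])
    show "orthogonal_matrix (q 0)" using orthq \<open>0 \<in> S1\<close> by (simp add: S1_def)
    show "real_flag k = real_flag (q 0)" by (simp add: q_def M0 real_flag_gs_matrix invk)
    show "left_sum k m > 0" "left_sum (q 0) m > 0" for m
      using orth_nonneg_left_sum[OF k(1)] q_sum[OF \<open>0 \<in> S1\<close>] by auto
  qed
  have "B 0 = mat 1"
    using orthogonal_matrixD(1)[OF h] by (simp add: B_def q0 h_def iota_orthogonal orth)
  moreover have "leading_mat (mat 1) j = (mat 1 :: (real, 'n) sqmat)" for j
    by (simp add: leading_mat_def Finite_Cartesian_Product.vec_eq_iff)
  ultimately have "0 \<in> W" using \<open>0 \<in> S1\<close> by (simp add: W_def)
  define F where "F x = reduced (B x)" for x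
  have ne: "det (leading_mat (B x) j) \<noteq> 0" if "x \<in> W" for x j
    using that by (auto simp: W_def)
  have WS: "W \<subseteq> S1" "W \<subseteq> S" by (auto simp: W_def S1_def)
  have "smooth_on F W"
    unfolding F_def
    by (intro smooth_on_matrix smooth_reduced \<open>open W\<close> ne smooth_expr_subset[OF B_smooth WS(1)])
  moreover have "F ` W \<subseteq> strictly_lower"
    by (auto simp: F_def strictly_lower_def reduced_upper_zero)
  moreover have "f (flag_chart k x) = flag_chart h (F x)" if x: "x \<in> W" and A: "flag_chart k x \<in> A" for x
  proof -
    have xS: "x \<in> S" "x \<in> S1" using x WS by auto
    have chart: "flag_chart k x = real_flag (q x)"
      using real_flag_gs_matrix[OF inv[OF xS(1)]] by (simp add: flag_chart_def q_def M_def)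
    obtain k' where k': "k' \<in> orth_nonneg" "flag_chart k x = real_flag k'"
      using A assms(1) flags_nonnegE by blast
    \<comment> \<open>Both matrices are orthogonal, have positive \<open>left_sum\<close> and
      represent the same flag. That the flag lies in \<open>A\<close> guarantees the nonnegative
      representative \<open>k'\<close>.\<close>
    have "q x = k'"
      using orthogonal_rep_unique[of k' "q x"] orth_nonnegD(1)[OF k'(1)] orthq[OF xS(1)] k'(2) chart
        orth_nonneg_left_sum[OF k'(1)] q_sum[OF xS(2)] by simp
    then have tw: "f (flag_chart k x) = real_flag (iota (q x))"
      using assms(2)[OF A] twist_real_flag[OF k'(1)] k'(2) by simp
    obtain Y where Y: "Y \<in> upper_B" "B x ** Y = mat 1 + F x"
      using column_reduction_upper_B[of "B x"] ne[OF x] unfolding F_def by blast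
    have "h ** (mat 1 + F x) = (h ** tr h) ** (delta ** tr (q x) ** delta) ** Y"
      unfolding Y(2)[symmetric] B_def by (simp add: matrix_mul_assoc)
    also have "\<dots> = iota (q x) ** Y"
      by (simp add: orthogonal_matrixD(2)[OF h] iota_orthogonal[OF orthq[OF xS(1)]])
    finally have eq: "h ** (mat 1 + F x) = iota (q x) ** Y" .
    show ?thesis
      unfolding tw by (simp only: flag_chart_def eq real_flag_mult_upper[OF Y(1)])
  qed
  moreover have "flag_chart k 0 = V" by (simp add: flag_chart_def k(2))
  moreover have "k \<in> GL" "h \<in> GL" "0 \<in> strictly_lower"
    using invk invertible_orthogonal[OF h] by (simp_all add: GL_def strictly_lower_def)
  ultimately show "\<exists>g\<in>GL. \<exists>h\<in>GL. \<exists>x0\<in>strictly_lower. flag_chart g x0 = V \<and>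
     (\<exists>W F. open W \<and> x0 \<in> W \<and> smooth_on F W \<and> F ` W \<subseteq> strictly_lower \<and>
        (\<forall>x \<in> W \<inter> strictly_lower. flag_chart g x \<in> A \<longrightarrow> f (flag_chart g x) = flag_chart h (F x)))"
    using \<open>open W\<close> \<open>0 \<in> W\<close>
    by (intro bexI[of _ k] bexI[of _ h] bexI[of _ 0] conjI exI[of _ W] exI[of _ F]) auto
qed

theorem theorem3p26:
  shows "twist ` (flags_pos :: 'n::{finite,linorder} flag set) = flags_pos \<and>
    twist ` (flags_nonneg :: 'n flag set) = flags_nonneg \<and>
    (\<forall>v w :: 'n \<Rightarrow> 'n. v permutes UNIV \<and> w permutes UNIV \<and> bruhat_le v w \<longrightarrow>
      flag_diffeomorphism twist (cell v w) (cell (inv_into UNIV v) (inv_into UNIV w)))"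
proof (intro conjI allI impI)
  fix v w :: "'n \<Rightarrow> 'n"
  assume "v permutes UNIV \<and> w permutes UNIV \<and> bruhat_le v w"
  then have bij: "bij_betw twist (cell v w) (cell (inv_into UNIV v) (inv_into UNIV w))"
    by (intro bij_betw_twist_cell) auto
  have nn: "cell v w \<subseteq> flags_nonneg" for v w :: "'n \<Rightarrow> 'n" by (auto simp: cell_def)
  \<comment> \<open>The inverse bijection agrees with \<open>twist\<close> on the target cell, so
    \<open>flag_smooth_on_twist\<close>, stated for any \<open>f\<close> with this property, covers
    both directions.\<close>
  have "inv_into (cell v w) twist V = twist V" if V: "V \<in> cell (inv_into UNIV v) (inv_into UNIV w)" for V
  proof -
    obtain U where U: "U \<in> cell v w" "V = twist U" using bij V by (auto simp: bij_betw_def)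
    then show ?thesis
      using inv_into_f_f[OF bij_betw_imp_inj_on[OF bij] U(1)] twist_twist nn by (metis subsetD)
  qed
  then show "flag_diffeomorphism twist (cell v w) (cell (inv_into UNIV v) (inv_into UNIV w))"
    using bij nn by (simp add: flag_diffeomorphism_def flag_smooth_on_twist)
qed (simp_all add: twist_image_pos twist_image_nonneg)

end
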